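(* Let $M$ be a manifold, $H$ a real closed 3-form, and $\mathcal J$ a generalized complex structure on $E=(T\oplus T^*,[\cdot,\cdot]_H)$ whose canonical line bundle $K$ satisfies $c_1(K)=0$. Let $\rho\in C^\infty(K)$ be a non-vanishing section with $$d_H\rho=v\cdot\rho,\qquad v\in C^\infty(E).$$ Then $X=-2\pi(\mathcal Jv)$ is the modular vector field associated to the Poisson structure $P=\pi\circ\mathcal J|_{T^*}$ and the volume form $(\rho,\overline\rho)$.
   Context: Let $T=TM$, $\pi:T\oplus T^*\to T$ the projection, with inner product $\langle X+\xi,Y+\eta\rangle=\tfrac12(\xi(Y)+\eta(X))$ and bracket $[X+\xi,Y+\eta]_H=[X,Y]+\mathcal L_X\eta-i_Yd\xi+i_Xi_YH$. A generalized complex structure on $E$ is an endomorphism $\mathcal J$ of $T\oplus T^*$ with $\mathcal J^2=-1$ whose $+i$-eigenbundle $L\subset E\otimes\mathbb C$ is involutive for the bracket. Here $E$ is the real bundle, so $v$ is a real section. Elements of $E\otimes\mathbb C$ act on forms by $(X+\xi)\cdot\varphi=i_X\varphi+\xi\wedge\varphi$, and $d_H\varphi=d\varphi+H\wedge\varphi$. The canonical line bundle $K\subset\wedge^\bullet T^*\otimes\mathbb C$ is the complex line bundle of forms annihilated by $L$. The Mukai pairing of forms is $(s,t)=[s^\top\wedge t]_{m}$, the component of degree $m=\dim M$, where $\top$ is the reversal antiautomorphism (multiplication by $(-1)^{k(k-1)/2}$ in degree $k$). The (possibly complex-valued) top-degree form $(\rho,\overline\rho)$ is nowhere vanishing. The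 map $P=\pi\circ\mathcal J|_{T^*}:T^*\to T$ is a Poisson structure. For a bivector field $\beta$ regarded as a map $T^*\to T$, $\xi\mapsto i_\xi\beta$, its action on forms is $e^\beta\varphi=(1+i_\beta+\tfrac12i_\beta^2+\cdots)\varphi$, where for $\beta=\tfrac12\beta^{ij}e_i\wedge e_j$, $i_\beta\varphi=\tfrac12\beta^{ij}i_{e_j}i_{e_i}\varphi$; with this convention $e^\beta\nu$, for $\nu$ a volume form, is annihilated by $\{i_\xi\beta+\xi:\xi\in T^*\}$. The modular vector field of a Poisson structure $\beta$ with respect to a volume form (nowhere-vanishing top-degree form) $\nu$ is the unique vector field $X_\nu$ with $d(e^\beta\nu)=i_{X_\nu}(e^\beta\nu)$. *)

theory Defs
  imports "HOL-Analysis.Analysis"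
begin

section \<open>Smooth functions on open subsets of a Euclidean space\<close>

text \<open>Both predicates are meant for open sets only: differentiability is taken at the
  points of the set in the ambient space, and the derivatives are the directional ones.\<close>

primrec Ck_on :: "nat \<Rightarrow> 'a::euclidean_space set \<Rightarrow> ('a \<Rightarrow> 'b::real_normed_vector) \<Rightarrow> bool" where
  "Ck_on 0 S f \<longleftrightarrow> continuous_on S f"
| "Ck_on (Suc k) S f \<longleftrightarrow>
     (\<forall>x\<in>S. f differentiable (at x)) \<and>
     (\<forall>v. Ck_on k S (\<lambda>x. frechet_derivative f (at x) v))"

definition smooth_on :: "'a::euclidean_space set \<Rightarrow> ('a \<Rightarrow> 'b::real_normed_vector) \<Rightarrow> bool" where
  "smooth_on S f \<longleftrightarrow> (\<forall>k. Ck_on k S f)"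


section \<open>Smooth manifolds\<close>

text \<open>A chart is an open domain together with its coordinate map. The underlying topological
  space of the manifold is the whole type \<open>'m\<close> (Hausdorff and second countable in the
  statement), and the dimension is \<open>DIM('e)\<close>. Every smooth atlas determines the same objects
  as the maximal atlas containing it, so maximality is not imposed.\<close>

type_synonym ('m, 'e) chart = "'m set \<times> ('m \<Rightarrow> 'e)"

definition chart_inv :: "('m, 'e) chart \<Rightarrow> 'e \<Rightarrow> 'm" where
  "chart_inv c = inv_into (fst c) (snd c)"

definition region :: "('m, 'e) chart \<Rightarrow> 'm set \<Rightarrow> 'e set" where
  "region c U = snd c ` (fst c \<inter> U)"

definition transition :: "('m, 'e) chart \<Rightarrow> ('m, 'e) chart \<Rightarrow> 'e \<Rightarrow> 'e" where
  "transition c c' = snd c' \<circ> chart_inv c"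

definition smooth_atlas :: "('m::topological_space, 'e::euclidean_space) chart set \<Rightarrow> bool" where
  "smooth_atlas A \<longleftrightarrow>
     (\<Union>c\<in>A. fst c) = UNIV \<and>
     (\<forall>c\<in>A. open (fst c) \<and> open (region c UNIV) \<and>
        homeomorphism (fst c) (region c UNIV) (snd c) (chart_inv c)) \<and>
     (\<forall>c\<in>A. \<forall>c'\<in>A. smooth_on (region c (fst c')) (transition c c'))"

abbreviation jacobian ::
  "('m, 'e::euclidean_space) chart \<Rightarrow> ('m, 'e) chart \<Rightarrow> 'e \<Rightarrow> 'e \<Rightarrow> 'e" where
  "jacobian c c' x \<equiv> frechet_derivative (transition c c') (at x)"

definition smooth_function ::
  "('m, 'e::euclidean_space) chart set \<Rightarrow> 'm set \<Rightarrow> ('m \<Rightarrow> 'b::real_normed_vector) \<Rightarrow> bool" where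
  "smooth_function A U f \<longleftrightarrow> (\<forall>c\<in>A. smooth_on (region c U) (f \<circ> chart_inv c))"

text \<open>A section of a natural bundle (vector fields, forms, sections of \<open>T \<oplus> T*\<close>, ...) is a
  family, indexed by the charts \<open>c\<close>, of functions on the coordinate image of \<open>c\<close>, any two of
  which are related on overlaps by the transition map and its derivative. The values outside
  the coordinate images, and for charts outside the atlas, carry no meaning.\<close>

definition vector_field ::
  "('m, 'e::euclidean_space) chart set \<Rightarrow> (('m, 'e) chart \<Rightarrow> 'e \<Rightarrow> 'e) \<Rightarrow> bool" where
  "vector_field A X \<longleftrightarrow>
     (\<forall>c\<in>A. smooth_on (region c UNIV) (X c)) \<and>
     (\<forall>c\<in>A. \<forall>c'\<in>A. \<forall>x\<in>region c (fst c').
        X c' (transition c c' x) = jacobian c c' x (X c x))"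


section \<open>Differential forms\<close>

text \<open>An element of \<open>\<Lambda>* V* \<otimes> k\<close>, possibly of mixed degree, is a function on lists of vectors
  which is multilinear and alternating on the lists of each length; its restriction to the
  lists of length \<open>k\<close> is its component of degree \<open>k\<close>.\<close>

type_synonym ('e, 'k) form = "'e list \<Rightarrow> 'k"

definition alternating_form :: "('e::real_vector, 'k::real_vector) form \<Rightarrow> bool" where
  "alternating_form \<phi> \<longleftrightarrow>
     (\<forall>vs. \<forall>i<length vs. linear (\<lambda>z. \<phi> (vs[i := z]))) \<and>
     (\<forall>vs i j. i < j \<and> j < length vs \<and> vs ! i = vs ! j \<longrightarrow> \<phi> vs = 0)"

definition has_degree :: "nat \<Rightarrow> ('e, 'k::zero) form \<Rightarrow> bool" where
  "has_degree k \<phi> \<longleftrightarrow> (\<forall>vs. length vs \<noteq> k \<longrightarrow> \<phi> vs = 0)"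

definition contract :: "'e \<Rightarrow> ('e, 'k) form \<Rightarrow> ('e, 'k) form" where
  "contract X \<phi> = (\<lambda>vs. \<phi> (X # vs))"

text \<open>The sum runs over the shuffles, given by the set \<open>S\<close> of the positions whose vectors are
  fed to the first factor; the exponent counts the inversions. There are no factorials, so
  that for 1-forms \<open>(\<xi> \<and> \<eta>)(X, Y) = \<xi>(X) \<eta>(Y) - \<xi>(Y) \<eta>(X)\<close>.\<close>

definition wedge :: "('e, 'k::comm_ring_1) form \<Rightarrow> ('e, 'k) form \<Rightarrow> ('e, 'k) form" where
  "wedge \<alpha> \<beta> = (\<lambda>vs. \<Sum>S\<in>Pow {..<length vs}.
     (-1) ^ card {(i, j). i < j \<and> j \<in> S \<and> i \<in> {..<length vs} - S} *
     \<alpha> (nths vs S) * \<beta> (nths vs ({..<length vs} - S)))"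

definition one_form :: "('e::real_normed_vector \<Rightarrow>\<^sub>L real) \<Rightarrow> ('e, 'k::real_algebra_1) form" where
  "one_form \<xi> = (\<lambda>vs. if length vs = 1 then of_real (blinfun_apply \<xi> (vs ! 0)) else 0)"

definition complexify :: "('e, real) form \<Rightarrow> ('e, complex) form" where
  "complexify \<phi> = (\<lambda>vs. complex_of_real (\<phi> vs))"

definition cnj_form :: "('e, complex) form \<Rightarrow> ('e, complex) form" where
  "cnj_form \<phi> = (\<lambda>vs. cnj (\<phi> vs))"

definition reversal :: "('e, 'k::comm_ring_1) form \<Rightarrow> ('e, 'k) form" where
  "reversal \<phi> = (\<lambda>vs. (-1) ^ (length vs * (length vs - 1) div 2) * \<phi> vs)"

definition mukai ::
  "('e::euclidean_space, 'k::comm_ring_1) form \<Rightarrow> ('e, 'k) form \<Rightarrow> ('e, 'k) form" where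
  "mukai s t = (\<lambda>vs. if length vs = DIM('e) then wedge (reversal s) t vs else 0)"

text \<open>Exterior derivative of a form on an open subset of \<open>'e\<close>: for constant vectors
  \<open>d\<omega>(v\<^sub>0, \<dots>, v\<^sub>k) = \<Sum>\<^sub>i (-1)\<^sup>i D\<omega>(v\<^sub>i)(v\<^sub>0, \<dots>, v\<^sub>k without v\<^sub>i)\<close>.\<close>

definition ext_d ::
  "('e::euclidean_space \<Rightarrow> ('e, 'k::real_normed_vector) form) \<Rightarrow> 'e \<Rightarrow> ('e, 'k) form" where
  "ext_d \<omega> x = (\<lambda>vs. \<Sum>i<length vs.
     (-1) ^ i *\<^sub>R frechet_derivative (\<lambda>y. \<omega> y (take i vs @ drop (Suc i) vs)) (at x) (vs ! i))"

definition twisted_d ::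
  "('e::euclidean_space \<Rightarrow> ('e, real) form) \<Rightarrow> ('e \<Rightarrow> ('e, complex) form)
     \<Rightarrow> 'e \<Rightarrow> ('e, complex) form" where
  "twisted_d H \<phi> x = (\<lambda>vs. ext_d \<phi> x vs + wedge (complexify (H x)) (\<phi> x) vs)"

definition form_field ::
  "('m, 'e::euclidean_space) chart set \<Rightarrow> 'm set \<Rightarrow>
     (('m, 'e) chart \<Rightarrow> 'e \<Rightarrow> ('e, 'k::real_normed_vector) form) \<Rightarrow> bool" where
  "form_field A U \<omega> \<longleftrightarrow>
     (\<forall>c\<in>A. (\<forall>x\<in>region c U. alternating_form (\<omega> c x)) \<and>
             (\<forall>vs. smooth_on (region c U) (\<lambda>x. \<omega> c x vs))) \<and>
     (\<forall>c\<in>A. \<forall>c'\<in>A. \<forall>x\<in>region c (fst c' \<inter> U). \<forall>vs.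
        \<omega> c x vs = \<omega> c' (transition c c' x) (map (jacobian c c' x) vs))"

definition nonvanishing_on ::
  "('m, 'e) chart set \<Rightarrow> 'm set \<Rightarrow> (('m, 'e) chart \<Rightarrow> 'e \<Rightarrow> ('e, 'k::zero) form) \<Rightarrow> bool" where
  "nonvanishing_on A U \<omega> \<longleftrightarrow> (\<forall>c\<in>A. \<forall>x\<in>region c U. \<exists>vs. \<omega> c x vs \<noteq> 0)"

definition closed_three_form ::
  "('m, 'e::euclidean_space) chart set \<Rightarrow> (('m, 'e) chart \<Rightarrow> 'e \<Rightarrow> ('e, real) form) \<Rightarrow> bool" where
  "closed_three_form A H \<longleftrightarrow> form_field A UNIV H \<and>
     (\<forall>c\<in>A. \<forall>x\<in>region c UNIV. has_degree 3 (H c x) \<and> (\<forall>vs. ext_d (H c) x vs = 0))"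

definition volume_form ::
  "('m, 'e::euclidean_space) chart set \<Rightarrow> (('m, 'e) chart \<Rightarrow> 'e \<Rightarrow> ('e, complex) form) \<Rightarrow> bool" where
  "volume_form A \<nu> \<longleftrightarrow> form_field A UNIV \<nu> \<and>
     (\<forall>c\<in>A. \<forall>x\<in>region c UNIV. has_degree DIM('e) (\<nu> c x)) \<and> nonvanishing_on A UNIV \<nu>"


section \<open>The generalized tangent bundle\<close>

type_synonym 'e gtan = "'e \<times> ('e \<Rightarrow>\<^sub>L real)"

definition related :: "('e::euclidean_space \<Rightarrow> 'e) \<Rightarrow> 'e gtan \<Rightarrow> 'e gtan \<Rightarrow> bool" where
  "related B u u' \<longleftrightarrow> fst u' = B (fst u) \<and>
     (\<forall>z. blinfun_apply (snd u) z = blinfun_apply (snd u') (B z))"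

definition gen_section ::
  "('m, 'e::euclidean_space) chart set \<Rightarrow> (('m, 'e) chart \<Rightarrow> 'e \<Rightarrow> 'e gtan) \<Rightarrow> bool" where
  "gen_section A v \<longleftrightarrow>
     (\<forall>c\<in>A. smooth_on (region c UNIV) (v c)) \<and>
     (\<forall>c\<in>A. \<forall>c'\<in>A. \<forall>x\<in>region c (fst c').
        related (jacobian c c' x) (v c x) (v c' (transition c c' x)))"

definition gen_endomorphism ::
  "('m, 'e::euclidean_space) chart set \<Rightarrow> (('m, 'e) chart \<Rightarrow> 'e \<Rightarrow> 'e gtan \<Rightarrow> 'e gtan) \<Rightarrow> bool" where
  "gen_endomorphism A J \<longleftrightarrow>
     (\<forall>c\<in>A. (\<forall>x\<in>region c UNIV. linear (J c x)) \<and>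
             (\<forall>u. smooth_on (region c UNIV) (\<lambda>x. J c x u))) \<and>
     (\<forall>c\<in>A. \<forall>c'\<in>A. \<forall>x\<in>region c (fst c'). \<forall>u u'.
        related (jacobian c c' x) u u' \<longrightarrow>
        related (jacobian c c' x) (J c x u) (J c' (transition c c' x) u'))"

definition clifford ::
  "'e::euclidean_space gtan \<Rightarrow> ('e, complex) form \<Rightarrow> ('e, complex) form" where
  "clifford u \<phi> = (\<lambda>vs. contract (fst u) \<phi> vs + wedge (one_form (snd u)) \<phi> vs)"

definition lie_bracket ::
  "('e::euclidean_space \<Rightarrow> 'e) \<Rightarrow> ('e \<Rightarrow> 'e) \<Rightarrow> 'e \<Rightarrow> 'e" where
  "lie_bracket X Y x =
     frechet_derivative Y (at x) (X x) - frechet_derivative X (at x) (Y x)"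

text \<open>The Lie derivative of a 1-form, by Cartan's formula \<open>L\<^sub>X \<eta> = d(\<eta>(X)) + i\<^sub>X d\<eta>\<close>.\<close>

definition lie_derivative ::
  "('e::euclidean_space \<Rightarrow> 'e) \<Rightarrow> ('e \<Rightarrow> 'e \<Rightarrow>\<^sub>L real) \<Rightarrow> 'e \<Rightarrow> 'e \<Rightarrow>\<^sub>L real" where
  "lie_derivative X \<eta> x = Blinfun (\<lambda>z.
     frechet_derivative (\<lambda>y. blinfun_apply (\<eta> y) (X y)) (at x) z +
     contract (X x) (ext_d (\<lambda>y. one_form (\<eta> y)) x) [z])"

definition gen_bracket ::
  "('e::euclidean_space \<Rightarrow> ('e, real) form) \<Rightarrow> ('e \<Rightarrow> 'e gtan) \<Rightarrow> ('e \<Rightarrow> 'e gtan)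
     \<Rightarrow> 'e \<Rightarrow> 'e gtan" where
  "gen_bracket H a b x =
     (let X = fst \<circ> a; \<xi> = snd \<circ> a; Y = fst \<circ> b; \<eta> = snd \<circ> b in
      (lie_bracket X Y x,
       lie_derivative X \<eta> x
       - Blinfun (\<lambda>z. contract (Y x) (ext_d (\<lambda>y. one_form (\<xi> y)) x) [z])
       + Blinfun (\<lambda>z. contract (X x) (contract (Y x) (H x)) [z])))"

text \<open>A vector \<open>a + i b\<close> of the complexification is the pair \<open>(a, b)\<close> of its real and
  imaginary parts. Hence the condition \<open>J (a + i b) = i (a + i b) = - b + i a\<close>, and the
  complex bilinear extension of the bracket.\<close>

definition eigenbundle :: "('e::euclidean_space gtan \<Rightarrow> 'e gtan) \<Rightarrow> ('e gtan \<times> 'e gtan) set" where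
  "eigenbundle J = {(a, b). J a = - b \<and> J b = a}"

definition complex_bracket ::
  "('e::euclidean_space \<Rightarrow> ('e, real) form) \<Rightarrow> ('e \<Rightarrow> 'e gtan \<times> 'e gtan) \<Rightarrow>
     ('e \<Rightarrow> 'e gtan \<times> 'e gtan) \<Rightarrow> 'e \<Rightarrow> 'e gtan \<times> 'e gtan" where
  "complex_bracket H p q x =
     (gen_bracket H (fst \<circ> p) (fst \<circ> q) x - gen_bracket H (snd \<circ> p) (snd \<circ> q) x,
      gen_bracket H (fst \<circ> p) (snd \<circ> q) x + gen_bracket H (snd \<circ> p) (fst \<circ> q) x)"

text \<open>Involutivity concerns the local sections of \<open>L\<close>; those over an open subset of a chart
  domain are the smooth functions on an open subset \<open>V\<close> of the coordinate image, and these
  open sets form a basis of the topology. Orthogonality of \<open>J\<close> is not part of the definition.\<close>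

definition generalized_complex ::
  "('m, 'e::euclidean_space) chart set \<Rightarrow> (('m, 'e) chart \<Rightarrow> 'e \<Rightarrow> ('e, real) form) \<Rightarrow>
     (('m, 'e) chart \<Rightarrow> 'e \<Rightarrow> 'e gtan \<Rightarrow> 'e gtan) \<Rightarrow> bool" where
  "generalized_complex A H J \<longleftrightarrow>
     gen_endomorphism A J \<and>
     (\<forall>c\<in>A. \<forall>x\<in>region c UNIV. \<forall>u. J c x (J c x u) = - u) \<and>
     (\<forall>c\<in>A. \<forall>V p q. open V \<and> V \<subseteq> region c UNIV \<and> smooth_on V p \<and> smooth_on V q \<and>
        (\<forall>x\<in>V. p x \<in> eigenbundle (J c x) \<and> q x \<in> eigenbundle (J c x)) \<longrightarrow>
        (\<forall>x\<in>V. complex_bracket (H c) p q x \<in> eigenbundle (J c x)))"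


section \<open>The canonical line bundle\<close>

definition canonical_fibre ::
  "('e::euclidean_space gtan \<Rightarrow> 'e gtan) \<Rightarrow> ('e, complex) form set" where
  "canonical_fibre J = {\<phi>. alternating_form \<phi> \<and>
     (\<forall>(a, b)\<in>eigenbundle J. \<forall>vs. clifford a \<phi> vs + \<i> * clifford b \<phi> vs = 0)}"

definition canonical_section ::
  "('m, 'e::euclidean_space) chart set \<Rightarrow> (('m, 'e) chart \<Rightarrow> 'e \<Rightarrow> 'e gtan \<Rightarrow> 'e gtan) \<Rightarrow>
     'm set \<Rightarrow> (('m, 'e) chart \<Rightarrow> 'e \<Rightarrow> ('e, complex) form) \<Rightarrow> bool" where
  "canonical_section A J U \<rho> \<longleftrightarrow> form_field A U \<rho> \<and>
     (\<forall>c\<in>A. \<forall>x\<in>region c U. \<rho> c x \<in> canonical_fibre (J c x))"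

text \<open>The first Chern class of \<open>K\<close> as a Cech class: for an open cover with local frames
  \<open>\<sigma>\<^sub>U\<close> and logarithms \<open>l\<^sub>U\<^sub>V\<close> of the transition functions, \<open>\<sigma>\<^sub>V = exp (2 \<pi> i l\<^sub>U\<^sub>V) \<sigma>\<^sub>U\<close>, it is
  represented (up to sign) by the integral cocycle \<open>l\<^sub>U\<^sub>V + l\<^sub>V\<^sub>W - l\<^sub>U\<^sub>W\<close>. It is zero in
  \<open>H\<^sup>2(M, Z)\<close> iff on some such cover this cocycle is the coboundary of a locally constant
  integral cochain \<open>n\<^sub>U\<^sub>V\<close>; continuity of \<open>n\<close> into the discrete space of integers is local
  constancy.\<close>

definition canonical_chern_class_zero ::
  "('m::topological_space, 'e::euclidean_space) chart set \<Rightarrow>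
     (('m, 'e) chart \<Rightarrow> 'e \<Rightarrow> 'e gtan \<Rightarrow> 'e gtan) \<Rightarrow> bool" where
  "canonical_chern_class_zero A J \<longleftrightarrow>
     (\<exists>(\<U> :: 'm set set) (\<sigma> :: 'm set \<Rightarrow> ('m, 'e) chart \<Rightarrow> 'e \<Rightarrow> ('e, complex) form)
        (l :: 'm set \<Rightarrow> 'm set \<Rightarrow> 'm \<Rightarrow> complex) (n :: 'm set \<Rightarrow> 'm set \<Rightarrow> 'm \<Rightarrow> int).
        \<Union>\<U> = UNIV \<and>
        (\<forall>U\<in>\<U>. open U \<and> canonical_section A J U (\<sigma> U) \<and> nonvanishing_on A U (\<sigma> U)) \<and>
        (\<forall>U\<in>\<U>. \<forall>V\<in>\<U>.
           smooth_function A (U \<inter> V) (l U V) \<and> continuous_on (U \<inter> V) (n U V) \<and>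
           (\<forall>c\<in>A. \<forall>x\<in>region c (U \<inter> V). \<forall>vs.
              \<sigma> V c x vs = exp (2 * of_real pi * \<i> * l U V (chart_inv c x)) * \<sigma> U c x vs)) \<and>
        (\<forall>U\<in>\<U>. \<forall>V\<in>\<U>. \<forall>W\<in>\<U>. \<forall>p\<in>U \<inter> V \<inter> W.
           l U V p + l V W p - l U W p = of_int (n U V p + n V W p - n U W p)))"


section \<open>Poisson structures and modular vector fields\<close>

text \<open>A bivector field is given by its maps \<open>T* \<rightarrow> T\<close>, \<open>\<xi> \<mapsto> i\<^sub>\<xi> \<beta>\<close>.\<close>

definition bivector_field ::
  "('m, 'e::euclidean_space) chart set \<Rightarrow> (('m, 'e) chart \<Rightarrow> 'e \<Rightarrow> ('e \<Rightarrow>\<^sub>L real) \<Rightarrow> 'e) \<Rightarrow> bool" where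
  "bivector_field A \<beta> \<longleftrightarrow>
     (\<forall>c\<in>A. (\<forall>x\<in>region c UNIV. linear (\<beta> c x) \<and>
                (\<forall>\<xi> \<eta>. blinfun_apply \<eta> (\<beta> c x \<xi>) = - blinfun_apply \<xi> (\<beta> c x \<eta>))) \<and>
             (\<forall>\<xi>. smooth_on (region c UNIV) (\<lambda>x. \<beta> c x \<xi>))) \<and>
     (\<forall>c\<in>A. \<forall>c'\<in>A. \<forall>x\<in>region c (fst c'). \<forall>\<xi> \<xi>'.
        (\<forall>z. blinfun_apply \<xi> z = blinfun_apply \<xi>' (jacobian c c' x z)) \<longrightarrow>
        \<beta> c' (transition c c' x) \<xi>' = jacobian c c' x (\<beta> c x \<xi>))"

definition poisson_bracket ::
  "('e::euclidean_space \<Rightarrow> ('e \<Rightarrow>\<^sub>L real) \<Rightarrow> 'e) \<Rightarrow> ('e \<Rightarrow> real) \<Rightarrow> ('e \<Rightarrow> real) \<Rightarrow> 'e \<Rightarrow> real" where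
  "poisson_bracket b f g x =
     frechet_derivative g (at x) (b x (Blinfun (frechet_derivative f (at x))))"

definition poisson_structure ::
  "('m, 'e::euclidean_space) chart set \<Rightarrow> (('m, 'e) chart \<Rightarrow> 'e \<Rightarrow> ('e \<Rightarrow>\<^sub>L real) \<Rightarrow> 'e) \<Rightarrow> bool" where
  "poisson_structure A \<beta> \<longleftrightarrow> bivector_field A \<beta> \<and>
     (\<forall>c\<in>A. \<forall>V f g h. open V \<and> V \<subseteq> region c UNIV \<and>
        smooth_on V f \<and> smooth_on V g \<and> smooth_on V h \<longrightarrow>
        (\<forall>x\<in>V. poisson_bracket (\<beta> c) f (poisson_bracket (\<beta> c) g h) x +
                 poisson_bracket (\<beta> c) g (poisson_bracket (\<beta> c) h f) x +
                 poisson_bracket (\<beta> c) h (poisson_bracket (\<beta> c) f g) x = 0))"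

text \<open>With \<open>\<beta> = 1/2 \<beta>\<^sup>i\<^sup>j e\<^sub>i \<and> e\<^sub>j\<close> the coefficient \<open>\<beta>\<^sup>i\<^sup>j\<close> is the \<open>j\<close>-th component of the
  image of the dual basis covector \<open>e\<^sup>i\<close>.\<close>

definition contract_bivector ::
  "(('e::euclidean_space \<Rightarrow>\<^sub>L real) \<Rightarrow> 'e) \<Rightarrow> ('e, complex) form \<Rightarrow> ('e, complex) form" where
  "contract_bivector b \<phi> = (\<lambda>vs. (1 / 2) *\<^sub>R (\<Sum>i\<in>Basis. \<Sum>j\<in>Basis.
     (b (blinfun_inner_right i) \<bullet> j) *\<^sub>R contract j (contract i \<phi>) vs))"

text \<open>The exponential series of \<open>i\<^sub>\<beta>\<close> may be cut off at \<open>DIM('e)\<close>, as \<open>i\<^sub>\<beta>\<close> lowers degrees by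
  two and alternating forms vanish in degrees above \<open>DIM('e)\<close>.\<close>

definition exp_bivector ::
  "(('e::euclidean_space \<Rightarrow>\<^sub>L real) \<Rightarrow> 'e) \<Rightarrow> ('e, complex) form \<Rightarrow> ('e, complex) form" where
  "exp_bivector b \<phi> = (\<lambda>vs. \<Sum>k\<le>DIM('e). (1 / fact k) *\<^sub>R (contract_bivector b ^^ k) \<phi> vs)"

definition modular_equation ::
  "('m, 'e::euclidean_space) chart set \<Rightarrow> (('m, 'e) chart \<Rightarrow> 'e \<Rightarrow> ('e \<Rightarrow>\<^sub>L real) \<Rightarrow> 'e) \<Rightarrow>
     (('m, 'e) chart \<Rightarrow> 'e \<Rightarrow> ('e, complex) form) \<Rightarrow> (('m, 'e) chart \<Rightarrow> 'e \<Rightarrow> 'e) \<Rightarrow> bool" where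
  "modular_equation A \<beta> \<nu> X \<longleftrightarrow>
     (\<forall>c\<in>A. \<forall>x\<in>region c UNIV. \<forall>vs.
        ext_d (\<lambda>y. exp_bivector (\<beta> c y) (\<nu> c y)) x vs =
        contract (X c x) (exp_bivector (\<beta> c x) (\<nu> c x)) vs)"

definition is_modular_vector_field ::
  "('m, 'e::euclidean_space) chart set \<Rightarrow> (('m, 'e) chart \<Rightarrow> 'e \<Rightarrow> ('e \<Rightarrow>\<^sub>L real) \<Rightarrow> 'e) \<Rightarrow>
     (('m, 'e) chart \<Rightarrow> 'e \<Rightarrow> ('e, complex) form) \<Rightarrow> (('m, 'e) chart \<Rightarrow> 'e \<Rightarrow> 'e) \<Rightarrow> bool" where
  "is_modular_vector_field A \<beta> \<nu> X \<longleftrightarrow>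
     poisson_structure A \<beta> \<and> volume_form A \<nu> \<and>
     vector_field A X \<and> modular_equation A \<beta> \<nu> X \<and>
     (\<forall>Y. vector_field A Y \<and> modular_equation A \<beta> \<nu> Y \<longrightarrow>
        (\<forall>c\<in>A. \<forall>x\<in>region c UNIV. Y c x = X c x))"

end

theory Submission
  imports Defs
begin

text \<open>For a constant covector \<open>\<xi>\<close> in a chart put \<open>w = J \<xi>\<close>, with vector part \<open>P \<xi>\<close>. Since
  \<open>\<xi> - i w\<close> lies in \<open>L\<close>, \<open>w \<cdot> \<rho> = - i \<xi> \<cdot> \<rho>\<close>; applying \<open>d\<^sub>H\<close> and the Clifford relations gives the derivative of
  \<open>\<rho>\<close> along \<open>P \<xi>\<close>, up to real Clifford terms, as a multiple of \<open>\<rho>\<close> with coefficient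
  \<open>2\<langle>w, v\<rangle> + 2i\<langle>\<xi>, v\<rangle>\<close>. Clifford elements are self-adjoint for the Mukai pairing, so in the
  derivative of \<open>\<nu> = (\<rho>, cnj \<rho>)\<close> the real terms contribute only the divergence of \<open>P \<xi>\<close>, and the Lie
  derivative of \<open>\<nu>\<close> along \<open>P \<xi>\<close> is \<open>4\<langle>J \<xi>, v\<rangle> \<nu> = \<xi>(X) \<nu>\<close>. This is the part of degree \<open>m - 1\<close> of the modular
  equation. The other degrees follow because the commutator of \<open>d\<close> with the contraction by \<open>P\<close> commutes with
  that contraction, by the Jacobi identity, which in turn is the involutivity of the sections \<open>df - i J df\<close>
  of \<open>L\<close>. Finally, \<open>\<nu>\<close> has no zeros since \<open>\<rho>\<close> generates the irreducible Clifford module of all forms,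
  on which the Mukai pairing is nondegenerate.\<close>

section \<open>The exterior algebra\<close>

text \<open>Skewness of \<open>J\<close> for the pairing is not built into the structure but read
  off from the spinor. Two elements of \<open>L\<close> annihilate \<rho>, hence so does their
  anticommutator, which is a scalar; where \<rho> is nonzero this makes \<open>L\<close> isotropic,
  so that \<open>J\<close> is skew and \<open>P\<close> is a bivector. Constant covectors in a chart
  have zero derivative, and the exterior derivative is the sum of the basis covectors acting on the
  partial derivatives; the computation with \<rho> is thereby Clifford algebra at one point. The
  constant -2 arises because the coefficient of \<rho> meets its conjugate in the derivative of
  \<nu>: only twice the pairing of \<open>J \<xi>\<close> with \<open>v\<close> survives, and
  skewness moves \<open>J\<close> onto \<open>v\<close>. The twist leaves no trace, since the
  contraction of \<open>H\<close> with \<open>P \<xi>\<close> is a 2-form and therefore skew for the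
  Mukai pairing. The passage to lower degrees rests on d(i_P^m \<nu>) = m i_X i_P^(m-1) \<nu>, whose
  factor m is absorbed by the factorials of the exponential.\<close>

definition grading :: "('e, 'k::comm_ring_1) form \<Rightarrow> ('e, 'k) form" where
  "grading \<alpha> = (\<lambda>vs. (-1) ^ length vs * \<alpha> vs)"

section \<open>Position sets and inversions of shuffles\<close>

lemma Pow_lessThan_Suc:
  "Pow {..<Suc n} = (`) Suc ` Pow {..<n} \<union> (\<lambda>S. insert 0 (Suc ` S)) ` Pow {..<n}"
proof -
  have "T \<in> (`) Suc ` Pow {..<n} \<union> (\<lambda>S. insert 0 (Suc ` S)) ` Pow {..<n}"
    if T: "T \<subseteq> {..<Suc n}" for T
  proof -
    define S where "S = {j. Suc j \<in> T}"
    have S: "S \<in> Pow {..<n}" using T by (auto simp: S_def)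
    have "Suc ` S = T - {0}"
    proof (rule set_eqI)
      fix m
      show "m \<in> Suc ` S \<longleftrightarrow> m \<in> T - {0}" by (cases m) (auto simp: S_def)
    qed
    then have "T = Suc ` S" if "0 \<notin> T" using that by simp
    moreover have "T = insert 0 (Suc ` S)" if "0 \<in> T"
      using that \<open>Suc ` S = T - {0}\<close> by (simp add: insert_absorb)
    ultimately show ?thesis using S by (cases "0 \<in> T") auto
  qed
  then show ?thesis by (intro equalityI subsetI) auto
qed

lemma wedge_Nil [simp]: "wedge \<alpha> \<beta> [] = \<alpha> [] * \<beta> []"
  by (simp add: wedge_def)

definition inversions :: "nat \<Rightarrow> nat set \<Rightarrow> (nat \<times> nat) set" where
  "inversions n S = {(i, j). i < j \<and> j \<in> S \<and> i \<in> {..<n} - S}"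

lemma finite_inversions: "S \<subseteq> {..<n} \<Longrightarrow> finite (inversions n S)"
  by (rule finite_subset[of _ "{..<n} \<times> {..<n}"]) (auto simp: inversions_def)

lemma card_inversions_insert_0:
  "card (inversions (Suc n) (insert 0 (Suc ` S))) = card (inversions n S)"
proof -
  have "inversions (Suc n) (insert 0 (Suc ` S)) = map_prod Suc Suc ` inversions n S"
  proof (rule set_eqI)
    fix p :: "nat \<times> nat"
    obtain i j where "p = (i, j)" by (cases p)
    then show "p \<in> inversions (Suc n) (insert 0 (Suc ` S)) \<longleftrightarrow> p \<in> map_prod Suc Suc ` inversions n S"
      by (cases i; cases j) (auto simp: inversions_def image_iff map_prod_def)
  qed
  then show ?thesis
    by (simp add: card_image inj_on_def map_prod_def split: prod.splits)
qed

text \<open>Feeding the head of the list to the second factor creates one new inversion with each of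
  the \<open>card S\<close> positions of the first factor. This is the sign that
  \<open>grading\<close> records in the Leibniz rule.\<close>

lemma card_inversions_Suc:
  assumes "S \<subseteq> {..<n}"
  shows "card (inversions (Suc n) (Suc ` S)) = card (inversions n S) + card S"
proof -
  have eq: "inversions (Suc n) (Suc ` S) = map_prod Suc Suc ` inversions n S \<union> (\<lambda>j. (0, Suc j)) ` S"
  proof (rule set_eqI)
    fix p :: "nat \<times> nat"
    obtain i j where "p = (i, j)" by (cases p)
    then show "p \<in> inversions (Suc n) (Suc ` S) \<longleftrightarrow> p \<in> map_prod Suc Suc ` inversions n S \<union> (\<lambda>j. (0, Suc j)) ` S"
      by (cases i; cases j) (auto simp: inversions_def image_iff map_prod_def)
  qed
  have fS: "finite S" using assms finite_subset by blast
  have "card (inversions (Suc n) (Suc ` S)) =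
      card (map_prod Suc Suc ` inversions n S) + card ((\<lambda>j. (0::nat, Suc j)) ` S)"
    unfolding eq by (rule card_Un_disjoint) (auto simp: fS finite_inversions[OF assms])
  then show ?thesis
    by (simp add: card_image inj_on_def map_prod_def split: prod.splits)
qed

text \<open>Together with its value on the empty list, this Leibniz rule determines the wedge product
  recursively and replaces the sum over shuffles in all that follows.\<close>

lemma wedge_Cons:
  "wedge \<alpha> \<beta> (x # vs) = wedge (contract x \<alpha>) \<beta> vs + wedge (grading \<alpha>) (contract x \<beta>) vs"
proof -
  let ?n = "length vs"
  let ?g = "\<lambda>S. (-1) ^ card (inversions (Suc ?n) S) *
     \<alpha> (nths (x # vs) S) * \<beta> (nths (x # vs) ({..<Suc ?n} - S))"
  have fin: "finite (Pow {..<?n})" by simp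
  have disj: "(`) Suc ` Pow {..<?n} \<inter> (\<lambda>S. insert 0 (Suc ` S)) ` Pow {..<?n} = {}" by auto
  have inj1: "inj_on ((`) Suc) (Pow {..<?n})" by (meson inj_Suc inj_image_eq_iff inj_onI)
  have inj2: "inj_on (\<lambda>S. insert 0 (Suc ` S)) (Pow {..<?n})"
  proof (rule inj_onI)
    fix S T :: "nat set"
    assume "insert 0 (Suc ` S) = insert 0 (Suc ` T)"
    then have "Suc ` S = Suc ` T" by (metis Diff_insert_absorb Zero_not_Suc imageE)
    then show "S = T" by (meson inj_Suc inj_image_eq_iff)
  qed
  have "wedge \<alpha> \<beta> (x # vs) = sum ?g (Pow {..<Suc ?n})"
    by (simp add: wedge_def inversions_def)
  also have "\<dots> = sum ?g ((`) Suc ` Pow {..<?n}) + sum ?g ((\<lambda>S. insert 0 (Suc ` S)) ` Pow {..<?n})"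
    unfolding Pow_lessThan_Suc by (rule sum.union_disjoint) (use fin disj in auto)
  also have "sum ?g ((`) Suc ` Pow {..<?n}) = (\<Sum>S\<in>Pow {..<?n}. ?g (Suc ` S))"
    using inj1 by (simp add: sum.reindex o_def)
  also have "\<dots> = wedge (grading \<alpha>) (contract x \<beta>) vs"
    unfolding wedge_def
  proof (rule sum.cong[OF refl])
    fix S assume "S \<in> Pow {..<?n}"
    then have S: "S \<subseteq> {..<?n}" by simp
    have a: "nths (x # vs) (Suc ` S) = nths vs S"
      by (simp add: nths_Cons image_iff)
    have "{j. Suc j < Suc ?n \<and> Suc j \<notin> Suc ` S} = {..<?n} - S" by auto
    then have b: "nths (x # vs) ({..<Suc ?n} - Suc ` S) = x # nths vs ({..<?n} - S)"
      by (simp add: nths_Cons image_iff)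
    have c: "length (nths vs S) = card S"
    proof -
      have "{i. i < ?n \<and> i \<in> S} = S" using S by auto
      then show ?thesis by (simp add: length_nths)
    qed
    show "?g (Suc ` S) = (-1) ^ card {(i, j). i < j \<and> j \<in> S \<and> i \<in> {..<?n} - S} *
         grading \<alpha> (nths vs S) * contract x \<beta> (nths vs ({..<?n} - S))"
      unfolding a b card_inversions_Suc[OF S] grading_def c contract_def
      by (simp add: inversions_def power_add)
  qed
  also have "sum ?g ((\<lambda>S. insert 0 (Suc ` S)) ` Pow {..<?n}) = (\<Sum>S\<in>Pow {..<?n}. ?g (insert 0 (Suc ` S)))"
    using inj2 by (simp add: sum.reindex o_def)
  also have "\<dots> = wedge (contract x \<alpha>) \<beta> vs"
    unfolding wedge_def
  proof (rule sum.cong[OF refl])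
    fix S assume "S \<in> Pow {..<?n}"
    have a: "nths (x # vs) (insert 0 (Suc ` S)) = x # nths vs S"
      by (simp add: nths_Cons image_iff)
    have "{j. Suc j < Suc ?n \<and> Suc j \<notin> Suc ` S} = {..<?n} - S" by auto
    then have b: "nths (x # vs) ({..<Suc ?n} - insert 0 (Suc ` S)) = nths vs ({..<?n} - S)"
      by (simp add: nths_Cons image_iff)
    show "?g (insert 0 (Suc ` S)) = (-1) ^ card {(i, j). i < j \<and> j \<in> S \<and> i \<in> {..<?n} - S} *
         contract x \<alpha> (nths vs S) * \<beta> (nths vs ({..<?n} - S))"
      unfolding a b card_inversions_insert_0 contract_def
      by (simp add: inversions_def)
  qed
  finally show ?thesis by (simp add: add.commute)
qed

lemma contract_wedge:
  "contract x (wedge \<alpha> \<beta>) = (\<lambda>vs. wedge (contract x \<alpha>) \<beta> vs + wedge (grading \<alpha>) (contract x \<beta>) vs)"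
  by (rule ext) (simp add: contract_def[of x "wedge \<alpha> \<beta>"] wedge_Cons)

lemma wedge_add_left: "wedge (\<lambda>vs. \<alpha> vs + \<alpha>' vs) \<beta> vs = wedge \<alpha> \<beta> vs + wedge \<alpha>' \<beta> vs"
  by (simp add: wedge_def algebra_simps sum.distrib)

lemma wedge_add_right: "wedge \<alpha> (\<lambda>vs. \<beta> vs + \<beta>' vs) vs = wedge \<alpha> \<beta> vs + wedge \<alpha> \<beta>' vs"
  by (simp add: wedge_def algebra_simps sum.distrib)

lemma wedge_mult_left: "wedge (\<lambda>vs. c * \<alpha> vs) \<beta> vs = c * wedge \<alpha> \<beta> vs"
  by (simp add: wedge_def sum_distrib_left mult_ac)

lemma wedge_mult_right: "wedge \<alpha> (\<lambda>vs. c * \<beta> vs) vs = c * wedge \<alpha> \<beta> vs"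
  by (simp add: wedge_def sum_distrib_left mult_ac)

lemma wedge_minus_left: "wedge (\<lambda>vs. - \<alpha> vs) \<beta> vs = - wedge \<alpha> \<beta> vs"
  using wedge_mult_left[of "-1"] by simp

lemma wedge_minus_right: "wedge \<alpha> (\<lambda>vs. - \<beta> vs) vs = - wedge \<alpha> \<beta> vs"
  using wedge_mult_right[of _ "-1"] by simp

lemma wedge_zero_left [simp]: "wedge (\<lambda>vs. 0) \<beta> = (\<lambda>vs. 0)"
  by (simp add: wedge_def)

lemma wedge_zero_right [simp]: "wedge \<alpha> (\<lambda>vs. 0) = (\<lambda>vs. 0)"
  by (simp add: wedge_def)

lemma wedge_sum_right: "wedge \<alpha> (\<lambda>vs. \<Sum>i\<in>I. \<beta> i vs) vs = (\<Sum>i\<in>I. wedge \<alpha> (\<beta> i) vs)"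
  by (induction I rule: infinite_finite_induct) (simp_all add: wedge_add_right)

lemmas wedge_linear = wedge_add_left wedge_add_right wedge_mult_left wedge_mult_right
  wedge_minus_left wedge_minus_right

lemma grading_grading [simp]: "grading (grading \<alpha>) = \<alpha>"
  by (simp add: grading_def fun_eq_iff flip: mult.assoc power_add)

lemma contract_grading: "contract x (grading \<alpha>) = (\<lambda>vs. - grading (contract x \<alpha>) vs)"
  by (simp add: grading_def contract_def fun_eq_iff)

lemma grading_wedge: "grading (wedge \<alpha> \<beta>) vs = wedge (grading \<alpha>) (grading \<beta>) vs"
proof (induction vs arbitrary: \<alpha> \<beta>)
  case Nil
  show ?case by (simp add: grading_def)
next
  case (Cons x vs)
  have "grading (wedge \<alpha> \<beta>) (x # vs) =
      - (grading (wedge (contract x \<alpha>) \<beta>) vs + grading (wedge (grading \<alpha>) (contract x \<beta>)) vs)"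
    by (simp add: grading_def wedge_Cons algebra_simps)
  also have "\<dots> = - (wedge (grading (contract x \<alpha>)) (grading \<beta>) vs + wedge \<alpha> (grading (contract x \<beta>)) vs)"
    by (simp only: Cons.IH grading_grading)
  also have "\<dots> = wedge (grading \<alpha>) (grading \<beta>) (x # vs)"
    by (simp add: wedge_Cons contract_grading wedge_linear)
  finally show ?case .
qed

text \<open>Both sides obey the same Leibniz rule in the head vector, so induction on the arguments,
  with all three factors generalized, avoids three-way shuffles.\<close>

lemma wedge_assoc: "wedge (wedge \<alpha> \<beta>) \<gamma> vs = wedge \<alpha> (wedge \<beta> \<gamma>) vs"
proof (induction vs arbitrary: \<alpha> \<beta> \<gamma>)
  case Nil
  show ?case by (simp add: mult.assoc)
next
  case (Cons x vs)
  have "wedge (wedge \<alpha> \<beta>) \<gamma> (x # vs) = wedge (contract x (wedge \<alpha> \<beta>)) \<gamma> vs +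
      wedge (wedge (grading \<alpha>) (grading \<beta>)) (contract x \<gamma>) vs"
    by (simp add: wedge_Cons ext[OF grading_wedge])
  also have "\<dots> = wedge \<alpha> (wedge \<beta> \<gamma>) (x # vs)"
    by (simp add: wedge_Cons contract_wedge wedge_linear Cons.IH)
  finally show ?case .
qed

section \<open>The reversal antiautomorphism\<close>

lemma reversal_simps:
  "reversal (\<lambda>vs. \<alpha> vs + \<beta> vs) = (\<lambda>vs. reversal \<alpha> vs + reversal \<beta> vs)"
  "reversal (\<lambda>vs. - \<alpha> vs) = (\<lambda>vs. - reversal \<alpha> vs)"
  "reversal (\<lambda>vs. c * \<alpha> vs) = (\<lambda>vs. c * reversal \<alpha> vs)"
  by (simp_all add: reversal_def fun_eq_iff algebra_simps)

lemma reversal_grading: "reversal (grading \<alpha>) = grading (reversal \<alpha>)"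
  by (simp add: grading_def reversal_def fun_eq_iff mult_ac)

text \<open>The reversal signs in degrees n + 1 and n differ by (-1)^n, the sign of
  \<open>grading\<close>.\<close>

lemma contract_reversal: "contract x (reversal \<alpha>) = grading (reversal (contract x \<alpha>))"
proof (rule ext)
  fix vs :: "'a list"
  have "(Suc n * n) div 2 = n + n * (n - 1) div 2" for n :: nat
  proof (cases n)
    case (Suc m)
    have "Suc n * n = n * 2 + n * (n - 1)" using Suc by (simp add: algebra_simps)
    then show ?thesis by simp
  qed simp
  then show "contract x (reversal \<alpha>) vs = grading (reversal (contract x \<alpha>)) vs"
    by (simp add: contract_def reversal_def grading_def power_add mult.assoc)
qed

lemma reversal_wedge: "reversal (wedge \<alpha> \<beta>) vs = wedge (reversal \<beta>) (reversal \<alpha>) vs"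
proof (induction vs arbitrary: \<alpha> \<beta>)
  case Nil
  show ?case by (simp add: reversal_def mult.commute)
next
  case (Cons x vs)
  have "reversal (wedge \<alpha> \<beta>) (x # vs) = grading (reversal (contract x (wedge \<alpha> \<beta>))) vs"
    using fun_cong[OF contract_reversal, of x "wedge \<alpha> \<beta>" vs] by (simp add: contract_def)
  also have "\<dots> = (-1) ^ length vs * (reversal (wedge (contract x \<alpha>) \<beta>) vs +
      reversal (wedge (grading \<alpha>) (contract x \<beta>)) vs)"
    by (simp add: contract_wedge reversal_simps grading_def[of "\<lambda>vs. _ vs + _ vs"])
  also have "\<dots> = grading (wedge (reversal \<beta>) (reversal (contract x \<alpha>))) vs +
      grading (wedge (reversal (contract x \<beta>)) (reversal (grading \<alpha>))) vs"
    by (simp add: Cons.IH grading_def[of "wedge _ _"] algebra_simps)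
  also have "\<dots> = wedge (reversal \<beta>) (reversal \<alpha>) (x # vs)"
    by (simp add: wedge_Cons contract_reversal grading_wedge reversal_grading)
  finally show ?case .
qed

section \<open>Products with 1-forms and scalars\<close>

lemma contract_one_form: "contract x (one_form \<xi>) = (\<lambda>vs. if vs = [] then of_real (blinfun_apply \<xi> x) else 0)"
  by (auto simp: contract_def one_form_def fun_eq_iff)

lemma wedge_scalar_left: "wedge (\<lambda>vs. if vs = [] then c else 0) \<beta> vs = c * \<beta> vs"
proof (induction vs arbitrary: c \<beta>)
  case (Cons x vs)
  let ?s = "(\<lambda>vs. if vs = [] then c else 0) :: ('b, 'a) form"
  have "contract x ?s = (\<lambda>vs. 0)" and "grading ?s = ?s"
    by (auto simp: contract_def grading_def fun_eq_iff)
  then show ?case using Cons.IH[of c "contract x \<beta>"] by (simp add: wedge_Cons contract_def[of x \<beta>])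
qed simp

lemma wedge_scalar_right: "wedge \<alpha> (\<lambda>vs. if vs = [] then c else 0) vs = c * \<alpha> vs"
proof (induction vs arbitrary: c \<alpha>)
  case (Cons x vs)
  let ?s = "(\<lambda>vs. if vs = [] then c else 0) :: ('b, 'a) form"
  have "contract x ?s = (\<lambda>vs. 0)"
    by (auto simp: contract_def fun_eq_iff)
  then show ?case using Cons.IH[of "contract x \<alpha>" c] by (simp add: wedge_Cons contract_def[of x \<alpha>])
qed simp

lemma has_degree_grading: "has_degree k \<alpha> \<Longrightarrow> grading \<alpha> vs = (-1) ^ k * \<alpha> vs"
  by (cases "length vs = k") (auto simp: has_degree_def grading_def)

lemma has_degree_reversal: "has_degree k \<alpha> \<Longrightarrow> reversal \<alpha> vs = (-1) ^ (k * (k - 1) div 2) * \<alpha> vs"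
  by (cases "length vs = k") (auto simp: has_degree_def reversal_def)

lemma has_degree_one_form: "has_degree 1 (one_form \<xi>)"
  by (simp add: has_degree_def one_form_def)

lemma grading_one_form: "grading (one_form \<xi>) = (\<lambda>vs. - one_form \<xi> vs)"
  using has_degree_grading[OF has_degree_one_form] by (auto simp: fun_eq_iff)

lemma reversal_one_form: "reversal (one_form \<xi>) = one_form \<xi>"
  using has_degree_reversal[OF has_degree_one_form] by (auto simp: fun_eq_iff)

lemma wedge_one_form_Cons:
  fixes \<beta> :: "('e::real_normed_vector, 'k::real_normed_field) form"
  shows "wedge (one_form \<xi>) \<beta> (x # vs) =
    of_real (blinfun_apply \<xi> x) * \<beta> vs - wedge (one_form \<xi>) (contract x \<beta>) vs"
  by (simp add: wedge_Cons contract_one_form wedge_scalar_left grading_one_form wedge_linear)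

lemma wedge_one_form_commute:
  fixes \<beta> :: "('e::real_normed_vector, 'k::real_normed_field) form"
  shows "wedge (one_form \<xi>) \<beta> vs = wedge (grading \<beta>) (one_form \<xi>) vs"
proof (induction vs arbitrary: \<beta>)
  case (Cons x vs)
  have "wedge (grading \<beta>) (one_form \<xi>) (x # vs) =
      - wedge (grading (contract x \<beta>)) (one_form \<xi>) vs + of_real (blinfun_apply \<xi> x) * \<beta> vs"
    by (simp add: wedge_Cons contract_one_form wedge_scalar_right contract_grading wedge_minus_left)
  then show ?case
    by (simp add: wedge_one_form_Cons Cons.IH[of "contract x \<beta>"])
qed (simp add: one_form_def)

lemma wedge_one_form_anticommute:
  fixes \<phi> :: "('e::real_normed_vector, 'k::real_normed_field) form"
  shows "wedge (one_form \<xi>) (wedge (one_form \<eta>) \<phi>) vs = - wedge (one_form \<eta>) (wedge (one_form \<xi>) \<phi>) vs"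
proof -
  have eq: "wedge (one_form \<xi>) (one_form \<eta>) = (\<lambda>vs. - wedge (one_form \<eta>) (one_form \<xi>) vs :: 'k)"
  proof (rule ext)
    fix vs :: "'e list"
    show "wedge (one_form \<xi>) (one_form \<eta>) vs = (- wedge (one_form \<eta>) (one_form \<xi>) vs :: 'k)"
      by (subst wedge_one_form_commute) (simp only: grading_one_form wedge_minus_left)
  qed
  have "wedge (one_form \<xi>) (wedge (one_form \<eta>) \<phi>) vs = wedge (wedge (one_form \<xi>) (one_form \<eta>)) \<phi> vs"
    by (simp only: wedge_assoc)
  also have "\<dots> = - wedge (wedge (one_form \<eta>) (one_form \<xi>)) \<phi> vs"
    by (simp only: eq wedge_minus_left)
  finally show ?thesis by (simp only: wedge_assoc)
qed

section \<open>Alternating forms and the Clifford action\<close>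

text \<open>Linearity in a slot marked by append and sign change under adjacent swaps are both
  stable under peeling off the head of the list, so they suit the recursive description of
  contraction and wedge better than vanishing on repeated entries.\<close>

lemma alternating_form_iff:
  fixes \<phi> :: "('e::real_vector, 'k::real_vector) form"
  shows "alternating_form \<phi> \<longleftrightarrow> (\<forall>ws vs. linear (\<lambda>z. \<phi> (ws @ z # vs))) \<and>
    (\<forall>ws x y vs. \<phi> (ws @ x # y # vs) = - \<phi> (ws @ y # x # vs))" (is "_ \<longleftrightarrow> ?L \<and> ?S")
proof
  assume alt: "alternating_form \<phi>"
  have L: "linear (\<lambda>z. \<phi> (ws @ z # vs))" for ws vs
  proof -
    have "linear (\<lambda>z. \<phi> ((ws @ 0 # vs)[length ws := z]))"
      using alt unfolding alternating_form_def
      by (metis length_append length_Cons less_add_Suc1 add_Suc_right)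
    then show ?thesis by (simp add: list_update_append)
  qed
  have Z: "\<phi> (ws @ x # x # vs) = 0" for ws x vs
  proof -
    have "(ws @ x # x # vs) ! length ws = (ws @ x # x # vs) ! Suc (length ws)"
      by (simp add: nth_append)
    then show ?thesis using alt unfolding alternating_form_def
      by (metis (no_types, lifting) length_append length_Cons less_add_Suc1 add_Suc_right lessI
          add_less_cancel_left less_Suc_eq Suc_less_eq)
  qed
  have "\<phi> (ws @ x # y # vs) = - \<phi> (ws @ y # x # vs)" for ws x y vs
  proof -
    have "0 = \<phi> (ws @ (x + y) # (x + y) # vs)" by (simp add: Z)
    also have "\<dots> = \<phi> (ws @ x # (x + y) # vs) + \<phi> (ws @ y # (x + y) # vs)"
      using linear_add[OF L] by blast
    also have "\<phi> (ws @ x # (x + y) # vs) = \<phi> (ws @ x # y # vs)"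
      using linear_add[OF L[of "ws @ [x]" vs], of x y] by (simp add: Z)
    also have "\<phi> (ws @ y # (x + y) # vs) = \<phi> (ws @ y # x # vs)"
      using linear_add[OF L[of "ws @ [y]" vs], of x y] by (simp add: Z)
    finally show ?thesis by (metis eq_neg_iff_add_eq_0)
  qed
  with L show "?L \<and> ?S" by blast
next
  assume "?L \<and> ?S"
  then have L: "linear (\<lambda>z. \<phi> (ws @ z # vs))"
    and S: "\<phi> (ws @ x # y # vs) = - \<phi> (ws @ y # x # vs)" for ws vs x y
    by blast+
  \<comment> \<open>The first copy of \<open>x\<close> moves right, one swap at a time, into the
    generalized prefix until it meets the second copy.\<close>
  have Z: "\<phi> (ws @ x # us @ x # vs) = 0" for ws us vs x
  proof (induction us arbitrary: ws)
    case Nil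
    have "\<phi> (ws @ x # x # vs) = - \<phi> (ws @ x # x # vs)" by (rule S)
    then show ?case by (metis append_Nil eq_neg_iff_add_eq_0 real_vector.scale_eq_0_iff scaleR_2 zero_neq_numeral)
  next
    case (Cons u us)
    have "\<phi> (ws @ x # (u # us) @ x # vs) = - \<phi> ((ws @ [u]) @ x # us @ x # vs)"
      using S[of ws x u "us @ x # vs"] by simp
    then show ?case using Cons[of "ws @ [u]"] by simp
  qed
  show "alternating_form \<phi>"
    unfolding alternating_form_def
  proof (intro conjI allI impI)
    fix vs :: "'e list" and i
    assume "i < length vs"
    then have "\<phi> (vs[i := z]) = \<phi> (take i vs @ z # drop (Suc i) vs)" for z
      by (simp add: upd_conv_take_nth_drop)
    then show "linear (\<lambda>z. \<phi> (vs[i := z]))" using L by simp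
  next
    fix vs :: "'e list" and i j
    assume *: "i < j \<and> j < length vs \<and> vs ! i = vs ! j"
    have "vs = take i vs @ vs ! i # drop (Suc i) vs"
      using * by (intro id_take_nth_drop) simp
    moreover have "drop (Suc i) vs = take (j - Suc i) (drop (Suc i) vs) @ vs ! j # drop (Suc j) vs"
      using * id_take_nth_drop[of "j - Suc i" "drop (Suc i) vs"] by (simp add: diff_less_mono)
    ultimately have "vs = take i vs @ vs ! i # take (j - Suc i) (drop (Suc i) vs) @ vs ! i # drop (Suc j) vs"
      using * by metis
    then show "\<phi> vs = 0" using Z by metis
  qed
qed

lemma alternating_linear: "alternating_form \<phi> \<Longrightarrow> linear (\<lambda>z. \<phi> (ws @ z # vs))"
  unfolding alternating_form_iff by blast

lemma alternating_linear_hd: "alternating_form \<phi> \<Longrightarrow> linear (\<lambda>z. \<phi> (z # vs))"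
  using alternating_linear[of \<phi> "[]"] by simp

lemma alternating_swap: "alternating_form \<phi> \<Longrightarrow> \<phi> (ws @ x # y # vs) = - \<phi> (ws @ y # x # vs)"
  unfolding alternating_form_iff by blast

lemma alternating_swap_hd: "alternating_form \<phi> \<Longrightarrow> \<phi> (x # y # vs) = - \<phi> (y # x # vs)"
  using alternating_swap[of \<phi> "[]" x y vs] by (simp only: append_Nil)

lemma alternatingI:
  assumes "\<And>ws vs. linear (\<lambda>z. \<phi> (ws @ z # vs))"
    and "\<And>ws x y vs. \<phi> (ws @ x # y # vs) = - \<phi> (ws @ y # x # vs)"
  shows "alternating_form \<phi>"
  unfolding alternating_form_iff using assms by blast

lemma alternating_contract:
  assumes "alternating_form \<phi>"
  shows "alternating_form (contract x \<phi>)"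
proof (rule alternatingI)
  show "linear (\<lambda>z. contract x \<phi> (ws @ z # vs))" for ws vs
    using alternating_linear[OF assms, of "x # ws" vs] by (simp only: contract_def append_Cons)
  show "contract x \<phi> (ws @ y # z # vs) = - contract x \<phi> (ws @ z # y # vs)" for ws y z vs
    using alternating_swap[OF assms, of "x # ws" y z vs] by (simp only: contract_def append_Cons)
qed

lemma alternating_add:
  assumes "alternating_form \<phi>" "alternating_form \<psi>"
  shows "alternating_form (\<lambda>vs. \<phi> vs + \<psi> vs)"
proof (rule alternatingI)
  show "linear (\<lambda>z. \<phi> (ws @ z # vs) + \<psi> (ws @ z # vs))" for ws vs
    by (intro linear_compose_add alternating_linear assms)
  show "\<phi> (ws @ y # z # vs) + \<psi> (ws @ y # z # vs) = - (\<phi> (ws @ z # y # vs) + \<psi> (ws @ z # y # vs))"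
    for ws y z vs
    using alternating_swap[OF assms(1), of ws y z vs] alternating_swap[OF assms(2), of ws y z vs]
    by (simp only: minus_add_distrib)
qed

lemma alternating_zero: "alternating_form (\<lambda>vs. 0)"
  by (rule alternatingI) (simp_all add: linear_iff)

text \<open>Grading, reversal and the restriction to one degree are all multiplications by a factor
  depending only on the number of arguments.\<close>

lemma alternating_mult_length:
  fixes \<phi> :: "('e::real_vector, 'k::real_normed_field) form"
  assumes "alternating_form \<phi>"
  shows "alternating_form (\<lambda>vs. f (length vs) * \<phi> vs)"
proof (rule alternatingI)
  show "linear (\<lambda>z. f (length (ws @ z # vs)) * \<phi> (ws @ z # vs))" for ws vs
    using alternating_linear[OF assms, of ws vs] by (simp add: linear_iff algebra_simps)
  show "f (length (ws @ x # y # vs)) * \<phi> (ws @ x # y # vs) = - (f (length (ws @ y # x # vs)) * \<phi> (ws @ y # x # vs))"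
    for ws x y vs
    by (subst alternating_swap[OF assms]) simp
qed

lemma alternating_mult:
  fixes \<phi> :: "('e::real_vector, 'k::real_normed_field) form"
  shows "alternating_form \<phi> \<Longrightarrow> alternating_form (\<lambda>vs. c * \<phi> vs)"
  by (rule alternating_mult_length)

lemma alternating_sum:
  "(\<And>i. i \<in> I \<Longrightarrow> alternating_form (\<phi> i)) \<Longrightarrow> alternating_form (\<lambda>vs. \<Sum>i\<in>I. \<phi> i vs)"
  by (induction I rule: infinite_finite_induct) (simp_all add: alternating_zero alternating_add)

lemma alternating_grading:
  fixes \<phi> :: "('e::real_vector, 'k::real_normed_field) form"
  shows "alternating_form \<phi> \<Longrightarrow> alternating_form (grading \<phi>)"
  unfolding grading_def by (rule alternating_mult_length)

lemma alternating_reversal: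
  fixes \<phi> :: "('e::real_vector, 'k::real_normed_field) form"
  shows "alternating_form \<phi> \<Longrightarrow> alternating_form (reversal \<phi>)"
  unfolding reversal_def by (rule alternating_mult_length)

lemma alternating_bounded_linear:
  assumes "alternating_form \<phi>" "bounded_linear h"
  shows "alternating_form (\<lambda>vs. h (\<phi> vs))"
proof (rule alternatingI)
  interpret h: bounded_linear h by fact
  show "linear (\<lambda>z. h (\<phi> (ws @ z # vs)))" for ws vs
    using alternating_linear[OF assms(1), of ws vs] by (simp add: linear_iff h.add h.scaleR)
  show "h (\<phi> (ws @ x # y # vs)) = - h (\<phi> (ws @ y # x # vs))" for ws x y vs
    by (subst alternating_swap[OF assms(1)]) (simp add: linear_neg h.linear)
qed

lemma alternating_cnj_form: "alternating_form \<phi> \<Longrightarrow> alternating_form (cnj_form \<phi>)"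
  unfolding cnj_form_def by (rule alternating_bounded_linear[OF _ bounded_linear_cnj])

lemma alternating_complexify: "alternating_form \<phi> \<Longrightarrow> alternating_form (complexify \<phi>)"
  unfolding complexify_def by (rule alternating_bounded_linear[OF _ bounded_linear_of_real])

lemma one_form_append: "one_form \<xi> (ws @ z # vs) = (if ws = [] \<and> vs = [] then of_real (blinfun_apply \<xi> z) else 0)"
  by (cases ws) (auto simp: one_form_def)

lemma alternating_one_form:
  "alternating_form (one_form \<xi> :: ('e::real_normed_vector, 'k::real_normed_field) form)"
  by (rule alternatingI; simp only: one_form_append)
     (auto simp: linear_iff blinfun.add_right blinfun.scaleR_right scaleR_conv_of_real)

text \<open>The Leibniz rule peels off the entries in front of the slots concerned. At the front,
  two applications of it reduce a swap to the anticommutation of contractions; the mixed terms carry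
  opposite signs through \<open>grading\<close>.\<close>

lemma alternating_wedge:
  fixes \<alpha> \<beta> :: "('e::real_vector, 'k::real_normed_field) form"
  assumes "alternating_form \<alpha>" "alternating_form \<beta>"
  shows "alternating_form (wedge \<alpha> \<beta>)"
proof -
  have C: "contract (y + z) \<phi> = (\<lambda>vs. contract y \<phi> vs + contract z \<phi> vs)"
    "contract (r *\<^sub>R z) \<phi> = (\<lambda>vs. of_real r * contract z \<phi> vs)"
    if "alternating_form \<phi>" for \<phi> :: "('e, 'k) form" and y z r
    using alternating_linear_hd[OF that]
    by (simp_all add: contract_def linear_iff scaleR_conv_of_real)
  have "linear (\<lambda>z. wedge \<alpha> \<beta> (ws @ z # vs))" for ws vs
    using assms
  proof (induction ws arbitrary: \<alpha> \<beta>)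
    case Nil
    then show ?case
      by (auto simp: linear_iff wedge_Cons C wedge_linear scaleR_conv_of_real algebra_simps)
  next
    case (Cons w ws)
    show ?case using Cons.prems
      by (simp add: wedge_Cons linear_compose_add Cons.IH alternating_contract alternating_grading)
  qed
  moreover have "wedge \<alpha> \<beta> (ws @ x # y # vs) = - wedge \<alpha> \<beta> (ws @ y # x # vs)" for ws x y vs
    using assms
  proof (induction ws arbitrary: \<alpha> \<beta>)
    case Nil
    have D: "contract y (contract x \<phi>) = (\<lambda>vs. - contract x (contract y \<phi>) vs)"
      if "alternating_form \<phi>" for \<phi> :: "('e, 'k) form"
      by (rule ext) (use alternating_swap_hd[OF that, of x y] in \<open>simp add: contract_def\<close>)
    show ?case using D[OF Nil(1)] D[OF Nil(2)]
      by (simp add: wedge_Cons contract_grading wedge_linear)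
  next
    case (Cons w ws)
    have "wedge (contract w \<alpha>) \<beta> (ws @ x # y # vs) = - wedge (contract w \<alpha>) \<beta> (ws @ y # x # vs)"
      and "wedge (grading \<alpha>) (contract w \<beta>) (ws @ x # y # vs) =
        - wedge (grading \<alpha>) (contract w \<beta>) (ws @ y # x # vs)"
      by (rule Cons.IH; intro alternating_contract alternating_grading Cons.prems)+
    then show ?case by (simp add: wedge_Cons)
  qed
  ultimately show ?thesis by (rule alternatingI)
qed

text \<open>On linearly dependent arguments, one entry lies in the span of the others, and the
  values of the slot where the form vanishes are a subspace.\<close>

lemma alternating_vanishes:
  fixes \<phi> :: "('e::euclidean_space, 'k::real_vector) form"
  assumes alt: "alternating_form \<phi>" and len: "DIM('e) < length vs"
  shows "\<phi> vs = 0"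
proof (cases "distinct vs")
  case False
  then obtain i j where "i < j" "j < length vs" "vs ! i = vs ! j"
    by (metis distinct_conv_nth linorder_neqE_nat)
  then show ?thesis using alt unfolding alternating_form_def by blast
next
  case True
  then have "card (set vs) = length vs" by (rule distinct_card)
  then have "dependent (set vs)"
    using len independent_bound by (metis not_less)
  then obtain a where a: "a \<in> set vs" "a \<in> span (set vs - {a})"
    unfolding dependent_def by blast
  then obtain i where i: "i < length vs" "vs ! i = a" by (metis in_set_conv_nth)
  have lin: "linear (\<lambda>z. \<phi> (vs[i := z]))" using alt i unfolding alternating_form_def by blast
  have "subspace {z. \<phi> (vs[i := z]) = 0}"
    using linear_0[OF lin] linear_add[OF lin] linear_scale[OF lin] by (simp add: subspace_def)
  moreover have "set vs - {a} \<subseteq> {z. \<phi> (vs[i := z]) = 0}"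
  proof safe
    fix z assume "z \<in> set vs" "z \<noteq> a"
    then obtain j where j: "j < length vs" "vs ! j = z" "j \<noteq> i" using i by (metis in_set_conv_nth)
    let ?us = "vs[i := z]"
    have "?us ! i = ?us ! j" "i < length ?us" "j < length ?us" using i j by auto
    then show "\<phi> ?us = 0" using alt j(3) unfolding alternating_form_def
      by (metis linorder_neqE_nat)
  qed
  ultimately have "\<phi> (vs[i := a]) = 0"
    using a(2) span_minimal by blast
  moreover have "vs[i := a] = vs" using i(2) list_update_id[of vs i] by simp
  ultimately show ?thesis by simp
qed

text \<open>Twice the inner product on T + T*: exactly the scalar by which the anticommutator of two
  Clifford actions multiplies a form.\<close>

abbreviation pairing :: "'e::real_normed_vector gtan \<Rightarrow> 'e gtan \<Rightarrow> real" where
  "pairing u w \<equiv> blinfun_apply (snd u) (fst w) + blinfun_apply (snd w) (fst u)"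

lemma alternating_clifford: "alternating_form \<phi> \<Longrightarrow> alternating_form (clifford u \<phi>)"
  unfolding clifford_def
  by (intro alternating_add alternating_contract alternating_wedge alternating_one_form)

lemma clifford_add: "clifford u (\<lambda>vs. \<phi> vs + \<psi> vs) = (\<lambda>vs. clifford u \<phi> vs + clifford u \<psi> vs)"
  by (simp add: clifford_def fun_eq_iff wedge_linear) (simp add: contract_def)

lemma clifford_mult: "clifford u (\<lambda>vs. c * \<phi> vs) = (\<lambda>vs. c * clifford u \<phi> vs)"
  by (simp add: clifford_def fun_eq_iff wedge_linear algebra_simps) (simp add: contract_def)

lemma clifford_minus: "clifford u (\<lambda>vs. - \<phi> vs) = (\<lambda>vs. - clifford u \<phi> vs)"
  using clifford_mult[of u "-1"] by simp

lemma clifford_diff: "clifford u (\<lambda>vs. \<phi> vs - \<psi> vs) = (\<lambda>vs. clifford u \<phi> vs - clifford u \<psi> vs)"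
  using clifford_add[of u \<phi> "\<lambda>vs. - \<psi> vs"] by (simp add: clifford_minus)

lemma clifford_zero [simp]: "clifford u (\<lambda>vs. 0) = (\<lambda>vs. 0)"
  using clifford_mult[of u 0] by simp

lemma clifford_sum: "clifford u (\<lambda>vs. \<Sum>i\<in>I. \<phi> i vs) = (\<lambda>vs. \<Sum>i\<in>I. clifford u (\<phi> i) vs)"
  by (induction I rule: infinite_finite_induct) (simp_all add: clifford_add)

lemma contract_wedge_one_form:
  fixes \<phi> :: "('e::real_normed_vector, 'k::real_normed_field) form"
  shows "contract x (wedge (one_form \<xi>) \<phi>) vs =
    of_real (blinfun_apply \<xi> x) * \<phi> vs - wedge (one_form \<xi>) (contract x \<phi>) vs"
  using wedge_one_form_Cons by (simp add: contract_def)

lemma contract_add: "contract x (\<lambda>vs. \<phi> vs + \<psi> vs) = (\<lambda>vs. contract x \<phi> vs + contract x \<psi> vs)"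
  by (simp add: contract_def)

lemma clifford_clifford:
  assumes "alternating_form \<phi>"
  shows "clifford u (clifford w \<phi>) vs + clifford w (clifford u \<phi>) vs = of_real (pairing u w) * \<phi> vs"
proof -
  have "contract (fst u) (contract (fst w) \<phi>) vs = - contract (fst w) (contract (fst u) \<phi>) vs"
    unfolding contract_def by (rule alternating_swap_hd[OF assms])
  then show ?thesis
    using wedge_one_form_anticommute[of "snd u" "snd w" \<phi> vs]
    by (simp add: clifford_def contract_add contract_wedge_one_form wedge_linear algebra_simps)
qed

lemma clifford_left_linear:
  assumes "alternating_form \<phi>"
  shows "linear (\<lambda>u. clifford u \<phi> vs)"
proof -
  have "linear (\<lambda>x. contract x \<phi> vs)"
    using alternating_linear_hd[OF assms] by (simp add: contract_def)
  moreover have "one_form (\<xi> + \<eta>) = (\<lambda>vs. one_form \<xi> vs + one_form \<eta> vs :: complex)"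
    "one_form (r *\<^sub>R \<xi>) = (\<lambda>vs. of_real r * one_form \<xi> vs :: complex)" for \<xi> \<eta> :: "'a \<Rightarrow>\<^sub>L real" and r
    by (auto simp: one_form_def blinfun.add_left blinfun.scaleR_left)
  ultimately show ?thesis
    by (simp add: clifford_def linear_iff wedge_linear scaleR_conv_of_real algebra_simps)
qed

lemma cnj_wedge: "cnj (wedge \<alpha> \<beta> vs) = wedge (cnj_form \<alpha>) (cnj_form \<beta>) vs"
  by (simp add: wedge_def cnj_form_def)

lemma cnj_clifford: "cnj_form (clifford u \<phi>) = clifford u (cnj_form \<phi>)"
proof -
  have "cnj_form (one_form (snd u)) = one_form (snd u)"
    by (auto simp: cnj_form_def one_form_def)
  moreover have "cnj_form \<phi> vs = cnj (\<phi> vs)" for \<phi> :: "('a, complex) form" and vs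
    by (simp add: cnj_form_def)
  ultimately show ?thesis
    by (auto simp: fun_eq_iff clifford_def cnj_wedge) (simp add: contract_def cnj_form_def)
qed

section \<open>The Mukai pairing\<close>

lemma mukai_eq: "length vs = DIM('e::euclidean_space) \<Longrightarrow> mukai s t vs = wedge (reversal s) t (vs :: 'e list)"
  by (simp add: mukai_def)

lemma mukai_linear:
  "mukai (\<lambda>vs. s vs + s' vs) t vs = mukai s t vs + mukai s' t vs"
  "mukai s (\<lambda>vs. t vs + t' vs) vs = mukai s t vs + mukai s t' vs"
  "mukai (\<lambda>vs. c * s vs) t vs = c * mukai s t vs"
  "mukai s (\<lambda>vs. c * t vs) vs = c * mukai s t vs"
  by (simp_all add: mukai_def reversal_simps wedge_linear)

lemma mukai_sum_left:
  "mukai (\<lambda>vs. \<Sum>i\<in>I. r i vs) t vs = (\<Sum>i\<in>I. mukai (r i) t vs)"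
  by (induction I rule: infinite_finite_induct)
     (simp_all add: mukai_linear, simp_all add: mukai_def reversal_def wedge_def)

lemma mukai_sum_right:
  "mukai s (\<lambda>vs. \<Sum>i\<in>I. t i vs) vs = (\<Sum>i\<in>I. mukai s (t i) vs)"
  by (induction I rule: infinite_finite_induct) 
     (simp_all add: mukai_linear, simp_all add: mukai_def reversal_def wedge_def)

text \<open>The product of the two forms vanishes on DIM + 1 vectors. Expanding this zero by the
  Leibniz rule moves the contraction across, and the sign from \<open>reversal\<close> cancels the
  one from \<open>grading\<close>.\<close>

lemma mukai_contract:
  fixes s t :: "('e::euclidean_space, 'k::real_normed_field) form"
  assumes "alternating_form s" "alternating_form t"
  shows "mukai (contract x s) t vs = mukai s (contract x t) vs"
proof (cases "length vs = DIM('e)")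
  case True
  have "alternating_form (wedge (grading (reversal s)) t)"
    by (intro alternating_wedge alternating_grading alternating_reversal assms)
  then have "wedge (grading (reversal s)) t (x # vs) = 0"
    by (rule alternating_vanishes) (use True in simp)
  then have "wedge (contract x (grading (reversal s))) t vs + wedge (reversal s) (contract x t) vs = 0"
    by (simp add: wedge_Cons)
  then show ?thesis using True
    by (simp add: mukai_eq contract_grading contract_reversal wedge_linear)
qed (simp add: mukai_def)

lemma mukai_wedge: "mukai (wedge \<alpha> s) t vs = mukai s (wedge (reversal \<alpha>) t) vs"
  by (simp add: mukai_def ext[OF reversal_wedge] wedge_assoc)

lemma mukai_clifford:
  assumes "alternating_form s" "alternating_form t"
  shows "mukai (clifford u s) t vs = mukai s (clifford u t) vs"
  by (simp add: clifford_def mukai_linear mukai_contract[OF assms] mukai_wedge reversal_one_form)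

lemma has_degree_mukai: "has_degree DIM('e) (mukai s t :: ('e::euclidean_space, 'k::comm_ring_1) form)"
  by (simp add: has_degree_def mukai_def)

lemma alternating_mukai:
  fixes s t :: "('e::euclidean_space, 'k::real_normed_field) form"
  assumes "alternating_form s" "alternating_form t"
  shows "alternating_form (mukai s t)"
proof -
  have "alternating_form (\<lambda>vs. of_bool (length vs = DIM('e)) * wedge (reversal s) t vs)"
    by (rule alternating_mult_length) (intro alternating_wedge alternating_reversal assms)
  moreover have "(\<lambda>vs. of_bool (length vs = DIM('e)) * wedge (reversal s) t vs) = mukai s t"
    by (auto simp: mukai_def)
  ultimately show ?thesis by simp
qed

section \<open>Nondegeneracy of the pairing on the canonical line\<close>

lemma canonical_fibreD:
  assumes "\<rho> \<in> canonical_fibre J" and J: "linear J" "\<And>u. J (J u) = - u"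
  shows "clifford u \<rho> = (\<lambda>vs. \<i> * clifford (J u) \<rho> vs)"
proof (rule ext)
  fix vs
  have "linear (\<lambda>u. clifford u \<rho> vs)"
    using assms(1) by (simp add: canonical_fibre_def clifford_left_linear)
  then have "clifford (- J u) \<rho> vs = - clifford (J u) \<rho> vs"
    by (rule linear_neg)
  moreover have "(u, - J u) \<in> eigenbundle J"
    using J by (simp add: eigenbundle_def linear_neg)
  then have "clifford u \<rho> vs + \<i> * clifford (- J u) \<rho> vs = 0"
    using assms(1) by (auto simp: canonical_fibre_def)
  ultimately show "clifford u \<rho> vs = \<i> * clifford (J u) \<rho> vs" by simp
qed

text \<open>On \<rho> the element \<open>J u\<close> acts as -i times \<open>u\<close>. Substituting
  this in the Clifford relation of \<open>J u\<close> and \<open>J w\<close> shows that the complex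
  bilinear pairing vanishes on \<open>L\<close>; its imaginary part is the claim, and its real part
  would say that \<open>J\<close> preserves the pairing.\<close>

lemma pairing_skew:
  assumes "\<rho> \<in> canonical_fibre J" and J: "linear J" "\<And>u. J (J u) = - u" and "\<rho> zs \<noteq> 0"
  shows "pairing (J u) w = - pairing u (J w)"
proof -
  note c = canonical_fibreD[OF assms(1-3)]
  have alt: "alternating_form \<rho>" using assms(1) by (simp add: canonical_fibre_def)
  note cc = clifford_clifford[OF alt, of _ _ zs]
  have Jc: "clifford (J u) \<rho> = (\<lambda>vs. - \<i> * clifford u \<rho> vs)" for u
    using c[of u] by (simp add: fun_eq_iff flip: mult.assoc)
  have "of_real (pairing (J u) (J w)) * \<rho> zs =
      - \<i> * (clifford (J u) (clifford w \<rho>) zs + clifford (J w) (clifford u \<rho>) zs)"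
    unfolding cc[of "J u" "J w", symmetric] by (simp only: Jc clifford_mult) (simp add: algebra_simps)
  also have "clifford (J u) (clifford w \<rho>) zs = of_real (pairing (J u) w) * \<rho> zs - clifford w (clifford (J u) \<rho>) zs"
    using cc[of "J u" w] by (simp add: algebra_simps)
  also have "clifford (J w) (clifford u \<rho>) zs = of_real (pairing (J w) u) * \<rho> zs - clifford u (clifford (J w) \<rho>) zs"
    using cc[of "J w" u] by (simp add: algebra_simps)
  also have "clifford w (clifford (J u) \<rho>) zs = - \<i> * clifford w (clifford u \<rho>) zs"
    by (simp only: Jc clifford_mult)
  also have "clifford u (clifford (J w) \<rho>) zs = - \<i> * clifford u (clifford w \<rho>) zs"
    by (simp only: Jc clifford_mult)
  finally have "of_real (pairing (J u) (J w)) * \<rho> zs =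
      - \<i> * of_real (pairing (J u) w + pairing (J w) u) * \<rho> zs +
      (clifford u (clifford w \<rho>) zs + clifford w (clifford u \<rho>) zs)"
    by (simp add: algebra_simps)
  then have "(of_real (pairing (J u) (J w)) + \<i> * of_real (pairing (J u) w + pairing (J w) u) - of_real (pairing u w)) * \<rho> zs = 0"
    unfolding cc by (simp add: algebra_simps)
  then have "of_real (pairing (J u) (J w)) + \<i> * of_real (pairing (J u) w + pairing (J w) u) - of_real (pairing u w) = (0 :: complex)"
    using assms(4) by (simp only: mult_eq_0_iff) simp
  from arg_cong[OF this, of Im] show ?thesis by simp
qed

lemma alternating_foldr_clifford:
  "alternating_form \<phi> \<Longrightarrow> alternating_form (foldr clifford us \<phi>)"
  by (induction us) (simp_all add: alternating_clifford)

lemma foldr_clifford_diff: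
  "foldr clifford us (\<lambda>vs. c * \<phi> vs - \<psi> vs) = (\<lambda>vs. c * foldr clifford us \<phi> vs - foldr clifford us \<psi> vs)"
  by (induction us) (simp_all add: clifford_diff clifford_mult)

lemma mukai_foldr_clifford:
  assumes "alternating_form s" "alternating_form t"
  shows "mukai (foldr clifford us s) t vs = mukai s (foldr clifford (rev us) t) vs"
  using assms(2)
proof (induction us arbitrary: t)
  case (Cons u us)
  then show ?case
    by (simp add: mukai_clifford alternating_foldr_clifford alternating_clifford assms(1))
qed simp

text \<open>Modulo the annihilator \<open>L\<close> of \<open>\<rho>\<close> and its conjugate, which annihilates \<open>cnj_form \<rho>\<close>, the
  Clifford relations shorten any word applied to \<open>\<rho>\<close>.\<close>

lemma mukai_word_eq_0:
  assumes \<rho>: "\<rho> \<in> canonical_fibre J" and J: "linear J" "\<And>u. J (J u) = - u"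
    and zero: "mukai \<rho> (cnj_form \<rho>) bs = 0"
  shows "mukai (foldr clifford us \<rho>) (cnj_form \<rho>) bs = 0"
proof (induction "length us" arbitrary: us rule: less_induct)
  case less
  note c = canonical_fibreD[OF \<rho> J]
  have alt: "alternating_form \<rho>" using \<rho> by (simp add: canonical_fibre_def)
  show ?case
  proof (cases us)
    case Nil
    then show ?thesis using zero by simp
  next
    case (Cons u ws)
    \<comment> \<open>\<open>a\<close> is the action of \<open>u\<close> - i \<open>J u\<close>, an
      element of \<open>L\<close> and hence zero on \<rho>. Moving it through the word towards
      \<rho> leaves, at each letter, a scalar times a word with two letters fewer than
      \<open>us\<close>.\<close>
    define a where "a \<phi> = (\<lambda>vs. clifford u \<phi> vs - \<i> * clifford (J u) \<phi> vs)" for \<phi>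
    have a\<rho>: "a \<rho> = (\<lambda>vs. 0)" using c[of u] by (simp add: a_def fun_eq_iff)
    have push: "mukai (foldr clifford p (a (foldr clifford q \<rho>))) (cnj_form \<rho>) bs = 0"
      if "length p + length q = length ws" for p q
      using that
    proof (induction q arbitrary: p)
      case Nil
      have "foldr clifford p (\<lambda>vs. 0) = (\<lambda>vs. 0)" by (induction p) simp_all
      then show ?case using mukai_linear(3)[of 0 "\<lambda>vs. 0" "cnj_form \<rho>" bs] by (simp add: a\<rho>)
    next
      case (Cons w q)
      let ?s = "foldr clifford q \<rho>"
      have s: "alternating_form ?s" by (rule alternating_foldr_clifford[OF alt])
      let ?c = "of_real (pairing u w) - \<i> * of_real (pairing (J u) w) :: complex"
      have "a (clifford w ?s) = (\<lambda>vs. ?c * ?s vs - clifford w (a ?s) vs)"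
      proof (rule ext)
        fix vs
        have eqs: "clifford u (clifford w ?s) vs = of_real (pairing u w) * ?s vs - clifford w (clifford u ?s) vs"
          "clifford (J u) (clifford w ?s) vs = of_real (pairing (J u) w) * ?s vs - clifford w (clifford (J u) ?s) vs"
          using clifford_clifford[OF s, of u w vs] clifford_clifford[OF s, of "J u" w vs]
          by (simp_all add: algebra_simps)
        show "a (clifford w ?s) vs = ?c * ?s vs - clifford w (a ?s) vs"
          unfolding a_def clifford_diff clifford_mult eqs by (simp add: algebra_simps)
      qed
      then have "foldr clifford p (a (foldr clifford (w # q) \<rho>)) =
          (\<lambda>vs. ?c * foldr clifford (p @ q) \<rho> vs + (-1) * foldr clifford (p @ [w]) (a ?s) vs)"
        by (simp add: foldr_clifford_diff)
      then have "mukai (foldr clifford p (a (foldr clifford (w # q) \<rho>))) (cnj_form \<rho>) bs =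
          ?c * mukai (foldr clifford (p @ q) \<rho>) (cnj_form \<rho>) bs +
          (-1) * mukai (foldr clifford (p @ [w]) (a ?s)) (cnj_form \<rho>) bs"
        by (simp only: mukai_linear)
      moreover have "mukai (foldr clifford (p @ q) \<rho>) (cnj_form \<rho>) bs = 0"
        by (rule less) (use Cons.prems \<open>us = u # ws\<close> in simp)
      moreover have "mukai (foldr clifford (p @ [w]) (a ?s)) (cnj_form \<rho>) bs = 0"
        by (rule Cons.IH) (use Cons.prems in simp)
      ultimately show ?case by simp
    qed
    let ?s = "foldr clifford ws \<rho>"
    have s: "alternating_form ?s" by (rule alternating_foldr_clifford[OF alt])
    have "clifford u (cnj_form \<rho>) = (\<lambda>vs. - \<i> * clifford (J u) (cnj_form \<rho>) vs)"
      using arg_cong[OF c[of u], of cnj_form] by (simp add: cnj_clifford[symmetric]) (simp add: cnj_form_def)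
    then have Jc: "clifford (J u) (cnj_form \<rho>) = (\<lambda>vs. \<i> * clifford u (cnj_form \<rho>) vs)"
      by (simp flip: mult.assoc)
    have "a ?s = (\<lambda>vs. clifford u ?s vs + (- \<i>) * clifford (J u) ?s vs)"
      by (simp add: a_def)
    then have "mukai (a ?s) (cnj_form \<rho>) bs =
        mukai (clifford u ?s) (cnj_form \<rho>) bs + (- \<i>) * mukai (clifford (J u) ?s) (cnj_form \<rho>) bs"
      by (simp only: mukai_linear)
    \<comment> \<open>Across the pairing, \<open>u\<close> - i \<open>J u\<close> meets the
      conjugate spinor, where \<open>J u\<close> acts as i times \<open>u\<close>; the two terms add
      up instead of cancelling.\<close>
    also have "\<dots> = 2 * mukai (clifford u ?s) (cnj_form \<rho>) bs"
      by (simp only: mukai_clifford[OF s alternating_cnj_form[OF alt]] Jc mukai_linear)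
         (simp flip: mult.assoc)
    finally show ?thesis using push[of "[]" ws] \<open>us = u # ws\<close> by simp
  qed
qed

section \<open>Words of vectors and of coordinate covectors\<close>

lemma clifford_vector:
  fixes \<phi> :: "('e::euclidean_space, complex) form"
  shows "clifford (x, 0) \<phi> = contract x \<phi>"
proof -
  have "one_form (0 :: 'e \<Rightarrow>\<^sub>L real) = (\<lambda>vs. 0 :: complex)" by (auto simp: one_form_def)
  then show ?thesis by (simp add: clifford_def)
qed

lemma clifford_covector: "alternating_form \<phi> \<Longrightarrow> clifford (0, \<xi>) \<phi> = wedge (one_form \<xi>) \<phi>"
  using linear_0[OF alternating_linear_hd[of \<phi>]] by (simp add: clifford_def contract_def)

lemma foldr_clifford_vectors:
  "foldr clifford (map (\<lambda>x. (x, 0)) xs) \<phi> = (\<lambda>vs. \<phi> (rev xs @ vs))"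
  by (induction xs arbitrary: \<phi>) (simp_all add: clifford_vector contract_def)

abbreviation wedges :: "'e::euclidean_space list \<Rightarrow> ('e, complex) form \<Rightarrow> ('e, complex) form" where
  "wedges cs \<equiv> foldr (\<lambda>c. wedge (one_form (blinfun_inner_right c))) cs"

lemma foldr_clifford_covectors:
  assumes "alternating_form \<phi>"
  shows "foldr clifford (map (\<lambda>c. (0, blinfun_inner_right c)) cs) \<phi> = wedges cs \<phi> \<and> alternating_form (wedges cs \<phi>)"
  using assms by (induction cs) (simp_all add: clifford_covector alternating_wedge alternating_one_form)

lemma wedge_low_degree:
  assumes "\<And>us. length us \<le> length vs \<Longrightarrow> \<beta> us = 0"
  shows "wedge \<alpha> \<beta> vs = 0"
proof -
  have "length (nths vs S) \<le> length vs" for S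
  proof -
    have "card {i. i < length vs \<and> i \<in> S} \<le> card {..<length vs}" by (rule card_mono) auto
    then show ?thesis by (simp add: length_nths)
  qed
  then show ?thesis unfolding wedge_def by (intro sum.neutral) (simp add: assms)
qed

lemma wedge_min_degree:
  assumes "\<And>us. length us < length vs \<Longrightarrow> \<beta> us = 0"
  shows "wedge \<alpha> \<beta> vs = \<alpha> [] * \<beta> vs"
  using assms
proof (induction vs arbitrary: \<alpha> \<beta>)
  case (Cons x vs)
  have "wedge (contract x \<alpha>) \<beta> vs = 0"
    by (rule wedge_low_degree) (simp add: Cons.prems)
  moreover have "wedge (grading \<alpha>) (contract x \<beta>) vs = grading \<alpha> [] * contract x \<beta> vs"
    by (rule Cons.IH) (simp add: contract_def Cons.prems)
  ultimately show ?case by (simp add: wedge_Cons) (simp add: contract_def grading_def)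
qed simp

lemma wedge_one_form_low_degree:
  fixes \<beta> :: "('e::real_normed_vector, 'k::real_normed_field) form"
  assumes "\<And>us. length us < n \<Longrightarrow> \<beta> us = 0" and "length vs \<le> n"
  shows "wedge (one_form \<xi>) \<beta> vs = 0"
  using assms
proof (induction vs arbitrary: \<beta> n)
  case (Cons x vs)
  have "wedge (one_form \<xi>) (contract x \<beta>) vs = 0"
    by (rule Cons.IH[of "n - 1"]) (use Cons.prems in \<open>auto simp: contract_def\<close>)
  then show ?case using Cons.prems by (simp add: wedge_one_form_Cons)
qed (simp add: one_form_def)

lemma wedges_low_degree: "length vs < length cs \<Longrightarrow> wedges cs \<phi> vs = 0"
proof (induction cs arbitrary: vs)
  case (Cons c cs)
  show ?case
    using Cons.prems by (simp, intro wedge_one_form_low_degree[OF Cons.IH]) auto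
qed simp

lemma contract_wedges:
  assumes "c \<in> Basis" "set cs \<subseteq> Basis" "c \<notin> set cs"
  shows "contract c (wedges cs \<phi>) = (\<lambda>vs. (-1) ^ length cs * wedges cs (contract c \<phi>) vs)"
  using assms(2,3)
proof (induction cs)
  case (Cons d cs)
  then have "d \<bullet> c = 0" using assms(1) by (auto simp: inner_Basis)
  moreover have "contract c (wedges cs \<phi>) = (\<lambda>vs. (-1) ^ length cs * wedges cs (contract c \<phi>) vs)"
    using Cons by simp
  ultimately show ?case
    by (intro ext) (simp add: contract_wedge_one_form wedge_linear)
qed simp

text \<open>In the Leibniz expansion at the head, contraction with \<open>c\<close> passes through
  the remaining covectors, which are orthogonal to \<open>c\<close>. What it leaves starts in degree
  \<open>length cs\<close>, and one more covector makes that too high to be seen on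
  \<open>cs\<close>.\<close>

lemma wedges_self:
  assumes "distinct cs" "set cs \<subseteq> Basis"
  shows "wedges cs \<phi> cs = \<phi> []"
  using assms
proof (induction cs arbitrary: \<phi>)
  case (Cons c cs)
  have "wedge (one_form (blinfun_inner_right c)) (contract c (wedges cs \<phi>)) cs = 0"
    by (rule wedge_one_form_low_degree[of "length cs"])
       (use Cons.prems in \<open>simp_all add: contract_wedges wedges_low_degree\<close>)
  then show ?case using Cons by (simp add: wedge_one_form_Cons inner_Basis)
qed simp

text \<open>If the pairing vanished, every Clifford word on \<rho> would pair to zero with the
  conjugate. The word used here contracts \<rho> down to the scalar \<open>\<rho> zs\<close>,
  multiplies by all basis covectors and contracts again; its value is the squared modulus of
  \<open>\<rho> zs\<close>.\<close>

lemma mukai_cnj_nonzero: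
  assumes \<rho>: "\<rho> \<in> canonical_fibre J" and J: "linear J" "\<And>u. J (J u) = - u"
    and nz: "\<rho> zs \<noteq> 0" and cs: "distinct cs" "set cs = (Basis :: 'e::euclidean_space set)"
  shows "mukai \<rho> (cnj_form \<rho>) cs \<noteq> 0"
proof
  assume "mukai \<rho> (cnj_form \<rho>) cs = 0"
  note w = mukai_word_eq_0[OF \<rho> J this]
  have len: "length cs = DIM('e)" using cs by (metis distinct_card)
  have alt: "alternating_form \<rho>" using \<rho> by (simp add: canonical_fibre_def)
  let ?v = "\<lambda>xs. map (\<lambda>x. (x, 0)) xs :: 'e gtan list"
  let ?c = "\<lambda>xs. map (\<lambda>c. (0, blinfun_inner_right c)) xs :: 'e gtan list"
  define s where "s = foldr clifford (?v (rev zs)) \<rho>"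
  define t where "t = foldr clifford (rev (?v zs)) (cnj_form \<rho>)"
  have s: "alternating_form s" "s [] = \<rho> zs"
    unfolding s_def using alt by (simp_all add: alternating_foldr_clifford, simp only: foldr_clifford_vectors, simp)
  have t: "alternating_form t" "t [] = cnj (\<rho> zs)"
    unfolding t_def using alternating_cnj_form[OF alt]
    by (simp add: alternating_foldr_clifford)
       (simp only: rev_map foldr_clifford_vectors, simp add: cnj_form_def)
  have "0 = mukai (foldr clifford (?v zs @ ?c (rev cs) @ ?v (rev zs)) \<rho>) (cnj_form \<rho>) cs"
    by (simp only: w)
  also have "\<dots> = mukai (foldr clifford (?v zs) (foldr clifford (?c (rev cs)) s)) (cnj_form \<rho>) cs"
    by (simp add: s_def)
  also have "\<dots> = mukai (foldr clifford (?c (rev cs)) s) t cs"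
    unfolding t_def
    by (rule mukai_foldr_clifford) (intro alternating_foldr_clifford alternating_cnj_form s(1) alt)+
  also have "\<dots> = mukai s (foldr clifford (?c cs) t) cs"
    by (subst mukai_foldr_clifford[OF s(1) t(1)]) (simp add: rev_map)
  also have "\<dots> = wedge (reversal s) (wedges cs t) cs"
    using foldr_clifford_covectors[OF t(1), of cs] len by (simp add: mukai_eq)
  \<comment> \<open>The right factor has no component below the top degree, so only the scalar part
    of the left factor contributes.\<close>
  also have "\<dots> = reversal s [] * wedges cs t cs"
    by (rule wedge_min_degree) (rule wedges_low_degree)
  also have "\<dots> = \<rho> zs * cnj (\<rho> zs)"
    using wedges_self[OF cs(1), of t] cs(2) s(2) t(2) by (simp add: reversal_def)
  finally show False using nz by simp
qed

text \<open>The covector dual to \<open>Z\<close> wedged with a top form vanishes; evaluated on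
  \<open>Z # zs\<close> it leaves the squared norm of \<open>Z\<close> times
  \<open>\<nu> zs\<close>.\<close>

lemma top_form_contract_eq_0:
  fixes \<nu> :: "('e::euclidean_space, complex) form"
  assumes "alternating_form \<nu>" "has_degree DIM('e) \<nu>" "\<nu> zs \<noteq> 0"
    and Z: "\<And>vs. contract Z \<nu> vs = 0"
  shows "Z = 0"
proof -
  have "length zs = DIM('e)" using assms(2,3) by (auto simp: has_degree_def)
  then have "wedge (one_form (blinfun_inner_right Z)) \<nu> (Z # zs) = 0"
    by (intro alternating_vanishes alternating_wedge alternating_one_form assms(1)) simp
  moreover have "contract Z \<nu> = (\<lambda>vs. 0)" using Z by auto
  ultimately show ?thesis using assms(3) by (simp add: wedge_one_form_Cons)
qed

section \<open>Contraction with a bivector\<close>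

definition skew_map :: "(('e::euclidean_space \<Rightarrow>\<^sub>L real) \<Rightarrow> 'e) \<Rightarrow> bool" where
  "skew_map b \<longleftrightarrow> linear b \<and> (\<forall>\<xi> \<eta>. blinfun_apply \<eta> (b \<xi>) = - blinfun_apply \<xi> (b \<eta>))"

abbreviation bcoeff :: "(('e::euclidean_space \<Rightarrow>\<^sub>L real) \<Rightarrow> 'e) \<Rightarrow> 'e \<Rightarrow> 'e \<Rightarrow> real" where
  "bcoeff b i j \<equiv> b (blinfun_inner_right i) \<bullet> j"

lemma bcoeff_skew: "skew_map b \<Longrightarrow> bcoeff b i j = - bcoeff b j i"
  unfolding skew_map_def by (metis blinfun_inner_right.rep_eq inner_commute)

lemma contract_bivector_eq:
  "contract_bivector b \<phi> vs = (1 / 2) * (\<Sum>i\<in>Basis. \<Sum>j\<in>Basis. of_real (bcoeff b i j) * \<phi> (i # j # vs))"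
  by (simp add: contract_bivector_def contract_def scaleR_conv_of_real)

lemma contract_bivector_add:
  "contract_bivector b (\<lambda>vs. \<phi> vs + \<psi> vs) = (\<lambda>vs. contract_bivector b \<phi> vs + contract_bivector b \<psi> vs)"
  by (simp add: fun_eq_iff contract_bivector_eq algebra_simps sum.distrib)

lemma contract_bivector_mult:
  "contract_bivector b (\<lambda>vs. c * \<phi> vs) = (\<lambda>vs. c * contract_bivector b \<phi> vs)"
  by (simp add: fun_eq_iff contract_bivector_eq algebra_simps sum_distrib_left)

lemma contract_bivector_zero [simp]: "contract_bivector b (\<lambda>vs. 0) = (\<lambda>vs. 0)"
  by (simp add: fun_eq_iff contract_bivector_eq)

lemma contract_bivector_sum:
  "contract_bivector b (\<lambda>vs. \<Sum>i\<in>I. \<phi> i vs) = (\<lambda>vs. \<Sum>i\<in>I. contract_bivector b (\<phi> i) vs)"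
  by (induction I rule: infinite_finite_induct) (simp_all add: contract_bivector_add)

lemma alternating_contract_bivector:
  assumes "alternating_form \<phi>"
  shows "alternating_form (contract_bivector b \<phi>)"
proof -
  have "alternating_form (\<lambda>vs. \<phi> (i # j # vs))" for i j
    using alternating_contract[OF alternating_contract[OF assms], of j i] by (simp add: contract_def)
  then show ?thesis
    unfolding contract_bivector_eq[abs_def] by (intro alternating_mult alternating_sum)
qed

lemma contract_bivector_contract:
  assumes "alternating_form \<phi>"
  shows "contract_bivector b (contract u \<phi>) = contract u (contract_bivector b \<phi>)"
proof -
  have "\<phi> (u # i # j # vs) = \<phi> (i # j # u # vs)" for i j vs
    using alternating_swap_hd[OF assms, of u i "j # vs"] alternating_swap[OF assms, of "[i]" u j vs] by simp
  then show ?thesis by (simp add: fun_eq_iff contract_def[of u] contract_bivector_eq)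
qed

lemma blinfun_basis_sum: "(\<xi> :: 'e::euclidean_space \<Rightarrow>\<^sub>L real) = (\<Sum>i\<in>Basis. blinfun_apply \<xi> i *\<^sub>R blinfun_inner_right i)"
proof (rule blinfun_euclidean_eqI)
  fix j :: 'e assume "j \<in> Basis"
  have "blinfun_apply (\<Sum>i\<in>Basis. blinfun_apply \<xi> i *\<^sub>R blinfun_inner_right i) j =
      (\<Sum>i\<in>Basis. if i = j then blinfun_apply \<xi> i else 0)"
    unfolding blinfun.sum_left using \<open>j \<in> Basis\<close> 
    by (intro sum.cong) (auto simp: blinfun.scaleR_left inner_Basis)
  then show "blinfun_apply \<xi> j = blinfun_apply (\<Sum>i\<in>Basis. blinfun_apply \<xi> i *\<^sub>R blinfun_inner_right i) j"
    using \<open>j \<in> Basis\<close> by simp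
qed

lemma linear_covector_sum:
  assumes "linear f"
  shows "f \<xi> = (\<Sum>i\<in>Basis. blinfun_apply \<xi> i *\<^sub>R f (blinfun_inner_right (i :: 'e::euclidean_space)))"
  by (subst blinfun_basis_sum) (simp add: linear_sum[OF assms] linear_scale[OF assms])

lemma linear_basis_sum:
  assumes "linear f"
  shows "f x = (\<Sum>i\<in>Basis. (x \<bullet> i) *\<^sub>R f (i :: 'e::euclidean_space))"
  by (subst euclidean_representation[of x, symmetric])
     (simp only: linear_sum[OF assms] linear_scale[OF assms])

text \<open>The double contraction is of second order in the exterior algebra, so its commutator
  with an exterior multiplication is a single contraction. All later commutators of
  \<open>contract_bivector\<close> come from this one.\<close>

lemma contract_bivector_wedge:
  fixes \<psi> :: "('e::euclidean_space, complex) form"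
  assumes b: "skew_map b" and alt: "alternating_form \<psi>"
  shows "contract_bivector b (wedge (one_form \<eta>) \<psi>) vs =
    wedge (one_form \<eta>) (contract_bivector b \<psi>) vs + contract (b \<eta>) \<psi> vs"
proof -
  let ?e = "blinfun_apply \<eta>"
  have lin: "linear (\<lambda>z. \<psi> (z # vs))" using alternating_linear_hd[OF alt] .
  have P: "(\<Sum>j\<in>Basis. of_real (bcoeff b i j) * \<psi> (j # vs)) = \<psi> (b (blinfun_inner_right i) # vs)" for i
    using linear_basis_sum[OF lin, of "b (blinfun_inner_right i)"] by (simp add: scaleR_conv_of_real)
  have Q: "(\<Sum>i\<in>Basis. of_real (?e i) * \<psi> (b (blinfun_inner_right i) # vs)) = \<psi> (b \<eta> # vs)"
  proof -
    have "linear (\<lambda>\<xi>. \<psi> (b \<xi> # vs))"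
      using linear_compose[of b, OF _ lin] b by (simp add: o_def skew_map_def)
    from linear_covector_sum[OF this, of \<eta>] show ?thesis by (simp add: scaleR_conv_of_real)
  qed
  have "wedge (one_form \<eta>) \<psi> (i # j # vs) =
      of_real (?e i) * \<psi> (j # vs) - of_real (?e j) * \<psi> (i # vs) +
      wedge (one_form \<eta>) (\<lambda>vs. \<psi> (i # j # vs)) vs" for i j :: 'e
    by (simp add: wedge_one_form_Cons) (simp add: contract_def)
  note w = this
  have "contract_bivector b (wedge (one_form \<eta>) \<psi>) vs =
      (1 / 2) * ((\<Sum>i\<in>Basis. \<Sum>j\<in>Basis. of_real (bcoeff b i j) * (of_real (?e i) * \<psi> (j # vs)))
       + (\<Sum>i\<in>Basis. \<Sum>j\<in>Basis. of_real (- bcoeff b i j) * (of_real (?e j) * \<psi> (i # vs))))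
       + (1 / 2) * (\<Sum>i\<in>Basis. \<Sum>j\<in>Basis. of_real (bcoeff b i j) * wedge (one_form \<eta>) (\<lambda>vs. \<psi> (i # j # vs)) vs)"
    unfolding contract_bivector_eq[of b "wedge _ _"] w
    by (simp add: algebra_simps sum.distrib sum_subtractf sum_negf)
  also have "(\<Sum>i\<in>Basis. \<Sum>j\<in>Basis. of_real (bcoeff b i j) * (of_real (?e i) * \<psi> (j # vs))) = \<psi> (b \<eta> # vs)"
    unfolding Q[symmetric] P[symmetric] sum_distrib_left by (simp add: mult_ac)
  \<comment> \<open>By skewness the second cross term equals the first after exchanging the indices,
    and together they cancel the factor 1/2.\<close>
  also have "(\<Sum>i\<in>Basis. \<Sum>j\<in>Basis. of_real (- bcoeff b i j) * (of_real (?e j) * \<psi> (i # vs))) = \<psi> (b \<eta> # vs)"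
    unfolding bcoeff_skew[OF b, symmetric] Q[symmetric] P[symmetric] sum_distrib_left
    by (subst sum.swap) (simp add: mult_ac)
  also have "(1 / 2) * (\<Sum>i\<in>Basis. \<Sum>j\<in>Basis. of_real (bcoeff b i j) * wedge (one_form \<eta>) (\<lambda>vs. \<psi> (i # j # vs)) vs)
      = wedge (one_form \<eta>) (contract_bivector b \<psi>) vs"
    unfolding contract_bivector_eq[abs_def] by (simp only: wedge_linear wedge_sum_right)
  finally show ?thesis by (simp add: contract_def)
qed

lemma contract_bivector_power_degree:
  assumes "has_degree n \<phi>" "n < length us + 2 * m"
  shows "(contract_bivector b ^^ m) \<phi> us = 0"
  using assms(2)
proof (induction m arbitrary: us)
  case 0
  then show ?case using assms(1) by (simp add: has_degree_def)
next
  case (Suc m)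
  then show ?case by (simp add: contract_bivector_eq)
qed

text \<open>Positive powers of the contraction lower the degree, so the exponential is invisible in
  the original degree. This lets the modular equation determine its vector field.\<close>

lemma exp_bivector_top:
  assumes "has_degree n \<phi>" "length us = n"
  shows "exp_bivector b \<phi> us = \<phi> us"
proof -
  have "{..DIM('a)} = insert 0 {0<..DIM('a)}" by auto
  then have "exp_bivector b \<phi> us = \<phi> us + (\<Sum>k\<in>{0<..DIM('a)}. (1 / fact k) *\<^sub>R (contract_bivector b ^^ k) \<phi> us)"
    by (simp add: exp_bivector_def)
  also have "(\<Sum>k\<in>{0<..DIM('a)}. (1 / fact k) *\<^sub>R (contract_bivector b ^^ k) \<phi> us) = 0"
    by (rule sum.neutral) (auto simp: contract_bivector_power_degree[OF assms(1)] assms(2))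
  finally show ?thesis by simp
qed

section \<open>Smooth functions\<close>

lemma frechet_derivative_cong_open:
  assumes "open S" "x \<in> S" "\<And>y. y \<in> S \<Longrightarrow> f y = g y"
  shows "frechet_derivative f (at x) = frechet_derivative g (at x)"
proof -
  have "(f has_derivative D) (at x) \<longleftrightarrow> (g has_derivative D) (at x)" for D
    using has_derivative_transform_within_open[OF _ assms(1,2), of f D UNIV g]
      has_derivative_transform_within_open[OF _ assms(1,2), of g D UNIV f] assms(3) by metis
  then show ?thesis by (simp add: frechet_derivative_def)
qed

lemma differentiable_cong_open:
  assumes "open S" "x \<in> S" "\<And>y. y \<in> S \<Longrightarrow> f y = g y" "f differentiable (at x)"
  shows "g differentiable (at x)"
  using assms has_derivative_transform_within_open[of f _ x UNIV S g] unfolding differentiable_def by blast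

lemma Ck_on_cong:
  assumes "open S" "\<And>x. x \<in> S \<Longrightarrow> f x = g x" "Ck_on k S f"
  shows "Ck_on k S g"
  using assms(2,3)
proof (induction k arbitrary: f g)
  case 0
  have "continuous_on S g"
    using Ck_on.simps(1)[THEN iffD1, OF 0(2)] 0(1) by (rule continuous_on_eq)
  then show ?case by simp
next
  case (Suc k)
  have "Ck_on k S (\<lambda>x. frechet_derivative g (at x) v)" for v
  proof (rule Suc.IH)
    show "frechet_derivative f (at x) v = frechet_derivative g (at x) v" if "x \<in> S" for x
      using frechet_derivative_cong_open[OF assms(1) that Suc.prems(1)] by simp
    show "Ck_on k S (\<lambda>x. frechet_derivative f (at x) v)"
      using Suc.prems(2) by simp
  qed
  moreover have "g differentiable (at x)" if "x \<in> S" for x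
    using differentiable_cong_open[OF assms(1) that Suc.prems(1)] Suc.prems(2) that by simp
  ultimately show ?case by simp
qed

lemma Ck_on_subset: "Ck_on k S f \<Longrightarrow> T \<subseteq> S \<Longrightarrow> Ck_on k T f"
  by (induction k arbitrary: f) (auto intro: continuous_on_subset)

lemma Ck_on_Suc_imp: "Ck_on (Suc k) S f \<Longrightarrow> Ck_on k S f"
proof (induction k arbitrary: f)
  case 0
  then show ?case
    by (auto intro!: continuous_at_imp_continuous_on differentiable_imp_continuous_within)
next
  case (Suc k)
  then show ?case by (subst Ck_on.simps) (simp only: Ck_on.simps(2)[of "Suc k"], blast)
qed

text \<open>Smoothness proofs may use any explicit derivative that is valid on the open set;
  \<open>frechet_derivative\<close> then stays out of the inductions.\<close>

lemma Ck_on_SucI: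
  assumes "open S" "\<And>x. x \<in> S \<Longrightarrow> (f has_derivative f' x) (at x)" "\<And>v. Ck_on k S (\<lambda>x. f' x v)"
  shows "Ck_on (Suc k) S f"
proof -
  have "f' x = frechet_derivative f (at x)" if "x \<in> S" for x
    using frechet_derivative_at[OF assms(2)[OF that]] .
  then have "Ck_on k S (\<lambda>x. frechet_derivative f (at x) v)" for v
    using assms(3) by (intro Ck_on_cong[OF assms(1) _ assms(3)[of v]]) simp
  then show ?thesis using assms(2) by (auto simp: differentiable_def)
qed

lemma Ck_on_SucD:
  assumes "Ck_on (Suc k) S f" "x \<in> S"
  shows "(f has_derivative frechet_derivative f (at x)) (at x)"
  using assms frechet_derivative_works by auto

lemma Ck_on_const: "open S \<Longrightarrow> Ck_on k S (\<lambda>x. c)"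
proof (induction k arbitrary: c)
  case (Suc k)
  then show ?case by (intro Ck_on_SucI[where f' = "\<lambda>x v. 0"]) auto
qed simp

lemma Ck_on_add:
  assumes "open S" "Ck_on k S f" "Ck_on k S g"
  shows "Ck_on k S (\<lambda>x. f x + g x)"
  using assms(2,3)
proof (induction k arbitrary: f g)
  case 0
  then show ?case by (simp add: continuous_on_add)
next
  case (Suc k)
  show ?case
  proof (rule Ck_on_SucI[OF assms(1)])
    show "((\<lambda>x. f x + g x) has_derivative
        (\<lambda>v. frechet_derivative f (at x) v + frechet_derivative g (at x) v)) (at x)" if "x \<in> S" for x
      using Ck_on_SucD[OF Suc.prems(1) that] Ck_on_SucD[OF Suc.prems(2) that]
      by (rule has_derivative_add)
    show "Ck_on k S (\<lambda>x. frechet_derivative f (at x) v + frechet_derivative g (at x) v)" for v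
      using Suc.prems by (intro Suc.IH) auto
  qed
qed

lemma Ck_on_bounded_linear:
  assumes "open S" "bounded_linear h" "Ck_on k S f"
  shows "Ck_on k S (\<lambda>x. h (f x))"
  using assms(3)
proof (induction k arbitrary: f)
  case 0
  then show ?case using linear_continuous_on_compose bounded_linear.continuous_on[OF assms(2)] by simp
next
  case (Suc k)
  show ?case
  proof (rule Ck_on_SucI[OF assms(1)])
    show "((\<lambda>x. h (f x)) has_derivative (\<lambda>v. h (frechet_derivative f (at x) v))) (at x)" if "x \<in> S" for x
      using bounded_linear.has_derivative[OF assms(2) Ck_on_SucD[OF Suc.prems that]] .
    show "Ck_on k S (\<lambda>x. h (frechet_derivative f (at x) v))" for v
      using Suc.prems by (intro Suc.IH) auto
  qed
qed

lemma Ck_on_bounded_bilinear: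
  assumes "open S" "bounded_bilinear h" "Ck_on k S f" "Ck_on k S g"
  shows "Ck_on k S (\<lambda>x. h (f x) (g x))"
  using assms(3,4)
proof (induction k arbitrary: f g)
  case 0
  then show ?case using bounded_bilinear.continuous_on[OF assms(2)] by simp
next
  case (Suc k)
  show ?case
  proof (rule Ck_on_SucI[OF assms(1)])
    show "((\<lambda>x. h (f x) (g x)) has_derivative
        (\<lambda>v. h (f x) (frechet_derivative g (at x) v) + h (frechet_derivative f (at x) v) (g x))) (at x)"
      if "x \<in> S" for x
      using bounded_bilinear.FDERIV[OF assms(2) Ck_on_SucD[OF Suc.prems(1) that] Ck_on_SucD[OF Suc.prems(2) that]] .
    show "Ck_on k S (\<lambda>x. h (f x) (frechet_derivative g (at x) v) + h (frechet_derivative f (at x) v) (g x))" for v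
      using Suc.prems Ck_on_Suc_imp[OF Suc.prems(1)] Ck_on_Suc_imp[OF Suc.prems(2)]
      by (intro Ck_on_add assms(1) Suc.IH) auto
  qed
qed

lemma smooth_on_cong: "open S \<Longrightarrow> (\<And>x. x \<in> S \<Longrightarrow> f x = g x) \<Longrightarrow> smooth_on S f \<Longrightarrow> smooth_on S g"
  unfolding smooth_on_def using Ck_on_cong by blast

lemma smooth_on_subset: "smooth_on S f \<Longrightarrow> T \<subseteq> S \<Longrightarrow> smooth_on T f"
  unfolding smooth_on_def using Ck_on_subset by blast

lemma smooth_on_const: "open S \<Longrightarrow> smooth_on S (\<lambda>x. c)"
  unfolding smooth_on_def using Ck_on_const by blast

lemma smooth_on_add: "open S \<Longrightarrow> smooth_on S f \<Longrightarrow> smooth_on S g \<Longrightarrow> smooth_on S (\<lambda>x. f x + g x)"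
  unfolding smooth_on_def using Ck_on_add by blast

lemma smooth_on_bounded_linear: "open S \<Longrightarrow> bounded_linear h \<Longrightarrow> smooth_on S f \<Longrightarrow> smooth_on S (\<lambda>x. h (f x))"
  unfolding smooth_on_def using Ck_on_bounded_linear by blast

lemma smooth_on_bounded_bilinear:
  "open S \<Longrightarrow> bounded_bilinear h \<Longrightarrow> smooth_on S f \<Longrightarrow> smooth_on S g \<Longrightarrow> smooth_on S (\<lambda>x. h (f x) (g x))"
  unfolding smooth_on_def using Ck_on_bounded_bilinear by blast

lemmas smooth_on_scaleR = smooth_on_bounded_bilinear[OF _ bounded_bilinear_scaleR]
lemmas smooth_on_mult = smooth_on_bounded_bilinear[OF _ bounded_bilinear_mult]
lemmas smooth_on_minus = smooth_on_bounded_linear[OF _ bounded_linear_minus[OF bounded_linear_ident]]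

lemma smooth_on_Pair:
  assumes "open S" "smooth_on S f" "smooth_on S g"
  shows "smooth_on S (\<lambda>x. (f x, g x))"
proof -
  have "smooth_on S (\<lambda>x. (f x, 0) + (0, g x))"
    using assms bounded_linear_Pair[OF bounded_linear_ident bounded_linear_zero]
      bounded_linear_Pair[OF bounded_linear_zero bounded_linear_ident]
    by (intro smooth_on_add) (auto intro: smooth_on_bounded_linear)
  then show ?thesis by simp
qed

lemma smooth_on_sum:
  assumes "open S" "\<And>i. i \<in> I \<Longrightarrow> smooth_on S (f i)"
  shows "smooth_on S (\<lambda>x. \<Sum>i\<in>I. f i x)"
  using assms(2)
  by (induction I rule: infinite_finite_induct) (simp_all add: smooth_on_const[OF assms(1)] smooth_on_add[OF assms(1)])

lemma smooth_on_differentiable: "smooth_on S f \<Longrightarrow> x \<in> S \<Longrightarrow> f differentiable (at x)"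
  unfolding smooth_on_def by (metis Ck_on.simps(2))

lemma smooth_on_has_derivative:
  "smooth_on S f \<Longrightarrow> x \<in> S \<Longrightarrow> (f has_derivative frechet_derivative f (at x)) (at x)"
  using smooth_on_differentiable frechet_derivative_works by blast

lemma smooth_on_derivative: "smooth_on S f \<Longrightarrow> smooth_on S (\<lambda>x. frechet_derivative f (at x) v)"
  unfolding smooth_on_def by (metis Ck_on.simps(2))

lemma smooth_on_id: "open S \<Longrightarrow> smooth_on S (\<lambda>x. x)"
  unfolding smooth_on_def
proof
  fix k assume "open S"
  then show "Ck_on k S (\<lambda>x. x)"
  proof (cases k)
    case (Suc n)
    show ?thesis unfolding Suc using \<open>open S\<close>
      by (intro Ck_on_SucI[where f' = "\<lambda>x v. v"]) (auto intro: Ck_on_const)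
  qed simp
qed

text \<open>The mean value theorem in direction \<open>u\<close> turns the second difference into
  \<open>t\<close> times an increment of the derivative along \<open>u\<close>. Differentiability of
  that derivative at the single point \<open>x\<close> then yields the quadratic term, with an error
  of order \<open>e\<close>.\<close>

lemma second_difference_bound:
  fixes f :: "'a::euclidean_space \<Rightarrow> real"
  assumes "open V" "x \<in> V" "smooth_on V f" "0 < e"
  shows "\<exists>d>0. \<forall>t. 0 < t \<and> t < d \<longrightarrow>
    \<bar>f (x + t *\<^sub>R u + t *\<^sub>R w) - f (x + t *\<^sub>R u) - f (x + t *\<^sub>R w) + f x -
      t\<^sup>2 * frechet_derivative (\<lambda>y. frechet_derivative f (at y) u) (at x) w\<bar> \<le> t\<^sup>2 * (e * (2 * norm u + norm w))"
proof -
  define g where "g y = frechet_derivative f (at y) u" for y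
  define G where "G = frechet_derivative g (at x)"
  have "smooth_on V g" unfolding g_def by (rule smooth_on_derivative[OF assms(3)])
  then have G: "(g has_derivative G) (at x)"
    unfolding G_def using assms(2) by (rule smooth_on_has_derivative)
  then interpret G: bounded_linear G by (rule has_derivative_bounded_linear)
  obtain r where r: "0 < r" "ball x r \<subseteq> V" using assms(1,2) open_contains_ball by blast
  obtain d where d: "0 < d" "\<And>y. norm (y - x) < d \<Longrightarrow> norm (g y - g x - G (y - x)) \<le> e * norm (y - x)"
    using G assms(4) unfolding has_derivative_at_alt by blast
  \<comment> \<open>Steps below \<open>D\<close> keep every point \<open>x + s u + t' w\<close>
    inside both the ball in \<open>V\<close> and the radius of the first-order estimate; the summand
    1 covers zero directions.\<close>
  define D where "D = min r d / (norm u + norm w + 1)"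
  have D: "0 < D" using r(1) d(1) by (simp add: D_def add_nonneg_pos)
  have small: "norm (s *\<^sub>R u + t' *\<^sub>R w) < min r d"
    if "0 \<le> s" "s \<le> t" "0 \<le> t'" "t' \<le> t" "0 < t" "t < D" for s t t'
  proof -
    have "norm (s *\<^sub>R u + t' *\<^sub>R w) \<le> s * norm u + t' * norm w"
      using norm_triangle_ineq[of "s *\<^sub>R u" "t' *\<^sub>R w"] that by simp
    also have "\<dots> \<le> t * norm u + t * norm w"
      using that by (intro add_mono mult_right_mono) auto
    also have "\<dots> < t * (norm u + norm w + 1)" using that by (simp add: algebra_simps)
    also have "\<dots> < D * (norm u + norm w + 1)"
      using that by (intro mult_strict_right_mono) (auto simp: add_nonneg_pos)
    also have "\<dots> = min r d" by (simp add: D_def add_nonneg_pos less_imp_neq[symmetric])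
    finally show ?thesis .
  qed
  have "\<bar>f (x + t *\<^sub>R u + t *\<^sub>R w) - f (x + t *\<^sub>R u) - f (x + t *\<^sub>R w) + f x - t\<^sup>2 * G w\<bar>
      \<le> t\<^sup>2 * (e * (2 * norm u + norm w))" if t: "0 < t" "t < D" for t
  proof -
    define F where "F s = f (x + s *\<^sub>R u + t *\<^sub>R w) - f (x + s *\<^sub>R u)" for s
    have inV: "x + s *\<^sub>R u + t' *\<^sub>R w \<in> V" if "0 \<le> s" "s \<le> t" "t' = 0 \<or> t' = t" for s t'
    proof -
      have "norm (s *\<^sub>R u + t' *\<^sub>R w) < r" using small[of s t t'] that t by auto
      then show ?thesis using r(2) by (force simp: dist_norm norm_minus_commute algebra_simps)
    qed
    have der: "((\<lambda>s. f (x + s *\<^sub>R u + t' *\<^sub>R w)) has_field_derivative g (x + s *\<^sub>R u + t' *\<^sub>R w)) (at s)"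
      if "0 \<le> s" "s \<le> t" "t' = 0 \<or> t' = t" for s t'
    proof -
      have f: "(f has_derivative frechet_derivative f (at (x + s *\<^sub>R u + t' *\<^sub>R w))) (at (x + s *\<^sub>R u + t' *\<^sub>R w))"
        by (rule smooth_on_has_derivative[OF assms(3) inV[OF that]])
      have l: "((\<lambda>s. x + s *\<^sub>R u + t' *\<^sub>R w) has_derivative (\<lambda>h. h *\<^sub>R u)) (at s)"
        by (auto intro!: derivative_eq_intros)
      from has_derivative_compose[OF l f]
      have "((\<lambda>s. f (x + s *\<^sub>R u + t' *\<^sub>R w)) has_derivative
          (\<lambda>h. frechet_derivative f (at (x + s *\<^sub>R u + t' *\<^sub>R w)) (h *\<^sub>R u))) (at s)" .
      then show ?thesis
        unfolding has_field_derivative_def g_def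
        by (simp add: linear_scale[OF has_derivative_linear[OF f]] mult.commute[of _ "frechet_derivative f _ _"])
    qed
    have "(F has_field_derivative g (x + s *\<^sub>R u + t *\<^sub>R w) - g (x + s *\<^sub>R u)) (at s)" if "0 \<le> s" "s \<le> t" for s
      unfolding F_def using der[of s t] der[of s 0] that by (auto intro!: DERIV_diff)
    then obtain s where s: "0 < s" "s < t" "F t - F 0 = (t - 0) * (g (x + s *\<^sub>R u + t *\<^sub>R w) - g (x + s *\<^sub>R u))"
      using MVT2[of 0 t F "\<lambda>s. g (x + s *\<^sub>R u + t *\<^sub>R w) - g (x + s *\<^sub>R u)"] t by auto
    have a: "\<bar>g (x + s *\<^sub>R u + t *\<^sub>R w) - g x - G (s *\<^sub>R u + t *\<^sub>R w)\<bar> \<le> e * norm (s *\<^sub>R u + t *\<^sub>R w)"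
      using d(2)[of "x + s *\<^sub>R u + t *\<^sub>R w"] small[of s t t] s t by (simp add: add.assoc)
    have b: "\<bar>g (x + s *\<^sub>R u) - g x - G (s *\<^sub>R u)\<bar> \<le> e * norm (s *\<^sub>R u)"
      using d(2)[of "x + s *\<^sub>R u"] small[of s t 0] s t by simp
    have n1: "norm (s *\<^sub>R u + t *\<^sub>R w) \<le> t * norm u + t * norm w"
      using norm_triangle_ineq[of "s *\<^sub>R u" "t *\<^sub>R w"] s t mult_right_mono[of s t "norm u"] by simp
    have n2: "norm (s *\<^sub>R u) \<le> t * norm u" using s mult_right_mono[of s t "norm u"] by simp
    have "\<bar>g (x + s *\<^sub>R u + t *\<^sub>R w) - g (x + s *\<^sub>R u) - t * G w\<bar> \<le> e * norm (s *\<^sub>R u + t *\<^sub>R w) + e * norm (s *\<^sub>R u)"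
      using a b by (simp add: G.add G.scaleR)
    also have "\<dots> \<le> e * (t * norm u + t * norm w) + e * (t * norm u)"
      using n1 n2 assms(4) by (intro add_mono mult_left_mono) auto
    finally have c: "\<bar>g (x + s *\<^sub>R u + t *\<^sub>R w) - g (x + s *\<^sub>R u) - t * G w\<bar> \<le> t * (e * (2 * norm u + norm w))"
      by (simp add: algebra_simps)
    have "f (x + t *\<^sub>R u + t *\<^sub>R w) - f (x + t *\<^sub>R u) - f (x + t *\<^sub>R w) + f x - t\<^sup>2 * G w =
        t * (g (x + s *\<^sub>R u + t *\<^sub>R w) - g (x + s *\<^sub>R u) - t * G w)"
      using s(3) by (simp add: F_def algebra_simps power2_eq_square)
    then show ?thesis
      using mult_left_mono[OF c, of t] t(1) by (simp add: abs_mult power2_eq_square mult.assoc)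
  qed
  then show ?thesis using D unfolding G_def g_def by blast
qed

text \<open>The second difference does not depend on the order of the two directions, and it
  approximates both mixed derivatives.\<close>

lemma second_derivative_symmetric:
  fixes f :: "'a::euclidean_space \<Rightarrow> real"
  assumes "open V" "x \<in> V" "smooth_on V f"
  shows "frechet_derivative (\<lambda>y. frechet_derivative f (at y) u) (at x) w =
    frechet_derivative (\<lambda>y. frechet_derivative f (at y) w) (at x) u" (is "?a = ?b")
proof -
  \<comment> \<open>The sum of the error factors \<open>2 * norm u + norm w\<close> and
    \<open>2 * norm w + norm u\<close> of the two approximations.\<close>
  define K where "K = 3 * (norm u + norm w)"
  have K: "0 \<le> K" by (simp add: K_def)
  have bound: "\<bar>?a - ?b\<bar> \<le> e * K" if e: "0 < e" for e
  proof -
    define \<Delta> where "\<Delta> t = f (x + t *\<^sub>R u + t *\<^sub>R w) - f (x + t *\<^sub>R u) - f (x + t *\<^sub>R w) + f x" for t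
    obtain d1 where d1: "0 < d1" "\<And>t. 0 < t \<Longrightarrow> t < d1 \<Longrightarrow> \<bar>\<Delta> t - t\<^sup>2 * ?a\<bar> \<le> t\<^sup>2 * (e * (2 * norm u + norm w))"
      using second_difference_bound[OF assms e, of u w] unfolding \<Delta>_def by blast
    obtain d2 where d2: "0 < d2" "\<And>t. 0 < t \<Longrightarrow> t < d2 \<Longrightarrow>
        \<bar>f (x + t *\<^sub>R w + t *\<^sub>R u) - f (x + t *\<^sub>R w) - f (x + t *\<^sub>R u) + f x - t\<^sup>2 * ?b\<bar> \<le> t\<^sup>2 * (e * (2 * norm w + norm u))"
      using second_difference_bound[OF assms e, of w u] by blast
    define t where "t = min d1 d2 / 2"
    have t: "0 < t" "t < d1" "t < d2" using d1(1) d2(1) by (auto simp: t_def)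
    have "\<bar>\<Delta> t - t\<^sup>2 * ?b\<bar> \<le> t\<^sup>2 * (e * (2 * norm w + norm u))"
      using d2(2)[OF t(1,3)] by (simp add: \<Delta>_def algebra_simps)
    with d1(2)[OF t(1,2)] have "\<bar>t\<^sup>2 * ?a - t\<^sup>2 * ?b\<bar> \<le> t\<^sup>2 * (e * (2 * norm u + norm w)) + t\<^sup>2 * (e * (2 * norm w + norm u))"
      by linarith
    also have "\<bar>t\<^sup>2 * ?a - t\<^sup>2 * ?b\<bar> = t\<^sup>2 * \<bar>?a - ?b\<bar>"
      by (simp only: right_diff_distrib[symmetric] abs_mult abs_power2)
    also have "t\<^sup>2 * (e * (2 * norm u + norm w)) + t\<^sup>2 * (e * (2 * norm w + norm u)) = t\<^sup>2 * (e * K)"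
      unfolding K_def by (simp only: distrib_left[symmetric]) simp
    finally have "t\<^sup>2 * \<bar>?a - ?b\<bar> \<le> t\<^sup>2 * (e * K)" .
    then show ?thesis using t(1) by (simp add: mult_le_cancel_left_pos)
  qed
  have "\<bar>?a - ?b\<bar> \<le> 0"
  proof (rule field_le_epsilon)
    fix e :: real assume "0 < e"
    have "\<bar>?a - ?b\<bar> \<le> e / (K + 1) * K" using bound[of "e / (K + 1)"] \<open>0 < e\<close> K by simp
    also have "\<dots> \<le> e" using \<open>0 < e\<close> K by (simp add: field_simps)
    finally show "\<bar>?a - ?b\<bar> \<le> 0 + e" by simp
  qed
  then show ?thesis by simp
qed

section \<open>Derivatives of forms\<close>

text \<open>Differentiation at fixed arguments. The direction \<open>k\<close> remains a parameter,
  so \<open>\<omega>' k\<close> is again a form and algebraic operations on forms satisfy product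
  rules.\<close>

definition form_has_derivative ::
  "('e::real_normed_vector \<Rightarrow> ('a, 'k::real_normed_vector) form) \<Rightarrow> ('e \<Rightarrow> ('a, 'k) form) \<Rightarrow> 'e \<Rightarrow> bool" where
  "form_has_derivative \<omega> \<omega>' x \<longleftrightarrow> (\<forall>vs. ((\<lambda>y. \<omega> y vs) has_derivative (\<lambda>k. \<omega>' k vs)) (at x))"

lemma form_has_derivativeD:
  "form_has_derivative \<omega> \<omega>' x \<Longrightarrow> ((\<lambda>y. \<omega> y vs) has_derivative (\<lambda>k. \<omega>' k vs)) (at x)"
  by (simp add: form_has_derivative_def)

lemma form_has_derivative_linear: "form_has_derivative \<omega> \<omega>' x \<Longrightarrow> linear (\<lambda>k. \<omega>' k vs)"
  by (rule has_derivative_linear[OF form_has_derivativeD])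

lemma form_has_derivative_unique:
  assumes "form_has_derivative \<omega> \<omega>' x" "form_has_derivative \<eta> \<eta>' x"
    and "open S" "x \<in> S" "\<And>y vs. y \<in> S \<Longrightarrow> \<omega> y vs = \<eta> y vs"
  shows "\<omega>' k vs = \<eta>' k vs"
proof -
  have "((\<lambda>y. \<eta> y vs) has_derivative (\<lambda>k. \<omega>' k vs)) (at x)"
    by (rule has_derivative_transform_within_open[OF form_has_derivativeD[OF assms(1)] assms(3-5)])
  from has_derivative_unique[OF this form_has_derivativeD[OF assms(2)]] show ?thesis
    by (rule fun_cong)
qed

lemma form_has_derivative_contract:
  "form_has_derivative \<omega> \<omega>' x \<Longrightarrow> form_has_derivative (\<lambda>y. contract u (\<omega> y)) (\<lambda>k. contract u (\<omega>' k)) x"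
  by (simp add: form_has_derivative_def contract_def)

lemma form_has_derivative_add:
  "form_has_derivative \<omega> \<omega>' x \<Longrightarrow> form_has_derivative \<eta> \<eta>' x \<Longrightarrow>
    form_has_derivative (\<lambda>y vs. \<omega> y vs + \<eta> y vs) (\<lambda>k vs. \<omega>' k vs + \<eta>' k vs) x"
  by (simp add: form_has_derivative_def has_derivative_add)

lemma form_has_derivative_mult:
  fixes c :: "'k::real_normed_field"
  shows "form_has_derivative \<omega> \<omega>' x \<Longrightarrow> form_has_derivative (\<lambda>y vs. c * \<omega> y vs) (\<lambda>k vs. c * \<omega>' k vs) x"
  by (simp add: form_has_derivative_def has_derivative_mult_right)

lemma form_has_derivative_wedge:
  fixes \<alpha> \<beta> :: "'e::real_normed_vector \<Rightarrow> ('a, 'k::real_normed_field) form"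
  assumes "form_has_derivative \<alpha> \<alpha>' x" "form_has_derivative \<beta> \<beta>' x"
  shows "form_has_derivative (\<lambda>y. wedge (\<alpha> y) (\<beta> y))
    (\<lambda>k vs. wedge (\<alpha>' k) (\<beta> x) vs + wedge (\<alpha> x) (\<beta>' k) vs) x"
  unfolding form_has_derivative_def
proof
  fix vs
  show "((\<lambda>y. wedge (\<alpha> y) (\<beta> y) vs) has_derivative
      (\<lambda>k. wedge (\<alpha>' k) (\<beta> x) vs + wedge (\<alpha> x) (\<beta>' k) vs)) (at x)"
    unfolding wedge_def sum.distrib[symmetric]
    by (rule has_derivative_sum)
       (auto intro!: derivative_eq_intros form_has_derivativeD[OF assms(1)] form_has_derivativeD[OF assms(2)]
         simp: algebra_simps)
qed

lemma form_has_derivative_one_form: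
  assumes "(\<theta> has_derivative \<theta>') (at x)"
  shows "form_has_derivative (\<lambda>y. one_form (\<theta> y) :: ('e::real_normed_vector, 'k::real_normed_field) form)
    (\<lambda>k. one_form (\<theta>' k)) x"
proof -
  have "((\<lambda>y. of_real (blinfun_apply (\<theta> y) z) :: 'k) has_derivative (\<lambda>k. of_real (blinfun_apply (\<theta>' k) z))) (at x)" for z
    by (rule bounded_linear.has_derivative[OF bounded_linear_of_real])
       (rule bounded_linear.has_derivative[OF bounded_bilinear.bounded_linear_left[OF bounded_bilinear_blinfun_apply] assms])
  then have "((\<lambda>y. one_form (\<theta> y) vs :: 'k) has_derivative (\<lambda>k. one_form (\<theta>' k) vs)) (at x)" for vs
    by (cases "length vs = 1") (simp_all add: one_form_def)
  then show ?thesis by (simp add: form_has_derivative_def)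
qed

lemma form_has_derivative_reversal:
  fixes \<omega> :: "'e::real_normed_vector \<Rightarrow> ('a, 'k::real_normed_field) form"
  shows "form_has_derivative \<omega> \<omega>' x \<Longrightarrow> form_has_derivative (\<lambda>y. reversal (\<omega> y)) (\<lambda>k. reversal (\<omega>' k)) x"
  by (simp add: form_has_derivative_def reversal_def has_derivative_mult_right)

lemma form_has_derivative_mukai:
  fixes s t :: "'e::euclidean_space \<Rightarrow> ('e, 'k::real_normed_field) form"
  assumes "form_has_derivative s s' x" "form_has_derivative t t' x"
  shows "form_has_derivative (\<lambda>y. mukai (s y) (t y)) (\<lambda>k vs. mukai (s' k) (t x) vs + mukai (s x) (t' k) vs) x"
  unfolding form_has_derivative_def
proof
  fix vs :: "'e list"
  show "((\<lambda>y. mukai (s y) (t y) vs) has_derivative (\<lambda>k. mukai (s' k) (t x) vs + mukai (s x) (t' k) vs)) (at x)"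
    using form_has_derivativeD[OF form_has_derivative_wedge[OF form_has_derivative_reversal[OF assms(1)] assms(2)]]
    by (cases "length vs = DIM('e)") (simp_all add: mukai_def)
qed

lemma form_has_derivative_cnj:
  "form_has_derivative \<omega> \<omega>' x \<Longrightarrow> form_has_derivative (\<lambda>y. cnj_form (\<omega> y)) (\<lambda>k. cnj_form (\<omega>' k)) x"
  by (simp add: form_has_derivative_def cnj_form_def bounded_linear.has_derivative[OF bounded_linear_cnj])

text \<open>A varying vector enters through an argument slot, where the derivative at fixed
  arguments says nothing. Expansion in the basis, legitimate since the forms are linear in that slot
  near \<open>x\<close>, turns the contraction into a sum of products.\<close>

lemma form_has_derivative_contract_field:
  fixes \<omega> :: "'e::euclidean_space \<Rightarrow> ('e, 'k::real_normed_vector) form"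
  assumes Y: "(Y has_derivative Y') (at x)" and \<omega>: "form_has_derivative \<omega> \<omega>' x"
    and S: "open S" "x \<in> S" "\<And>y. y \<in> S \<Longrightarrow> alternating_form (\<omega> y)"
    and alt': "\<And>k. alternating_form (\<omega>' k)"
  shows "form_has_derivative (\<lambda>y. contract (Y y) (\<omega> y))
    (\<lambda>k vs. contract (Y' k) (\<omega> x) vs + contract (Y x) (\<omega>' k) vs) x"
  unfolding form_has_derivative_def
proof
  fix vs
  have exp: "contract z \<phi> vs = (\<Sum>b\<in>Basis. (z \<bullet> b) *\<^sub>R \<phi> (b # vs))"
    if "alternating_form \<phi>" for z :: 'e and \<phi> :: "('e, 'k) form"
    unfolding contract_def by (rule linear_basis_sum[OF alternating_linear_hd[OF that]])
  have "((\<lambda>y. \<Sum>b\<in>Basis. (Y y \<bullet> b) *\<^sub>R \<omega> y (b # vs)) has_derivative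
      (\<lambda>k. \<Sum>b\<in>Basis. (Y x \<bullet> b) *\<^sub>R \<omega>' k (b # vs) + (Y' k \<bullet> b) *\<^sub>R \<omega> x (b # vs))) (at x)"
    by (intro has_derivative_sum has_derivative_scaleR has_derivative_inner_left Y form_has_derivativeD[OF \<omega>])
  moreover have "(\<Sum>b\<in>Basis. (Y x \<bullet> b) *\<^sub>R \<omega>' k (b # vs) + (Y' k \<bullet> b) *\<^sub>R \<omega> x (b # vs)) =
      contract (Y' k) (\<omega> x) vs + contract (Y x) (\<omega>' k) vs" for k
    unfolding exp[OF alt'] exp[OF S(3)[OF S(2)]] sum.distrib by (rule add.commute)
  ultimately have "((\<lambda>y. \<Sum>b\<in>Basis. (Y y \<bullet> b) *\<^sub>R \<omega> y (b # vs)) has_derivative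
      (\<lambda>k. contract (Y' k) (\<omega> x) vs + contract (Y x) (\<omega>' k) vs)) (at x)"
    by (simp only:)
  then show "((\<lambda>y. contract (Y y) (\<omega> y) vs) has_derivative
      (\<lambda>k. contract (Y' k) (\<omega> x) vs + contract (Y x) (\<omega>' k) vs)) (at x)"
    by (rule has_derivative_transform_within_open[OF _ S(1,2)]) (simp only: exp[OF S(3)])
qed

lemma form_has_derivative_clifford:
  fixes \<omega> :: "'e::euclidean_space \<Rightarrow> ('e, complex) form"
  assumes w: "(w has_derivative w') (at x)" and \<omega>: "form_has_derivative \<omega> \<omega>' x"
    and S: "open S" "x \<in> S" "\<And>y. y \<in> S \<Longrightarrow> alternating_form (\<omega> y)"
    and alt': "\<And>k. alternating_form (\<omega>' k)"
  shows "form_has_derivative (\<lambda>y. clifford (w y) (\<omega> y))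
    (\<lambda>k vs. clifford (w' k) (\<omega> x) vs + clifford (w x) (\<omega>' k) vs) x"
  using form_has_derivative_add[OF
      form_has_derivative_contract_field[OF has_derivative_fst[OF w] \<omega> S alt']
      form_has_derivative_wedge[OF form_has_derivative_one_form[OF has_derivative_snd[OF w]] \<omega>]]
  unfolding clifford_def by (simp add: algebra_simps)

lemma form_has_derivative_contract_bivector:
  assumes b: "\<And>\<xi>. ((\<lambda>y. b y \<xi>) has_derivative (\<lambda>k. b' k \<xi>)) (at x)" and \<omega>: "form_has_derivative \<omega> \<omega>' x"
  shows "form_has_derivative (\<lambda>y. contract_bivector (b y) (\<omega> y))
    (\<lambda>k vs. contract_bivector (b' k) (\<omega> x) vs + contract_bivector (b x) (\<omega>' k) vs) x"
  unfolding form_has_derivative_def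
proof
  fix vs
  have "((\<lambda>y. (1 / 2) * (\<Sum>i\<in>Basis. \<Sum>j\<in>Basis. of_real (bcoeff (b y) i j) * \<omega> y (i # j # vs))) has_derivative
      (\<lambda>k. (1 / 2) * (\<Sum>i\<in>Basis. \<Sum>j\<in>Basis. of_real (bcoeff (b x) i j) * \<omega>' k (i # j # vs) +
        of_real (bcoeff (b' k) i j) * \<omega> x (i # j # vs)))) (at x)"
    by (intro has_derivative_mult_right has_derivative_sum has_derivative_mult has_derivative_of_real
        has_derivative_inner_left b form_has_derivativeD[OF \<omega>])
  then show "((\<lambda>y. contract_bivector (b y) (\<omega> y) vs) has_derivative
      (\<lambda>k. contract_bivector (b' k) (\<omega> x) vs + contract_bivector (b x) (\<omega>' k) vs)) (at x)"
    unfolding contract_bivector_eq by (simp add: sum.distrib algebra_simps)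
qed

text \<open>Slot linearity and the swap rule are linear identities in the form that hold near
  \<open>x\<close>, so uniqueness of derivatives passes them on.\<close>

lemma alternating_derivative:
  fixes \<omega> :: "'e::real_normed_vector \<Rightarrow> ('a::real_vector, 'k::real_normed_vector) form"
  assumes \<omega>: "form_has_derivative \<omega> \<omega>' x"
    and S: "open S" "x \<in> S" "\<And>y. y \<in> S \<Longrightarrow> alternating_form (\<omega> y)"
  shows "alternating_form (\<omega>' k)"
proof (rule alternatingI)
  note d = form_has_derivativeD[OF \<omega>]
  have eq: "f' k = g' k"
    if "(f has_derivative f') (at x)" "(g has_derivative g') (at x)" "\<And>y. y \<in> S \<Longrightarrow> f y = g y"
    for f g :: "'e \<Rightarrow> 'k" and f' g'
    using has_derivative_unique[OF has_derivative_transform_within_open[OF that(1) S(1,2) that(3)] that(2)] by simp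
  show "linear (\<lambda>z. \<omega>' k (ws @ z # vs))" for ws vs
  proof (rule linearI)
    show "\<omega>' k (ws @ (y + z) # vs) = \<omega>' k (ws @ y # vs) + \<omega>' k (ws @ z # vs)" for y z
      by (rule eq[OF d has_derivative_add[OF d d]]) (simp add: linear_add[OF alternating_linear[OF S(3)]])
    show "\<omega>' k (ws @ (r *\<^sub>R z) # vs) = r *\<^sub>R \<omega>' k (ws @ z # vs)" for r z
      by (rule eq[OF d has_derivative_scaleR_right[OF d]]) (simp add: linear_scale[OF alternating_linear[OF S(3)]])
  qed
  show "\<omega>' k (ws @ y # z # vs) = - \<omega>' k (ws @ z # y # vs)" for ws y z vs
    by (rule eq[OF d has_derivative_minus[OF d]]) (rule alternating_swap[OF S(3)])
qed

section \<open>The exterior derivative in coordinates\<close>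

lemma ext_d_Nil: "ext_d \<omega> x [] = 0"
  by (simp add: ext_d_def)

text \<open>Cartan's formula for a constant vector field \<open>u\<close>.\<close>

lemma ext_d_Cons:
  "ext_d \<omega> x (u # vs) = frechet_derivative (\<lambda>y. \<omega> y vs) (at x) u - ext_d (\<lambda>y. contract u (\<omega> y)) x vs"
proof -
  have "ext_d \<omega> x (u # vs) = frechet_derivative (\<lambda>y. \<omega> y vs) (at x) u +
      (\<Sum>i<length vs. (-1) ^ Suc i *\<^sub>R frechet_derivative (\<lambda>y. \<omega> y (u # take i vs @ drop (Suc i) vs)) (at x) (vs ! i))"
    unfolding ext_d_def length_Cons sum.lessThan_Suc_shift by simp
  then show ?thesis by (simp add: ext_d_def contract_def sum_negf)
qed

text \<open>Both sides satisfy Cartan's formula for a constant vector. In this form the exterior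
  derivative becomes a sum of Clifford actions of basis covectors, accessible to the Clifford
  relations.\<close>

lemma ext_d_eq:
  fixes \<omega> :: "'e::euclidean_space \<Rightarrow> ('e, 'k::real_normed_field) form"
  assumes "form_has_derivative \<omega> \<omega>' x"
  shows "ext_d \<omega> x vs = (\<Sum>b\<in>Basis. wedge (one_form (blinfun_inner_right b)) (\<omega>' b) vs)"
  using assms
proof (induction vs arbitrary: \<omega> \<omega>')
  case Nil
  show ?case by (simp add: ext_d_Nil one_form_def)
next
  case (Cons u vs)
  have "frechet_derivative (\<lambda>y. \<omega> y vs) (at x) u = \<omega>' u vs"
    using frechet_derivative_at[OF form_has_derivativeD[OF Cons.prems]] by metis
  also have "\<dots> = (\<Sum>b\<in>Basis. of_real (b \<bullet> u) * \<omega>' b vs)"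
    using linear_basis_sum[OF form_has_derivative_linear[OF Cons.prems, of vs], of u]
    by (simp add: scaleR_conv_of_real inner_commute[of u])
  finally show ?case
    using Cons.IH[OF form_has_derivative_contract[OF Cons.prems, of u]]
    by (simp add: ext_d_Cons wedge_one_form_Cons sum_subtractf)
qed

lemma has_degree_wedge_one_form:
  fixes \<beta> :: "('e::real_normed_vector, 'k::real_normed_field) form"
  assumes "has_degree n \<beta>"
  shows "has_degree (Suc n) (wedge (one_form \<xi>) \<beta>)"
proof -
  have "wedge (one_form \<xi>) \<beta> vs = 0" if "length vs \<noteq> Suc n" for vs
    using that assms
  proof (induction vs arbitrary: \<beta> n)
    case (Cons x vs)
    have "wedge (one_form \<xi>) (contract x \<beta>) vs = 0"
    proof (cases n)
      case 0
      then have "contract x \<beta> = (\<lambda>vs. 0)" using Cons.prems(2) by (auto simp: contract_def has_degree_def)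
      then show ?thesis by simp
    next
      case (Suc m)
      then show ?thesis using Cons.prems by (intro Cons.IH[of m]) (auto simp: contract_def has_degree_def)
    qed
    then show ?case using Cons.prems by (simp add: wedge_one_form_Cons has_degree_def)
  qed (simp add: one_form_def)
  then show ?thesis by (simp add: has_degree_def)
qed

lemma wedge_one_form_top:
  fixes \<nu> :: "('e::euclidean_space, 'k::real_normed_field) form"
  assumes "alternating_form \<nu>" "has_degree DIM('e) \<nu>"
  shows "wedge (one_form \<xi>) \<nu> = (\<lambda>vs. 0)"
proof (rule ext)
  fix vs :: "'e list"
  show "wedge (one_form \<xi>) \<nu> vs = 0"
  proof (cases "length vs = Suc DIM('e)")
    case True
    then show ?thesis
      by (intro alternating_vanishes alternating_wedge alternating_one_form assms(1)) simp
  next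
    case False
    then show ?thesis using has_degree_wedge_one_form[OF assms(2), of \<xi>] by (simp add: has_degree_def)
  qed
qed

section \<open>The modular equation in one chart\<close>

text \<open>\<open>b' k\<close> and \<open>\<nu>' k\<close> are the derivatives at \<open>x\<close> in direction \<open>k\<close>; the assumption
  \<open>top_divergence\<close> says that \<open>X\<close> is the divergence of the bivector with respect to \<open>\<nu>\<close>.\<close>

locale poisson_at =
  fixes b :: "'e::euclidean_space \<Rightarrow> ('e \<Rightarrow>\<^sub>L real) \<Rightarrow> 'e" and b' :: "'e \<Rightarrow> ('e \<Rightarrow>\<^sub>L real) \<Rightarrow> 'e"
    and \<nu> :: "'e \<Rightarrow> ('e, complex) form" and \<nu>' :: "'e \<Rightarrow> ('e, complex) form" and x X :: 'e
  assumes b_derivative: "\<And>\<xi>. ((\<lambda>y. b y \<xi>) has_derivative (\<lambda>k. b' k \<xi>)) (at x)"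
    and skew: "skew_map (b x)" and skew': "\<And>k. skew_map (b' k)"
    and jacobi: "\<And>i j l. i \<in> Basis \<Longrightarrow> j \<in> Basis \<Longrightarrow> l \<in> Basis \<Longrightarrow>
      bcoeff (b' (b x (blinfun_inner_right l))) i j + bcoeff (b' (b x (blinfun_inner_right i))) j l +
      bcoeff (b' (b x (blinfun_inner_right j))) l i = 0"
    and \<nu>_derivative: "form_has_derivative \<nu> \<nu>' x"
    and \<nu>_alt: "alternating_form (\<nu> x)" and \<nu>'_alt: "\<And>k. alternating_form (\<nu>' k)"
    and \<nu>_top: "has_degree DIM('e) (\<nu> x)" and \<nu>'_top: "\<And>k. has_degree DIM('e) (\<nu>' k)"
    and top_divergence: "\<And>i vs. i \<in> Basis \<Longrightarrow> \<nu>' (b x (blinfun_inner_right i)) vs +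
      (\<Sum>k\<in>Basis. of_real (bcoeff (b' k) i k) * \<nu> x vs) = of_real (X \<bullet> i) * \<nu> x vs"
begin

text \<open>The exterior derivative at \<open>x\<close> as a function of first-order data alone,
  which allows an induction over forms known only through their value and derivative at
  \<open>x\<close>.\<close>

definition "dform \<psi>' = (\<lambda>vs. \<Sum>k\<in>Basis. wedge (one_form (blinfun_inner_right k)) (\<psi>' k) vs)"
  for \<psi>' :: "'e \<Rightarrow> ('e, complex) form"

text \<open>The commutator of the contraction with \<open>b\<close> and the exterior derivative, on a form with
  value \<open>\<psi>\<close> and derivative \<open>\<psi>'\<close> at \<open>x\<close>.\<close>

definition "koszul \<psi> \<psi>' = (\<lambda>vs. \<Sum>k\<in>Basis. contract (b x (blinfun_inner_right k)) (\<psi>' k) vs -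
    wedge (one_form (blinfun_inner_right k)) (contract_bivector (b' k) \<psi>) vs)"
  for \<psi> :: "('e, complex) form" and \<psi>' :: "'e \<Rightarrow> ('e, complex) form"

abbreviation cb where "cb \<equiv> contract_bivector (b x)"

text \<open>The product rule for the derivative at \<open>x\<close> of the contraction of a form
  with the varying bivector \<open>b\<close>.\<close>

abbreviation cb' where "cb' \<psi> \<psi>' \<equiv> (\<lambda>k vs. contract_bivector (b' k) \<psi> vs + cb (\<psi>' k) vs)"

lemma dform_contract_bivector:
  assumes "\<And>k. alternating_form (\<psi>' k)"
  shows "dform (cb' \<psi> \<psi>') vs = cb (dform \<psi>') vs - koszul \<psi> \<psi>' vs"
proof -
  have "cb (dform \<psi>') vs = (\<Sum>k\<in>Basis. wedge (one_form (blinfun_inner_right k)) (cb (\<psi>' k)) vs +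
      contract (b x (blinfun_inner_right k)) (\<psi>' k) vs)"
    unfolding dform_def contract_bivector_sum by (simp only: contract_bivector_wedge[OF skew assms])
  then show ?thesis
    by (simp add: dform_def koszul_def wedge_linear sum.distrib sum_subtractf)
qed

lemma contract_bivector_commute:
  assumes "alternating_form \<psi>"
  shows "contract_bivector c (contract_bivector d \<psi>) vs = contract_bivector d (contract_bivector c \<psi>) vs"
proof -
  have "contract_bivector d \<psi> (i # j # vs) = contract_bivector d (\<lambda>vs. \<psi> (i # j # vs)) vs" for i j vs
  proof -
    have "contract_bivector d (contract j (contract i \<psi>)) = contract j (contract i (contract_bivector d \<psi>))"
      by (simp only: contract_bivector_contract assms alternating_contract)
    then show ?thesis by (simp add: contract_def fun_eq_iff)
  qed
  then have "contract_bivector c (contract_bivector d \<psi>) vs =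
      contract_bivector d (\<lambda>vs. (1 / 2) * (\<Sum>i\<in>Basis. \<Sum>j\<in>Basis. of_real (bcoeff c i j) * \<psi> (i # j # vs))) vs"
    unfolding contract_bivector_mult contract_bivector_sum
    by (simp add: contract_bivector_eq[of c])
  then show ?thesis unfolding contract_bivector_eq[of c, symmetric] .
qed

text \<open>The sum is contraction with a trivector proportional to the Schouten square of the
  bivector. An alternating form is invariant under rotating its first three arguments, so only the
  cyclic sum of the coefficients matters, and that is the Jacobi expression.\<close>

lemma jacobi_contract:
  assumes alt: "alternating_form \<psi>"
  shows "(\<Sum>k\<in>Basis. contract (b x (blinfun_inner_right k)) (contract_bivector (b' k) \<psi>) vs) = 0"
proof -
  define T where "T i j l = bcoeff (b' (b x (blinfun_inner_right l))) i j" for i j l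
  let ?S = "\<lambda>f. \<Sum>i\<in>Basis. \<Sum>j\<in>Basis. \<Sum>l\<in>Basis. complex_of_real (f i j l) * \<psi> (i # j # l # vs)"
  have T: "T i j l = (\<Sum>k\<in>Basis. - bcoeff (b x) k l * bcoeff (b' k) i j)" for i j l
  proof -
    have "linear (\<lambda>k. bcoeff (b' k) i j)"
      by (rule has_derivative_linear[OF has_derivative_inner_left[OF b_derivative]])
    from linear_basis_sum[OF this, of "b x (blinfun_inner_right l)"]
    show ?thesis unfolding T_def by (simp add: bcoeff_skew[OF skew, of l])
  qed
  have exp: "contract (b x (blinfun_inner_right k)) (contract_bivector (b' k) \<psi>) vs =
      (\<Sum>l\<in>Basis. of_real (bcoeff (b x) k l) * contract_bivector (b' k) \<psi> (l # vs))" for k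
    using linear_basis_sum[OF alternating_linear_hd[OF alternating_contract_bivector[OF alt, of "b' k"], of vs],
        of "b x (blinfun_inner_right k)"]
    by (simp add: contract_def scaleR_conv_of_real)
  have "(\<Sum>k\<in>Basis. contract (b x (blinfun_inner_right k)) (contract_bivector (b' k) \<psi>) vs) =
      (\<Sum>k\<in>Basis. \<Sum>l\<in>Basis. \<Sum>i\<in>Basis. \<Sum>j\<in>Basis.
        (1 / 2) * of_real (bcoeff (b x) k l * bcoeff (b' k) i j) * \<psi> (i # j # l # vs))"
    unfolding exp contract_bivector_eq by (simp add: sum_distrib_left mult_ac)
  also have "\<dots> = (\<Sum>i\<in>Basis. \<Sum>j\<in>Basis. \<Sum>l\<in>Basis. \<Sum>k\<in>Basis.
        (1 / 2) * of_real (bcoeff (b x) k l * bcoeff (b' k) i j) * \<psi> (i # j # l # vs))"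
    (is "?l = ?r")
  proof -
    let ?g = "\<lambda>i j l k. (1 / 2) * of_real (bcoeff (b x) k l * bcoeff (b' k) i j) * \<psi> (i # j # l # vs)"
    have "?l = (\<Sum>l\<in>Basis. \<Sum>k\<in>Basis. \<Sum>i\<in>Basis. \<Sum>j\<in>Basis. ?g i j l k)" by (rule sum.swap)
    also have "\<dots> = (\<Sum>l\<in>Basis. \<Sum>i\<in>Basis. \<Sum>k\<in>Basis. \<Sum>j\<in>Basis. ?g i j l k)"
      by (rule sum.cong[OF refl], rule sum.swap)
    also have "\<dots> = (\<Sum>i\<in>Basis. \<Sum>l\<in>Basis. \<Sum>k\<in>Basis. \<Sum>j\<in>Basis. ?g i j l k)" by (rule sum.swap)
    also have "\<dots> = (\<Sum>i\<in>Basis. \<Sum>l\<in>Basis. \<Sum>j\<in>Basis. \<Sum>k\<in>Basis. ?g i j l k)"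
      by (rule sum.cong[OF refl], rule sum.cong[OF refl], rule sum.swap)
    also have "\<dots> = ?r" by (rule sum.cong[OF refl], rule sum.swap)
    finally show ?thesis .
  qed
  also have "\<dots> = - (1 / 2) * ?S T"
    unfolding T by (simp add: sum_distrib_left sum_distrib_right sum_negf mult_ac)
  also have "?S T = 0"
  proof -
    have s1: "\<psi> (i # j # l # vs) = \<psi> (j # l # i # vs)" for i j l
      using alternating_swap_hd[OF alt, of i j "l # vs"] alternating_swap[OF alt, of "[j]" i l vs] by simp
    \<comment> \<open>Renaming the summation indices compensates the rotation of the arguments;
      averaging over the three rotations produces the cyclic sum.\<close>
    have rot: "?S f = ?S (\<lambda>i j l. f l i j)" for f :: "'e \<Rightarrow> 'e \<Rightarrow> 'e \<Rightarrow> real"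
    proof -
      have "?S f = (\<Sum>i\<in>Basis. \<Sum>j\<in>Basis. \<Sum>l\<in>Basis. complex_of_real (f i j l) * \<psi> (j # l # i # vs))"
        by (intro sum.cong refl arg_cong2[where f = times] s1)
      also have "\<dots> = (\<Sum>j\<in>Basis. \<Sum>i\<in>Basis. \<Sum>l\<in>Basis. complex_of_real (f i j l) * \<psi> (j # l # i # vs))"
        by (rule sum.swap)
      also have "\<dots> = (\<Sum>j\<in>Basis. \<Sum>l\<in>Basis. \<Sum>i\<in>Basis. complex_of_real (f i j l) * \<psi> (j # l # i # vs))"
        by (rule sum.cong[OF refl], rule sum.swap)
      finally show ?thesis .
    qed
    have "3 * ?S T = ?S T + ?S (\<lambda>i j l. T l i j) + ?S (\<lambda>i j l. T j l i)"
      using rot[of T] rot[of "\<lambda>i j l. T l i j"] by simp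
    also have "\<dots> = ?S (\<lambda>i j l. T i j l + T j l i + T l i j)"
      by (simp add: sum.distrib[symmetric] algebra_simps)
    also have "\<dots> = 0"
      by (intro sum.neutral ballI) (simp add: T_def jacobi)
    finally show ?thesis by simp
  qed
  finally show ?thesis by simp
qed

text \<open>The two orders of composition differ by contractions with \<open>b\<close> and its
  derivative. One arises from commuting \<open>cb\<close> past the covectors, the other from
  differentiating the bivector inside \<open>cb'\<close>, and each vanishes by
  \<open>jacobi_contract\<close>.\<close>

lemma koszul_contract_bivector:
  assumes alt: "alternating_form \<psi>" and alt': "\<And>k. alternating_form (\<psi>' k)"
  shows "koszul (cb \<psi>) (cb' \<psi> \<psi>') vs = cb (koszul \<psi> \<psi>') vs"
proof -
  let ?e = "\<lambda>k. one_form (blinfun_inner_right k) :: ('e, complex) form"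
  let ?u = "\<lambda>k. b x (blinfun_inner_right k)"
  have "koszul \<psi> \<psi>' = (\<lambda>vs. \<Sum>k\<in>Basis. contract (?u k) (\<psi>' k) vs + (-1) * wedge (?e k) (contract_bivector (b' k) \<psi>) vs)"
    by (simp add: koszul_def)
  then have "cb (koszul \<psi> \<psi>') vs = (\<Sum>k\<in>Basis. cb (contract (?u k) (\<psi>' k)) vs -
      cb (wedge (?e k) (contract_bivector (b' k) \<psi>)) vs)"
    by (simp only: contract_bivector_sum contract_bivector_add contract_bivector_mult) simp
  also have "\<dots> = (\<Sum>k\<in>Basis. contract (?u k) (cb (\<psi>' k)) vs -
      (wedge (?e k) (cb (contract_bivector (b' k) \<psi>)) vs + contract (?u k) (contract_bivector (b' k) \<psi>) vs))"
    by (simp only: contract_bivector_contract[OF alt']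
        contract_bivector_wedge[OF skew alternating_contract_bivector[OF alt]])
  also have "\<dots> = (\<Sum>k\<in>Basis. contract (?u k) (cb (\<psi>' k)) vs - wedge (?e k) (cb (contract_bivector (b' k) \<psi>)) vs)"
    by (simp add: sum_subtractf sum.distrib jacobi_contract[OF alt])
  also have "\<dots> = (\<Sum>k\<in>Basis. contract (?u k) (cb' \<psi> \<psi>' k) vs -
      wedge (?e k) (contract_bivector (b' k) (cb \<psi>)) vs)"
  proof -
    have "contract_bivector (b' k) (cb \<psi>) = cb (contract_bivector (b' k) \<psi>)" for k
      by (rule ext) (rule contract_bivector_commute[OF alt])
    then show ?thesis
      by (simp add: contract_add sum.distrib sum_subtractf jacobi_contract[OF alt])
  qed
  finally show ?thesis by (simp add: koszul_def)
qed

text \<open>Covectors annihilate a top form, so the commutator rule turns the wedge terms into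
  contractions with the divergence of the bivector. Collected by components, the two sums are minus
  the left side of \<open>top_divergence\<close>.\<close>

lemma koszul_top: "koszul (\<nu> x) \<nu>' vs = - contract X (\<nu> x) vs"
proof -
  let ?e = "blinfun_inner_right :: 'e \<Rightarrow> 'e \<Rightarrow>\<^sub>L real"
  have "wedge (one_form (?e k)) (contract_bivector (b' k) (\<nu> x)) vs = - contract (b' k (?e k)) (\<nu> x) vs" for k
    using contract_bivector_wedge[OF skew' \<nu>_alt, of k "?e k" vs] wedge_one_form_top[OF \<nu>_alt \<nu>_top, of "?e k"]
    by (simp add: eq_neg_iff_add_eq_0)
  then have "koszul (\<nu> x) \<nu>' vs = (\<Sum>k\<in>Basis. contract (b x (?e k)) (\<nu>' k) vs + contract (b' k (?e k)) (\<nu> x) vs)"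
    by (simp add: koszul_def)
  also have "\<dots> = (\<Sum>k\<in>Basis. \<Sum>i\<in>Basis. - of_real (bcoeff (b x) i k) * \<nu>' k (i # vs) - of_real (bcoeff (b' k) i k) * \<nu> x (i # vs))"
  proof (rule sum.cong[OF refl])
    fix k :: 'e
    have "contract z \<phi> vs = (\<Sum>i\<in>Basis. of_real (z \<bullet> i) * \<phi> (i # vs))"
      if "alternating_form \<phi>" for z and \<phi> :: "('e, complex) form"
      unfolding contract_def using linear_basis_sum[OF alternating_linear_hd[OF that], of z vs]
      by (simp add: scaleR_conv_of_real)
    from this[OF \<nu>'_alt] this[OF \<nu>_alt]
    show "contract (b x (?e k)) (\<nu>' k) vs + contract (b' k (?e k)) (\<nu> x) vs =
      (\<Sum>i\<in>Basis. - of_real (bcoeff (b x) i k) * \<nu>' k (i # vs) - of_real (bcoeff (b' k) i k) * \<nu> x (i # vs))"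
      by (simp add: bcoeff_skew[OF skew, of k] bcoeff_skew[OF skew', of k k] sum_negf sum_subtractf)
  qed
  also have "\<dots> = (\<Sum>i\<in>Basis. \<Sum>k\<in>Basis. - of_real (bcoeff (b x) i k) * \<nu>' k (i # vs) - of_real (bcoeff (b' k) i k) * \<nu> x (i # vs))"
    by (rule sum.swap)
  also have "\<dots> = (\<Sum>i\<in>Basis. - (of_real (X \<bullet> i) * \<nu> x (i # vs)))"
  proof (rule sum.cong[OF refl])
    fix i :: 'e assume "i \<in> Basis"
    have eq: "\<nu>' (b x (?e i)) (i # vs) = (\<Sum>k\<in>Basis. of_real (bcoeff (b x) i k) * \<nu>' k (i # vs))"
      using linear_basis_sum[OF form_has_derivative_linear[OF \<nu>_derivative, of "i # vs"], of "b x (?e i)"]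
      by (simp add: scaleR_conv_of_real)
    show "(\<Sum>k\<in>Basis. - of_real (bcoeff (b x) i k) * \<nu>' k (i # vs) - of_real (bcoeff (b' k) i k) * \<nu> x (i # vs)) =
        - (of_real (X \<bullet> i) * \<nu> x (i # vs))"
      unfolding top_divergence[OF \<open>i \<in> Basis\<close>, of "i # vs", symmetric] eq
      by (simp add: sum_subtractf sum_negf)
  qed
  also have "\<dots> = - contract X (\<nu> x) vs"
    unfolding contract_def using linear_basis_sum[OF alternating_linear_hd[OF \<nu>_alt], of X vs]
    by (simp add: scaleR_conv_of_real sum_negf)
  finally show ?thesis .
qed

text \<open>The induction carries the action of \<open>koszul\<close> along with the exterior
  derivative: on every power it equals minus contraction with \<open>X\<close>, because it commutes
  with \<open>cb\<close>. Moving \<open>d\<close> past one more \<open>cb\<close> therefore adds one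
  more copy of the same contraction.\<close>

lemma ext_d_power:
  "ext_d (\<lambda>y. (contract_bivector (b y) ^^ m) (\<nu> y)) x vs = of_nat m * contract X ((cb ^^ (m - 1)) (\<nu> x)) vs"
  "form_has_derivative (\<lambda>y. (contract_bivector (b y) ^^ m) (\<nu> y)) 
    (\<lambda>k vs. frechet_derivative (\<lambda>y. (contract_bivector (b y) ^^ m) (\<nu> y) vs) (at x) k) x"
proof -
  have alt: "alternating_form ((cb ^^ m) (\<nu> x))" for m
    by (induction m) (simp_all add: \<nu>_alt alternating_contract_bivector)
  have "\<exists>\<psi>'. form_has_derivative (\<lambda>y. (contract_bivector (b y) ^^ m) (\<nu> y)) \<psi>' x \<and>
      (\<forall>k. alternating_form (\<psi>' k)) \<and>
      (\<forall>vs. koszul ((cb ^^ m) (\<nu> x)) \<psi>' vs = - contract X ((cb ^^ m) (\<nu> x)) vs) \<and>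
      (\<forall>vs. dform \<psi>' vs = of_nat m * contract X ((cb ^^ (m - 1)) (\<nu> x)) vs)"
  proof (induction m)
    case 0
    have "dform \<nu>' vs = 0" for vs
      by (simp add: dform_def wedge_one_form_top[OF \<nu>'_alt \<nu>'_top])
    then show ?case
      by (intro exI[of _ \<nu>']) (simp add: \<nu>_derivative \<nu>'_alt koszul_top)
  next
    case (Suc m)
    let ?\<psi> = "(cb ^^ m) (\<nu> x)"
    obtain \<psi>' where d: "form_has_derivative (\<lambda>y. (contract_bivector (b y) ^^ m) (\<nu> y)) \<psi>' x"
      and alt': "\<And>k. alternating_form (\<psi>' k)"
      and kos: "\<And>vs. koszul ?\<psi> \<psi>' vs = - contract X ?\<psi> vs"
      and df: "\<And>vs. dform \<psi>' vs = of_nat m * contract X ((cb ^^ (m - 1)) (\<nu> x)) vs"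
      using Suc by blast
    have "form_has_derivative (\<lambda>y. (contract_bivector (b y) ^^ Suc m) (\<nu> y)) (cb' ?\<psi> \<psi>') x"
      using form_has_derivative_contract_bivector[OF b_derivative d] by simp
    moreover have "alternating_form (cb' ?\<psi> \<psi>' k)" for k
      by (intro alternating_add alternating_contract_bivector alt alt')
    moreover have "koszul ((cb ^^ Suc m) (\<nu> x)) (cb' ?\<psi> \<psi>') vs = - contract X ((cb ^^ Suc m) (\<nu> x)) vs" for vs
    proof -
      have "koszul ?\<psi> \<psi>' = (\<lambda>vs. (-1) * contract X ?\<psi> vs)" by (simp add: fun_eq_iff kos)
      then have "cb (koszul ?\<psi> \<psi>') vs = - contract X (cb ?\<psi>) vs"
        by (simp only: contract_bivector_mult contract_bivector_contract[OF alt]) simp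
      then show ?thesis using koszul_contract_bivector[of ?\<psi> \<psi>' vs, OF alt alt'] by simp
    qed
    moreover have "dform (cb' ?\<psi> \<psi>') vs = of_nat (Suc m) * contract X ((cb ^^ (Suc m - 1)) (\<nu> x)) vs" for vs
    proof -
      have "dform \<psi>' = (\<lambda>vs. of_nat m * contract X ((cb ^^ (m - 1)) (\<nu> x)) vs)" by (rule ext) (rule df)
      then have "cb (dform \<psi>') vs = of_nat m * contract X (cb ((cb ^^ (m - 1)) (\<nu> x))) vs"
        by (simp only: contract_bivector_mult contract_bivector_contract[OF alt])
      \<comment> \<open>For m = 0 the truncated \<open>m - 1\<close> gives the wrong power, but the
        factor \<open>of_nat m\<close> is zero.\<close>
      also have "\<dots> = of_nat m * contract X ?\<psi> vs" by (cases m) simp_all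
      finally show ?thesis
        using dform_contract_bivector[of \<psi>' ?\<psi> vs, OF alt'] kos[of vs] by (simp add: algebra_simps)
    qed
    ultimately show ?case by blast
  qed
  then obtain \<psi>' where d: "form_has_derivative (\<lambda>y. (contract_bivector (b y) ^^ m) (\<nu> y)) \<psi>' x"
    and df: "\<And>vs. dform \<psi>' vs = of_nat m * contract X ((cb ^^ (m - 1)) (\<nu> x)) vs"
    by blast
  show "ext_d (\<lambda>y. (contract_bivector (b y) ^^ m) (\<nu> y)) x vs = of_nat m * contract X ((cb ^^ (m - 1)) (\<nu> x)) vs"
    using ext_d_eq[OF d, of vs] df[of vs] by (simp add: dform_def)
  show "form_has_derivative (\<lambda>y. (contract_bivector (b y) ^^ m) (\<nu> y)) 
    (\<lambda>k vs. frechet_derivative (\<lambda>y. (contract_bivector (b y) ^^ m) (\<nu> y) vs) (at x) k) x"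
    unfolding form_has_derivative_def
    using form_has_derivativeD[OF d] frechet_derivative_works differentiable_def by blast
qed

text \<open>Differentiation shifts the exponential series by one, since m / m! is 1 / (m - 1)!. The
  shifted sum ends one term early.\<close>

lemma modular_equation_at:
  "ext_d (\<lambda>y. exp_bivector (b y) (\<nu> y)) x vs = contract X (exp_bivector (b x) (\<nu> x)) vs"
proof -
  let ?n = "DIM('e)"
  let ?f = "\<lambda>m. complex_of_real (1 / fact m)"
  let ?A = "\<lambda>m y. (contract_bivector (b y) ^^ m) (\<nu> y)"
  have "form_has_derivative (\<lambda>y. exp_bivector (b y) (\<nu> y))
      (\<lambda>k vs. \<Sum>m\<le>?n. (1 / fact m) *\<^sub>R frechet_derivative (\<lambda>y. ?A m y vs) (at x) k) x"
    unfolding form_has_derivative_def exp_bivector_def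
    by (intro allI has_derivative_sum has_derivative_scaleR_right form_has_derivativeD[OF ext_d_power(2)])
  from ext_d_eq[OF this]
  have "ext_d (\<lambda>y. exp_bivector (b y) (\<nu> y)) x vs = (\<Sum>c\<in>Basis. \<Sum>m\<le>?n. ?f m *
      wedge (one_form (blinfun_inner_right c)) (\<lambda>vs. frechet_derivative (\<lambda>y. ?A m y vs) (at x) c) vs)"
    by (simp only: scaleR_conv_of_real wedge_sum_right wedge_mult_right)
  also have "\<dots> = (\<Sum>m\<le>?n. ?f m * ext_d (\<lambda>y. ?A m y) x vs)"
    unfolding ext_d_eq[OF ext_d_power(2)] sum_distrib_left by (rule sum.swap)
  also have "\<dots> = (\<Sum>m\<le>?n. ?f m * (of_nat m * ?A (m - 1) x (X # vs)))"
    by (simp add: ext_d_power(1)) (simp add: contract_def)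
  also have "\<dots> = (\<Sum>m<?n. ?f m * ?A m x (X # vs))"
  proof -
    have "{..?n} = {..<Suc ?n}" by auto
    then have "(\<Sum>m\<le>?n. ?f m * (of_nat m * ?A (m - 1) x (X # vs))) =
        (\<Sum>m<?n. ?f (Suc m) * (of_nat (Suc m) * ?A m x (X # vs)))"
      by (simp only: sum.lessThan_Suc_shift of_nat_0 mult_zero_left mult_zero_right add_0 diff_Suc_1)
    also have "\<dots> = (\<Sum>m<?n. ?f m * ?A m x (X # vs))"
    proof (rule sum.cong[OF refl])
      fix m
      have "?f (Suc m) * of_nat (Suc m) = ?f m"
      proof -
        have "1 / fact (Suc m) * real (Suc m) = 1 / fact m"
          unfolding fact_Suc by (simp add: field_simps del: of_nat_Suc)
        then show ?thesis by (metis of_real_mult of_real_of_nat_eq)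
      qed
      then show "?f (Suc m) * (of_nat (Suc m) * ?A m x (X # vs)) = ?f m * ?A m x (X # vs)"
        by (simp only: mult.assoc[symmetric])
    qed
    finally show ?thesis .
  qed
  also have "\<dots> = (\<Sum>m\<le>?n. ?f m * ?A m x (X # vs))"
  proof -
    \<comment> \<open>The term lost at the cutoff is zero: \<open>DIM('e)\<close> double
      contractions and at least one argument exceed the degree of \<nu>.\<close>
    have "?A ?n x (X # vs) = 0" by (rule contract_bivector_power_degree[OF \<nu>_top]) simp
    moreover have "{..?n} = insert ?n {..<?n}" by auto
    ultimately show ?thesis by simp
  qed
  also have "\<dots> = contract X (exp_bivector (b x) (\<nu> x)) vs"
    by (simp add: contract_def exp_bivector_def scaleR_conv_of_real)
  finally show ?thesis .
qed

end

section \<open>The Poisson tensor and the spinor in one chart\<close>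

lemma pair_as_basis_sum:
  assumes "linear f"
  shows "f (u :: 'e::euclidean_space gtan) = (\<Sum>i\<in>Basis. (fst u \<bullet> i) *\<^sub>R f (i, 0)) +
    (\<Sum>i\<in>Basis. blinfun_apply (snd u) i *\<^sub>R f (0, blinfun_inner_right i))"
proof -
  have "linear (\<lambda>x. f (x, 0))" "linear (\<lambda>\<xi>. f (0, \<xi>))"
    using linear_add[OF assms] linear_scale[OF assms] by (auto intro!: linearI simp flip: add_Pair) 
      (metis add.right_neutral add_Pair scaleR_Pair scaleR_zero_right)+
  moreover have "f u = f (fst u, 0) + f (0, snd u)"
    using linear_add[OF assms, of "(fst u, 0)" "(0, snd u)"] by simp
  ultimately show ?thesis
    using linear_basis_sum[of "\<lambda>x. f (x, 0)" "fst u"] linear_covector_sum[of "\<lambda>\<xi>. f (0, \<xi>)" "snd u"] by simp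
qed

text \<open>Smoothness of \<open>J\<close> is given only on constant elements; expansion in the
  constant frame extends it to smooth sections.\<close>

lemma smooth_on_endomorphism:
  fixes J :: "'e::euclidean_space \<Rightarrow> 'e gtan \<Rightarrow> 'e gtan"
  assumes "open V" and lin: "\<And>x. x \<in> V \<Longrightarrow> linear (J x)" and J: "\<And>u. smooth_on V (\<lambda>x. J x u)"
    and u: "smooth_on V u"
  shows "smooth_on V (\<lambda>x. J x (u x))"
proof (rule smooth_on_cong[OF assms(1)])
  show "(\<Sum>i\<in>Basis. (fst (u x) \<bullet> i) *\<^sub>R J x (i, 0)) +
      (\<Sum>i\<in>Basis. blinfun_apply (snd (u x)) i *\<^sub>R J x (0, blinfun_inner_right i)) = J x (u x)" if "x \<in> V" for x
    using pair_as_basis_sum[OF lin[OF that]] by metis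
  have "smooth_on V (\<lambda>x. fst (u x) \<bullet> i)" for i
    by (rule smooth_on_bounded_linear[OF assms(1) bounded_linear_inner_left_comp[OF bounded_linear_fst] u])
  moreover have "smooth_on V (\<lambda>x. blinfun_apply (snd (u x)) i)" for i
    by (rule smooth_on_bounded_linear[OF assms(1) bounded_linear_compose[OF
          bounded_bilinear.bounded_linear_left[OF bounded_bilinear_blinfun_apply] bounded_linear_snd] u])
  ultimately show "smooth_on V (\<lambda>x. (\<Sum>i\<in>Basis. (fst (u x) \<bullet> i) *\<^sub>R J x (i, 0)) +
      (\<Sum>i\<in>Basis. blinfun_apply (snd (u x)) i *\<^sub>R J x (0, blinfun_inner_right i)))"
    by (intro smooth_on_add smooth_on_sum smooth_on_scaleR assms(1) J)
qed

section \<open>Exact 1-forms in the bracket\<close>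

definition differential :: "('e::euclidean_space \<Rightarrow> real) \<Rightarrow> 'e \<Rightarrow> 'e \<Rightarrow>\<^sub>L real" where
  "differential f x = Blinfun (frechet_derivative f (at x))"

lemma differential_apply:
  assumes "f differentiable (at x)"
  shows "blinfun_apply (differential f x) = frechet_derivative f (at x)"
  unfolding differential_def
  using assms by (intro bounded_linear_Blinfun_apply) (rule frechet_derivative_works[THEN iffD1, THEN has_derivative_bounded_linear])

lemma smooth_on_differential:
  fixes f :: "'e::euclidean_space \<Rightarrow> real"
  assumes "open V" "smooth_on V f"
  shows "smooth_on V (differential f)"
proof (rule smooth_on_cong[OF assms(1)])
  show "(\<Sum>i\<in>Basis. frechet_derivative f (at x) i *\<^sub>R blinfun_inner_right i) = differential f x" if "x \<in> V" for x
    using blinfun_basis_sum[of "differential f x"] smooth_on_differentiable[OF assms(2) that]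
    by (simp add: differential_apply)
  show "smooth_on V (\<lambda>x. \<Sum>i\<in>Basis. frechet_derivative f (at x) i *\<^sub>R blinfun_inner_right i)"
    by (intro smooth_on_sum smooth_on_scaleR smooth_on_const smooth_on_derivative assms)
qed

lemma ext_d_one_form:
  fixes \<theta> :: "'e::euclidean_space \<Rightarrow> 'e \<Rightarrow>\<^sub>L real"
  shows "ext_d (\<lambda>y. one_form (\<theta> y)) x [u, z] = frechet_derivative (\<lambda>y. blinfun_apply (\<theta> y) z) (at x) u -
    frechet_derivative (\<lambda>y. blinfun_apply (\<theta> y) u) (at x) z"
  by (simp add: ext_d_Cons ext_d_Nil) (simp add: contract_def one_form_def)

lemma ext_d_differential:
  fixes f :: "'e::euclidean_space \<Rightarrow> real"
  assumes V: "open V" "x \<in> V" and f: "smooth_on V f"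
  shows "ext_d (\<lambda>y. one_form (differential f y)) x [u, z] = (0 :: real)"
proof -
  have "frechet_derivative (\<lambda>y. blinfun_apply (differential f y) a) (at x) =
      frechet_derivative (\<lambda>y. frechet_derivative f (at y) a) (at x)" for a
    using smooth_on_differentiable[OF f] by (intro frechet_derivative_cong_open[OF V]) (simp add: differential_apply)
  then show ?thesis
    by (simp add: ext_d_one_form second_derivative_symmetric[OF V f, of z u])
qed

text \<open>A pure covector has no vector part to differentiate along or to insert in
  \<open>H\<close>, and the only remaining term contains the exterior derivative of
  \<open>differential f\<close>, which is zero.\<close>

lemma gen_bracket_exact_left:
  fixes f :: "'e::euclidean_space \<Rightarrow> real"
  assumes V: "open V" "x \<in> V" and f: "smooth_on V f" and a: "a differentiable (at x)"
    and H: "alternating_form (H x)"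
  shows "gen_bracket H (\<lambda>y. (0, differential f y)) a x = 0"
proof -
  have a': "(a has_derivative frechet_derivative a (at x)) (at x)"
    using a frechet_derivative_works by blast
  have Y: "(\<lambda>y. fst (a y)) differentiable (at x)"
    using has_derivative_fst[OF a'] differentiable_def by blast
  have T: "(\<lambda>y. blinfun_apply (snd (a y)) z) differentiable (at x)" for z
    using bounded_linear.has_derivative[OF bounded_bilinear.bounded_linear_left[OF bounded_bilinear_blinfun_apply] has_derivative_snd[OF a']]
      differentiable_def by blast
  have "H x [fst (a x), 0, z] = 0" for z
    using linear_0[OF alternating_linear[OF H, of "[fst (a x)]" "[z]"]] by simp
  moreover have "ext_d (\<lambda>y. one_form (snd (a y))) x [0, z] = (0 :: real)" for z
    using linear_0[OF linear_frechet_derivative[OF T[of z]]] by (simp add: ext_d_one_form)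
  ultimately show ?thesis
    using linear_0[OF linear_frechet_derivative[OF Y]]
    by (simp add: gen_bracket_def lie_bracket_def lie_derivative_def contract_def o_def
        ext_d_differential[OF V f] zero_prod_def zero_blinfun_def)
qed

text \<open>The Lie derivative of an exact form is the differential of a function, while the term in
  \<open>H\<close> vanishes because one inserted vector is zero.\<close>

lemma gen_bracket_exact_right:
  fixes g :: "'e::euclidean_space \<Rightarrow> real"
  assumes V: "open V" "x \<in> V" and g: "smooth_on V g" and a: "a differentiable (at x)"
    and H: "alternating_form (H x)"
  shows "gen_bracket H a (\<lambda>y. (0, differential g y)) x =
    (0, differential (\<lambda>y. blinfun_apply (differential g y) (fst (a y))) x)"
proof -
  have a': "(a has_derivative frechet_derivative a (at x)) (at x)"
    using a frechet_derivative_works by blast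
  have Y: "(\<lambda>y. fst (a y)) differentiable (at x)"
    using has_derivative_fst[OF a'] differentiable_def by blast
  have T: "(\<lambda>y. blinfun_apply (snd (a y)) z) differentiable (at x)" for z
    using bounded_linear.has_derivative[OF bounded_bilinear.bounded_linear_left[OF bounded_bilinear_blinfun_apply] has_derivative_snd[OF a']]
      differentiable_def by blast
  have "H x [0, fst (a x), z] = 0" for z
    using linear_0[OF alternating_linear_hd[OF H, of "[fst (a x), z]"]] by simp
  moreover have "ext_d (\<lambda>y. one_form (snd (a y))) x [0, z] = (0 :: real)" for z
    using linear_0[OF linear_frechet_derivative[OF T[of z]]] by (simp add: ext_d_one_form)
  ultimately show ?thesis
    using linear_0[OF linear_frechet_derivative[OF Y]]
    by (simp add: gen_bracket_def lie_bracket_def lie_derivative_def contract_def o_def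
        ext_d_differential[OF V g] zero_blinfun_def[symmetric] differential_def[of "\<lambda>y. blinfun_apply (differential g y) (fst (a y))"])
qed

section \<open>The structure and its spinor on one coordinate image\<close>

locale generalized_complex_chart =
  fixes S :: "'e::euclidean_space set" and H :: "'e \<Rightarrow> ('e, real) form"
    and J :: "'e \<Rightarrow> 'e gtan \<Rightarrow> 'e gtan" and \<rho> :: "'e \<Rightarrow> ('e, complex) form" and v :: "'e \<Rightarrow> 'e gtan"
  assumes open_S: "open S"
    and J_linear: "\<And>x. x \<in> S \<Longrightarrow> linear (J x)"
    and J_smooth: "\<And>u. smooth_on S (\<lambda>x. J x u)"
    and J_square: "\<And>x u. x \<in> S \<Longrightarrow> J x (J x u) = - u"
    and involutive: "\<And>V p q x. open V \<Longrightarrow> V \<subseteq> S \<Longrightarrow> smooth_on V p \<Longrightarrow> smooth_on V q \<Longrightarrow>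
      (\<And>x. x \<in> V \<Longrightarrow> p x \<in> eigenbundle (J x)) \<Longrightarrow> (\<And>x. x \<in> V \<Longrightarrow> q x \<in> eigenbundle (J x)) \<Longrightarrow> x \<in> V \<Longrightarrow>
      complex_bracket H p q x \<in> eigenbundle (J x)"
    and H_alt: "\<And>x. x \<in> S \<Longrightarrow> alternating_form (H x)"
    and H_degree: "\<And>x. x \<in> S \<Longrightarrow> has_degree 3 (H x)"
    and \<rho>_smooth: "\<And>vs. smooth_on S (\<lambda>x. \<rho> x vs)"
    and \<rho>_canonical: "\<And>x. x \<in> S \<Longrightarrow> \<rho> x \<in> canonical_fibre (J x)"
    and \<rho>_nonzero: "\<And>x. x \<in> S \<Longrightarrow> \<exists>vs. \<rho> x vs \<noteq> 0"
    and twisted: "\<And>x. x \<in> S \<Longrightarrow> twisted_d H \<rho> x = clifford (v x) (\<rho> x)"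
begin

abbreviation P where "P \<equiv> \<lambda>y \<xi>. fst (J y (0, \<xi>))"
abbreviation \<nu> where "\<nu> \<equiv> \<lambda>y. mukai (\<rho> y) (cnj_form (\<rho> y))"

lemma \<rho>_alt: "x \<in> S \<Longrightarrow> alternating_form (\<rho> x)"
  using \<rho>_canonical by (simp add: canonical_fibre_def)

lemma J_skew: "x \<in> S \<Longrightarrow> pairing (J x u) w = - pairing u (J x w)"
  using \<rho>_nonzero[of x] pairing_skew[OF \<rho>_canonical J_linear J_square] by blast

lemma skew_map_P:
  assumes "x \<in> S"
  shows "skew_map (P x)"
  unfolding skew_map_def
proof (intro conjI allI)
  have "(0 :: 'e, \<xi> + \<eta>) = (0, \<xi>) + (0, \<eta>)" "(0 :: 'e, r *\<^sub>R \<xi>) = r *\<^sub>R (0, \<xi>)" for \<xi> \<eta> :: "'e \<Rightarrow>\<^sub>L real" and r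
    by simp_all
  then show "linear (P x)"
    using linear_add[OF J_linear[OF assms]] linear_scale[OF J_linear[OF assms]]
    by (intro linearI) (simp_all only: fst_add fst_scaleR)
  show "blinfun_apply \<eta> (P x \<xi>) = - blinfun_apply \<xi> (P x \<eta>)" for \<xi> \<eta>
    using J_skew[OF assms, of "(0, \<xi>)" "(0, \<eta>)"] by simp
qed

lemma smooth_on_J: "open V \<Longrightarrow> V \<subseteq> S \<Longrightarrow> smooth_on V u \<Longrightarrow> smooth_on V (\<lambda>x. J x (u x))"
  by (rule smooth_on_endomorphism) (auto intro: J_linear smooth_on_subset[OF J_smooth])

lemma smooth_on_hamiltonian:
  assumes "open V" "V \<subseteq> S" "smooth_on V f"
  shows "smooth_on V (\<lambda>y. P y (differential f y))"
  by (intro smooth_on_bounded_linear[OF assms(1) bounded_linear_fst] smooth_on_J smooth_on_Pair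
      smooth_on_const smooth_on_differential assms)

lemma poisson_bracket_eq:
  "f differentiable (at y) \<Longrightarrow> poisson_bracket P g f y = blinfun_apply (differential f y) (P y (differential g y))"
  by (simp add: poisson_bracket_def differential_apply differential_def[of g])

text \<open>The section \<open>df - i J df\<close> of \<open>L\<close> is the pair \<open>(df, - J df)\<close>, and the Dorfman bracket of
  two of these is \<open>(- [J df, J dg], - d{f, g})\<close>.\<close>

lemma hamiltonian_bracket:
  assumes V: "open V" "V \<subseteq> S" "x \<in> V" and f: "smooth_on V f" and g: "smooth_on V g"
  shows "P x (differential (poisson_bracket P f g) x) =
    lie_bracket (\<lambda>y. P y (differential f y)) (\<lambda>y. P y (differential g y)) x"
proof -
  define w where "w f y = J y (0, differential f y)" for f y
  define p where "p f y = ((0 :: 'e, differential f y), - w f y)" for f y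
  have sm: "smooth_on V (w f)" "smooth_on V (p f)" if "smooth_on V f" for f
  proof -
    have d: "smooth_on V (\<lambda>y. (0 :: 'e, differential f y))"
      by (intro smooth_on_Pair smooth_on_const smooth_on_differential V that)
    then show w: "smooth_on V (w f)" unfolding w_def by (rule smooth_on_J[OF V(1,2)])
    show "smooth_on V (p f)" unfolding p_def by (intro smooth_on_Pair smooth_on_minus d w V)
  qed
  have eig: "p f y \<in> eigenbundle (J y)" if "y \<in> V" for f y
  proof -
    have y: "y \<in> S" using that V(2) by blast
    show ?thesis
      using linear_neg[OF J_linear[OF y], of "w f y"] J_square[OF y, of "(0, differential f y)"]
      by (simp add: p_def w_def eigenbundle_def)
  qed
  have dw: "w f differentiable (at x)" if "smooth_on V f" for f
    using sm(1)[OF that] V(3) by (rule smooth_on_differentiable)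
  have dmw: "(\<lambda>y. - w f y) differentiable (at x)" if "smooth_on V f" for f
    using dw[OF that] by simp
  have Hx: "alternating_form (H x)" using H_alt V by blast
  have "complex_bracket H (p f) (p g) x \<in> eigenbundle (J x)"
    by (rule involutive[OF V(1,2) sm(2)[OF f] sm(2)[OF g] eig eig V(3)])
  \<comment> \<open>Every bracket with an exact form on the left vanishes. The real part keeps only
    the bracket of the two \<open>J\<close> terms, the imaginary part only an exact form.\<close>
  moreover have "complex_bracket H (p f) (p g) x =
      (- gen_bracket H (\<lambda>y. - w f y) (\<lambda>y. - w g y) x,
       (0, differential (\<lambda>y. blinfun_apply (differential g y) (fst (- w f y))) x))"
  proof -
    have d0: "(\<lambda>y. (0 :: 'e, differential g y)) differentiable (at x)"
      by (rule smooth_on_differentiable[OF smooth_on_Pair V(3)])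
         (intro smooth_on_const smooth_on_differential V g)+
    show ?thesis
      unfolding complex_bracket_def p_def o_def fst_conv snd_conv
      by (simp only: gen_bracket_exact_left[where H = H and a = "\<lambda>y. (0, differential g y)", OF V(1,3) f d0 Hx]
          gen_bracket_exact_left[where H = H and a = "\<lambda>y. - w g y", OF V(1,3) f dmw[OF g] Hx]
          gen_bracket_exact_right[where H = H and a = "\<lambda>y. - w f y", OF V(1,3) g dmw[OF f] Hx]) simp
  qed
  \<comment> \<open>The eigenbundle condition says that \<open>J\<close> sends the imaginary part to
    the real part; the vector component of this equation is the claim.\<close>
  ultimately have "J x (0, differential (\<lambda>y. blinfun_apply (differential g y) (fst (- w f y))) x) =
      - gen_bracket H (\<lambda>y. - w f y) (\<lambda>y. - w g y) x"
    by (simp add: eigenbundle_def)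
  moreover have "fst (gen_bracket H (\<lambda>y. - w f y) (\<lambda>y. - w g y) x) =
      lie_bracket (\<lambda>y. P y (differential f y)) (\<lambda>y. P y (differential g y)) x"
  proof -
    have d: "((\<lambda>y. P y (differential f y)) has_derivative frechet_derivative (\<lambda>y. P y (differential f y)) (at x)) (at x)"
      if "smooth_on V f" for f
      by (rule smooth_on_has_derivative[OF smooth_on_hamiltonian[OF V(1,2) that] V(3)])
    have m: "frechet_derivative (\<lambda>y. - P y (differential f y)) (at x) z = - frechet_derivative (\<lambda>y. P y (differential f y)) (at x) z"
      if "smooth_on V f" for f z
      unfolding frechet_derivative_at[OF has_derivative_minus[OF d[OF that]], symmetric] ..
    have "fst (gen_bracket H (\<lambda>y. - w f y) (\<lambda>y. - w g y) x) =
        lie_bracket (\<lambda>y. - P y (differential f y)) (\<lambda>y. - P y (differential g y)) x"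
      by (simp add: gen_bracket_def o_def w_def Let_def)
    then show ?thesis
      unfolding lie_bracket_def m[OF f] m[OF g] linear_neg[OF has_derivative_linear[OF d[OF f]]]
        linear_neg[OF has_derivative_linear[OF d[OF g]]] by simp
  qed
  moreover have "differential (\<lambda>y. blinfun_apply (differential g y) (fst (- w f y))) x =
      - differential (poisson_bracket P f g) x"
  proof -
    have eq: "blinfun_apply (differential g y) (fst (- w f y)) = - poisson_bracket P f g y" if "y \<in> V" for y
      using poisson_bracket_eq[OF smooth_on_differentiable[OF g that], of f]
      by (simp add: w_def blinfun.minus_right)
    have s: "smooth_on V (\<lambda>y. blinfun_apply (differential g y) (fst (- w f y)))"
      by (intro smooth_on_bounded_bilinear[OF V(1) bounded_bilinear_blinfun_apply] smooth_on_differential V g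
          smooth_on_bounded_linear[OF V(1) bounded_linear_fst] smooth_on_minus sm f)
    have "smooth_on V (poisson_bracket P f g)"
      by (rule smooth_on_cong[OF V(1) _ smooth_on_minus[OF V(1) s]]) (simp only: eq minus_minus)
    then have d: "(poisson_bracket P f g has_derivative frechet_derivative (poisson_bracket P f g) (at x)) (at x)"
      using V(3) by (rule smooth_on_has_derivative)
    have "frechet_derivative (\<lambda>y. blinfun_apply (differential g y) (fst (- w f y))) (at x) =
        frechet_derivative (\<lambda>y. - poisson_bracket P f g y) (at x)"
      by (rule frechet_derivative_cong_open[OF V(1,3) eq])
    also have "\<dots> = (\<lambda>z. - frechet_derivative (poisson_bracket P f g) (at x) z)"
      using frechet_derivative_at[OF has_derivative_minus[OF d]] by simp
    finally have eq2: "frechet_derivative (\<lambda>y. blinfun_apply (differential g y) (fst (- w f y))) (at x) =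
        (\<lambda>z. - frechet_derivative (poisson_bracket P f g) (at x) z)" .
    have "(\<lambda>y. blinfun_apply (differential g y) (fst (- w f y))) differentiable (at x)"
      "poisson_bracket P f g differentiable (at x)"
      using smooth_on_differentiable[OF s V(3)] d differentiable_def by blast+
    then show ?thesis
      by (intro blinfun_eqI) (simp only: differential_apply eq2 blinfun.minus_left)
  qed
  ultimately have "P x (- differential (poisson_bracket P f g) x) =
      - lie_bracket (\<lambda>y. P y (differential f y)) (\<lambda>y. P y (differential g y)) x"
    by simp
  moreover have "linear (P x)" using skew_map_P[of x] V by (auto simp: skew_map_def)
  ultimately show ?thesis
    using linear_neg[of "P x" "differential (poisson_bracket P f g) x"] by simp
qed


section \<open>The Jacobi identity of the bracket\<close>

lemma poisson_bracket_skew: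
  assumes "y \<in> S" "f differentiable (at y)" "g differentiable (at y)"
  shows "poisson_bracket P g f y = - poisson_bracket P f g y"
  unfolding poisson_bracket_eq[OF assms(2)] poisson_bracket_eq[OF assms(3)]
  using skew_map_P[OF assms(1)] unfolding skew_map_def by blast

text \<open>Separates the Hessian of \<open>h\<close> from the derivative of the Hamiltonian field
  of \<open>g\<close>; in the Jacobi sum the two kinds of terms cancel for different
  reasons.\<close>

lemma poisson_bracket_derivative:
  assumes V: "open V" "V \<subseteq> S" "x \<in> V" and g: "smooth_on V g" and h: "smooth_on V h"
  shows "(poisson_bracket P g h has_derivative (\<lambda>u.
    frechet_derivative (\<lambda>y. frechet_derivative h (at y) (P x (differential g x))) (at x) u +
    frechet_derivative h (at x) (frechet_derivative (\<lambda>y. P y (differential g y)) (at x) u))) (at x)"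
proof -
  let ?X = "\<lambda>y. P y (differential g y)"
  have X: "(?X has_derivative frechet_derivative ?X (at x)) (at x)"
    by (rule smooth_on_has_derivative[OF smooth_on_hamiltonian[OF V(1,2) g] V(3)])
  have d: "(differential h has_derivative frechet_derivative (differential h) (at x)) (at x)"
    by (rule smooth_on_has_derivative[OF smooth_on_differential[OF V(1) h] V(3)])
  have dh: "blinfun_apply (differential h y) = frechet_derivative h (at y)" if "y \<in> V" for y
    by (rule differential_apply[OF smooth_on_differentiable[OF h that]])
  have *: "blinfun_apply (frechet_derivative (differential h) (at x) u) z =
      frechet_derivative (\<lambda>y. frechet_derivative h (at y) z) (at x) u" for u z
  proof -
    have "((\<lambda>y. blinfun_apply (differential h y) z) has_derivative
        (\<lambda>u. blinfun_apply (frechet_derivative (differential h) (at x) u) z)) (at x)"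
      by (rule bounded_linear.has_derivative[OF bounded_bilinear.bounded_linear_left[OF bounded_bilinear_blinfun_apply] d])
    from frechet_derivative_at[OF this] frechet_derivative_cong_open[OF V(1,3), of "\<lambda>y. blinfun_apply (differential h y) z"
        "\<lambda>y. frechet_derivative h (at y) z"]
    show ?thesis by (simp add: dh) metis
  qed
  have "((\<lambda>y. blinfun_apply (differential h y) (?X y)) has_derivative
      (\<lambda>u. blinfun_apply (differential h x) (frechet_derivative ?X (at x) u) +
        blinfun_apply (frechet_derivative (differential h) (at x) u) (?X x))) (at x)"
    by (rule bounded_bilinear.FDERIV[OF bounded_bilinear_blinfun_apply d X])
  then have "((\<lambda>y. blinfun_apply (differential h y) (?X y)) has_derivative (\<lambda>u.
      frechet_derivative (\<lambda>y. frechet_derivative h (at y) (?X x)) (at x) u +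
      frechet_derivative h (at x) (frechet_derivative ?X (at x) u))) (at x)"
    by (simp only: * dh[OF V(3)] add.commute)
  then show ?thesis
    by (rule has_derivative_transform_within_open[OF _ V(1,3)])
       (simp add: poisson_bracket_eq smooth_on_differentiable[OF h])
qed

text \<open>The Hessian terms of the first two brackets cancel by symmetry, leaving the Lie bracket
  of the Hamiltonian fields of \<open>f\<close> and \<open>g\<close> applied to \<open>h\<close>.
  The third bracket is its negative by \<open>hamiltonian_bracket\<close>.\<close>

lemma jacobi_identity:
  assumes V: "open V" "V \<subseteq> S" "x \<in> V" and f: "smooth_on V f" and g: "smooth_on V g" and h: "smooth_on V h"
  shows "poisson_bracket P f (poisson_bracket P g h) x + poisson_bracket P g (poisson_bracket P h f) x +
    poisson_bracket P h (poisson_bracket P f g) x = 0"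
proof -
  let ?X = "\<lambda>f y. P y (differential f y)"
  let ?D = "\<lambda>f z. frechet_derivative f (at x) z"
  let ?H = "\<lambda>z u. ?D (\<lambda>y. frechet_derivative h (at y) z) u"
  have br: "poisson_bracket P f (poisson_bracket P g h) x =
      ?H (?X g x) (?X f x) + ?D h (?D (?X g) (?X f x))" if f: "smooth_on V f" and g: "smooth_on V g" for f g
    using frechet_derivative_at[OF poisson_bracket_derivative[OF V g h], symmetric]
    by (simp add: poisson_bracket_def[of _ f] differential_def)
  have s: "x \<in> S" using V by blast
  have d: "poisson_bracket P f g differentiable (at x)" if "smooth_on V f" "smooth_on V g" for f g
    using poisson_bracket_derivative[OF V that] differentiable_def by blast
  have "poisson_bracket P g (poisson_bracket P h f) x = - poisson_bracket P g (poisson_bracket P f h) x"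
  proof -
    have "frechet_derivative (poisson_bracket P h f) (at x) = frechet_derivative (\<lambda>y. - poisson_bracket P f h y) (at x)"
      using V(2) by (intro frechet_derivative_cong_open[OF V(1,3)] poisson_bracket_skew
          smooth_on_differentiable[OF h] smooth_on_differentiable[OF f]) auto
    also have "\<dots> = (\<lambda>u. - frechet_derivative (poisson_bracket P f h) (at x) u)"
      using frechet_derivative_at[OF has_derivative_minus[OF poisson_bracket_derivative[OF V f h]]]
        frechet_derivative_at[OF poisson_bracket_derivative[OF V f h]] by metis
    finally show ?thesis by (simp add: poisson_bracket_def)
  qed
  moreover have "poisson_bracket P h (poisson_bracket P f g) x = - ?D h (?D (?X g) (?X f x) - ?D (?X f) (?X g x))"
  proof -
    have "poisson_bracket P h (poisson_bracket P f g) x = - poisson_bracket P (poisson_bracket P f g) h x"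
      by (rule poisson_bracket_skew[OF s d[OF f g] smooth_on_differentiable[OF h V(3)]])
    also have "poisson_bracket P (poisson_bracket P f g) h x = ?D h (P x (differential (poisson_bracket P f g) x))"
      by (simp add: poisson_bracket_def differential_def)
    finally show ?thesis by (simp add: hamiltonian_bracket[OF V f g] lie_bracket_def)
  qed
  moreover have "?D h (?D (?X g) (?X f x) - ?D (?X f) (?X g x)) = ?D h (?D (?X g) (?X f x)) - ?D h (?D (?X f) (?X g x))"
    by (rule linear_diff[OF linear_frechet_derivative[OF smooth_on_differentiable[OF h V(3)]]])
  ultimately show ?thesis
    using br[OF f g] br[OF g f] second_derivative_symmetric[OF V(1,3) h, of "?X g x" "?X f x"] by simp
qed

section \<open>The Poisson tensor and its derivative in linear coordinates\<close>

abbreviation "P' x \<equiv> \<lambda>k \<xi>. fst (frechet_derivative (\<lambda>y. J y (0, \<xi>)) (at x) k)"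

lemma P_has_derivative:
  assumes "x \<in> S"
  shows "((\<lambda>y. P y \<xi>) has_derivative (\<lambda>k. P' x k \<xi>)) (at x)"
  by (rule has_derivative_fst[OF smooth_on_has_derivative[OF J_smooth assms]])

lemma skew_map_P':
  assumes x: "x \<in> S"
  shows "skew_map (P' x k)"
proof -
  note d = P_has_derivative[OF x]
  have eq: "f' k = g' k"
    if "(f has_derivative f') (at x)" "(g has_derivative g') (at x)" "\<And>y. y \<in> S \<Longrightarrow> f y = g y"
    for f g :: "'e \<Rightarrow> 'b::real_normed_vector" and f' g'
    using has_derivative_unique[OF has_derivative_transform_within_open[OF that(1) open_S x that(3)] that(2)] by simp
  have L: "linear (P y)" and K: "blinfun_apply \<eta> (P y \<xi>) = - blinfun_apply \<xi> (P y \<eta>)" if "y \<in> S" for y \<xi> \<eta>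
    using skew_map_P[OF that] unfolding skew_map_def by blast+
  have "linear (P' x k)"
  proof (rule linearI)
    show "P' x k (\<xi> + \<eta>) = P' x k \<xi> + P' x k \<eta>" for \<xi> \<eta>
      by (rule eq[OF d has_derivative_add[OF d d]]) (rule linear_add[OF L])
    show "P' x k (r *\<^sub>R \<xi>) = r *\<^sub>R P' x k \<xi>" for r \<xi>
      by (rule eq[OF d has_derivative_scaleR_right[OF d]]) (rule linear_scale[OF L])
  qed
  moreover have "blinfun_apply \<eta> (P' x k \<xi>) = - blinfun_apply \<xi> (P' x k \<eta>)" for \<xi> \<eta>
    by (rule eq[OF bounded_linear.has_derivative[OF blinfun.bounded_linear_right d]
          has_derivative_minus[OF bounded_linear.has_derivative[OF blinfun.bounded_linear_right d]]])
       (rule K)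
  ultimately show ?thesis unfolding skew_map_def by blast
qed

text \<open>Coordinate functions have constant differentials, so their brackets are the coefficients
  of \<open>P\<close> and the iterated brackets are derivatives of these along Hamiltonian
  directions.\<close>

lemma jacobi_coordinates:
  assumes x: "x \<in> S"
  shows "bcoeff (P' x (P x (blinfun_inner_right l))) i j + bcoeff (P' x (P x (blinfun_inner_right i))) j l +
    bcoeff (P' x (P x (blinfun_inner_right j))) l i = 0"
proof -
  have inner_derivative: "((\<lambda>y. y \<bullet> i) has_derivative (\<lambda>y. y \<bullet> i)) (at y)" for i y :: 'e
    by (rule bounded_linear_imp_has_derivative[OF bounded_linear_inner_left])
  have inner: "frechet_derivative (\<lambda>y. y \<bullet> i) (at y) = (\<lambda>z. z \<bullet> i)" for i y :: 'e
    using frechet_derivative_at[OF inner_derivative] by metis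
  have B: "Blinfun (\<lambda>z. z \<bullet> i) = blinfun_inner_right i" for i :: 'e
    by (rule blinfun_eqI) (simp add: bounded_linear_Blinfun_apply bounded_linear_inner_left inner_commute)
  have 1: "poisson_bracket P (\<lambda>y. y \<bullet> i) (\<lambda>y. y \<bullet> j) = (\<lambda>y. bcoeff (P y) i j)" for i j
    by (simp add: poisson_bracket_def inner B fun_eq_iff)
  have "frechet_derivative (\<lambda>y. bcoeff (P y) i j) (at x) k = bcoeff (P' x k) i j" for i j k
    using frechet_derivative_at[OF has_derivative_inner_left[OF P_has_derivative[OF x]]] by metis
  then have 2: "poisson_bracket P (\<lambda>y. y \<bullet> l) (poisson_bracket P (\<lambda>y. y \<bullet> i) (\<lambda>y. y \<bullet> j)) x =
      bcoeff (P' x (P x (blinfun_inner_right l))) i j" for l i j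
    unfolding 1 by (simp add: poisson_bracket_def inner B)
  have "smooth_on S (\<lambda>y. y \<bullet> i)" for i
    by (rule smooth_on_bounded_linear[OF open_S bounded_linear_inner_left smooth_on_id[OF open_S]])
  then show ?thesis
    using jacobi_identity[OF open_S order_refl x, of "\<lambda>y. y \<bullet> l" "\<lambda>y. y \<bullet> i" "\<lambda>y. y \<bullet> j"] by (simp only: 2)
qed

section \<open>The derivative of the spinor along \<open>P \<xi>\<close>\<close>

abbreviation "\<rho>' x \<equiv> \<lambda>k vs. frechet_derivative (\<lambda>y. \<rho> y vs) (at x) k"

lemma \<rho>_derivative: "x \<in> S \<Longrightarrow> form_has_derivative \<rho> (\<rho>' x) x"
  unfolding form_has_derivative_def using smooth_on_has_derivative[OF \<rho>_smooth] by blast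

lemma \<rho>'_alt: "x \<in> S \<Longrightarrow> alternating_form (\<rho>' x k)"
  by (rule alternating_derivative[OF \<rho>_derivative open_S _ \<rho>_alt])

text \<open>A form of odd degree anticommutes with covectors and, up to its own contraction, with
  vectors.\<close>

lemma clifford_wedge_three_form:
  assumes H: "has_degree 3 \<eta>"
  shows "clifford u (wedge \<eta> \<phi>) vs = wedge (contract (fst u) \<eta>) \<phi> vs - wedge \<eta> (clifford u \<phi>) vs"
proof -
  have g: "grading \<eta> = (\<lambda>vs. - \<eta> vs)" using has_degree_grading[OF H] by (simp add: fun_eq_iff)
  have "wedge (one_form (snd u)) \<eta> = (\<lambda>vs. - wedge \<eta> (one_form (snd u)) vs)"
    by (rule ext) (simp only: wedge_one_form_commute g wedge_minus_left)
  then have "wedge (one_form (snd u)) (wedge \<eta> \<phi>) vs = - wedge \<eta> (wedge (one_form (snd u)) \<phi>) vs"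
    by (simp only: wedge_assoc[symmetric] wedge_minus_left)
  then show ?thesis
    by (simp add: clifford_def contract_wedge g wedge_linear)
qed

text \<open>Applying \<open>d\<^sub>H\<close> to \<open>(J \<xi>) \<rho> = - i \<xi> \<rho>\<close> for a constant covector \<open>\<xi>\<close>.\<close>

lemma hamiltonian_derivative:
  fixes \<xi> :: "'e \<Rightarrow>\<^sub>L real"
  assumes x: "x \<in> S"
  defines "w \<equiv> \<lambda>y. J y (0, \<xi>)"
  defines "w' \<equiv> frechet_derivative w (at x)"
  shows "\<rho>' x (fst (w x)) vs + (\<Sum>k\<in>Basis. wedge (one_form (blinfun_inner_right k)) (clifford (w' k) (\<rho> x)) vs) +
      wedge (contract (fst (w x)) (complexify (H x))) (\<rho> x) vs =
    (of_real (pairing (w x) (v x)) + \<i> * of_real (pairing (0, \<xi>) (v x))) * \<rho> x vs"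
proof -
  let ?e = "\<lambda>k. blinfun_inner_right k :: 'e \<Rightarrow>\<^sub>L real"
  let ?\<xi> = "(0, \<xi>) :: 'e gtan"
  let ?H = "complexify (H x)"
  note alt = \<rho>_alt[OF x] and alt' = \<rho>'_alt[OF x]
  have wd: "(w has_derivative w') (at x)"
    unfolding w_def w'_def by (rule smooth_on_has_derivative[OF J_smooth x])
  have eq: "clifford (w y) (\<rho> y) = (\<lambda>vs. - \<i> * clifford ?\<xi> (\<rho> y) vs)" if "y \<in> S" for y
    using canonical_fibreD[OF \<rho>_canonical[OF that] J_linear[OF that] J_square[OF that], of ?\<xi>]
    by (simp add: w_def flip: mult.assoc)
  have cd: "form_has_derivative (\<lambda>y. clifford (w y) (\<rho> y))
      (\<lambda>k vs. clifford (w' k) (\<rho> x) vs + clifford (w x) (\<rho>' x k) vs) x"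
    by (rule form_has_derivative_clifford[OF wd \<rho>_derivative[OF x] open_S x \<rho>_alt alt'])
  have "((\<lambda>y. ?\<xi>) has_derivative (\<lambda>k. 0)) (at x)" by simp
  from form_has_derivative_mult[OF form_has_derivative_clifford[OF this \<rho>_derivative[OF x] open_S x \<rho>_alt alt'], of "- \<i>"]
  have cd2: "form_has_derivative (\<lambda>y vs. - \<i> * clifford ?\<xi> (\<rho> y) vs)
      (\<lambda>k vs. - \<i> * (clifford 0 (\<rho> x) vs + clifford ?\<xi> (\<rho>' x k) vs)) x" .
  have "clifford 0 (\<rho> x) vs = 0" for vs
    by (rule linear_0[OF clifford_left_linear[OF alt]])
  then have K0: "clifford (w' k) (\<rho> x) vs + clifford (w x) (\<rho>' x k) vs = - \<i> * clifford ?\<xi> (\<rho>' x k) vs" for k vs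
    using form_has_derivative_unique[OF cd cd2 open_S x, of k vs] by (simp add: eq)
  have K: "clifford (w x) (\<rho>' x k) = (\<lambda>vs. - \<i> * clifford ?\<xi> (\<rho>' x k) vs + (-1) * clifford (w' k) (\<rho> x) vs)" for k
    unfolding K0[symmetric] by simp
  define d\<rho> where "d\<rho> = (\<lambda>vs. \<Sum>k\<in>Basis. clifford (0, ?e k) (\<rho>' x k) vs)"
  have d\<rho>: "d\<rho> = (\<lambda>vs. clifford (v x) (\<rho> x) vs - wedge ?H (\<rho> x) vs)"
  proof (rule ext)
    fix vs
    have "twisted_d H \<rho> x vs = d\<rho> vs + wedge ?H (\<rho> x) vs"
      by (simp add: twisted_d_def ext_d_eq[OF \<rho>_derivative[OF x]] d\<rho>_def clifford_covector[OF alt'])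
    then show "d\<rho> vs = clifford (v x) (\<rho> x) vs - wedge ?H (\<rho> x) vs" by (simp add: twisted[OF x])
  qed
  \<comment> \<open>Anticommuting \<open>w\<close> past each basis covector yields the components of
    its vector part, which assemble to the derivative of \<rho> along
    \<open>P \<xi>\<close>.\<close>
  have a: "clifford (w x) d\<rho> vs = \<rho>' x (fst (w x)) vs -
      (\<Sum>k\<in>Basis. clifford (0, ?e k) (clifford (w x) (\<rho>' x k)) vs)"
  proof -
    have "clifford (w x) (clifford (0, ?e k) (\<rho>' x k)) vs = of_real (fst (w x) \<bullet> k) * \<rho>' x k vs -
        clifford (0, ?e k) (clifford (w x) (\<rho>' x k)) vs" for k
      using clifford_clifford[OF alt', of "w x" "(0, ?e k)" k vs] by (simp add: inner_commute algebra_simps)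
    then show ?thesis
      unfolding d\<rho>_def clifford_sum
      using linear_basis_sum[OF form_has_derivative_linear[OF \<rho>_derivative[OF x], of vs], of "fst (w x)"]
      by (simp add: sum_subtractf scaleR_conv_of_real)
  qed
  \<comment> \<open>The differentiated relation \<open>K\<close> replaces \<open>w\<close> by -i
    times the constant \<xi>, at the price of the derivative of \<open>w\<close>; moving \<xi> to
    the front flips the sign since covectors anticommute.\<close>
  have b: "(\<Sum>k\<in>Basis. clifford (0, ?e k) (clifford (w x) (\<rho>' x k)) vs) =
      \<i> * clifford ?\<xi> d\<rho> vs - (\<Sum>k\<in>Basis. clifford (0, ?e k) (clifford (w' k) (\<rho> x)) vs)"
  proof -
    have "clifford (0, ?e k) (clifford ?\<xi> (\<rho>' x k)) vs = - clifford ?\<xi> (clifford (0, ?e k) (\<rho>' x k)) vs" for k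
      using clifford_clifford[OF alt', of ?\<xi> "(0, ?e k)" k vs] by (simp add: add_eq_0_iff)
    then show ?thesis
      unfolding d\<rho>_def clifford_sum K clifford_add clifford_mult
      by (simp add: sum.distrib sum_negf sum_distrib_left sum_subtractf)
  qed
  have c: "clifford u (clifford (v x) (\<rho> x)) vs = of_real (pairing u (v x)) * \<rho> x vs - clifford (v x) (clifford u (\<rho> x)) vs" for u
    using clifford_clifford[OF alt, of u "v x" vs] by (simp add: algebra_simps)
  have d: "clifford u (wedge ?H (\<rho> x)) vs = wedge (contract (fst u) ?H) (\<rho> x) vs - wedge ?H (clifford u (\<rho> x)) vs" for u
    by (rule clifford_wedge_three_form) (use H_degree[OF x] in \<open>simp add: has_degree_def complexify_def\<close>)
  have z: "contract 0 ?H = (\<lambda>vs. 0)"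
    using linear_0[OF alternating_linear_hd[OF alternating_complexify[OF H_alt[OF x]]]] by (auto simp: contract_def)
  \<comment> \<open>After anticommuting with \<open>v\<close> and with the 3-form, \<open>w\<close>
    and i \<xi> both act directly on \<rho>, where their sum is zero. Only the scalars and the
    contracted 3-form remain.\<close>
  have "clifford (w x) d\<rho> vs + \<i> * clifford ?\<xi> d\<rho> vs =
      (of_real (pairing (w x) (v x)) + \<i> * of_real (pairing ?\<xi> (v x))) * \<rho> x vs - wedge (contract (fst (w x)) ?H) (\<rho> x) vs"
    unfolding d\<rho> clifford_diff c d eq[OF x] clifford_mult wedge_mult_right
    by (simp add: z algebra_simps)
  then show ?thesis
    using a b
    by (simp add: clifford_covector[OF alternating_clifford[OF alt]] algebra_simps)
qed

end

text \<open>Pullback by a linear map is precomposition with \<open>map\<close>, which leaves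
  positions and hence shuffles unchanged; this gives the transformation rule of \<nu>.\<close>

lemma wedge_map:
  assumes "\<And>vs. \<alpha> vs = \<alpha>' (map B vs)" "\<And>vs. \<beta> vs = \<beta>' (map B vs)"
  shows "wedge \<alpha> \<beta> vs = wedge \<alpha>' \<beta>' (map B vs)"
  by (simp add: wedge_def assms nths_map)

context generalized_complex_chart
begin

section \<open>The volume form and its derivative along \<open>P \<xi>\<close>\<close>

lemma \<nu>_alt: "x \<in> S \<Longrightarrow> alternating_form (\<nu> x)"
  by (intro alternating_mukai alternating_cnj_form \<rho>_alt)

lemma \<nu>_smooth: "smooth_on S (\<lambda>x. \<nu> x vs)"
proof (cases "length vs = DIM('e)")
  case True
  have "smooth_on S (\<lambda>x. (-1) ^ k * reversal (\<rho> x) us * cnj_form (\<rho> x) ws)" for k us ws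
    unfolding reversal_def cnj_form_def
    by (intro smooth_on_mult smooth_on_const smooth_on_bounded_linear[OF open_S bounded_linear_cnj] \<rho>_smooth open_S)
  then show ?thesis
    using True unfolding mukai_def wedge_def by (simp add: smooth_on_sum[OF open_S])
next
  case False
  then show ?thesis by (simp add: mukai_def smooth_on_const open_S)
qed

lemma \<nu>_nonzero:
  assumes "x \<in> S"
  shows "\<exists>vs. \<nu> x vs \<noteq> 0"
proof -
  obtain cs :: "'e list" where "distinct cs" "set cs = Basis"
    using finite_distinct_list[OF finite_Basis] by blast
  then show ?thesis
    using \<rho>_nonzero[OF assms] mukai_cnj_nonzero[OF \<rho>_canonical J_linear J_square] assms by blast
qed

abbreviation "\<nu>' x \<equiv> \<lambda>k vs. mukai (\<rho>' x k) (cnj_form (\<rho> x)) vs + mukai (\<rho> x) (cnj_form (\<rho>' x k)) vs"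

lemma \<nu>_derivative: "x \<in> S \<Longrightarrow> form_has_derivative \<nu> (\<nu>' x) x"
  by (intro form_has_derivative_mukai form_has_derivative_cnj \<rho>_derivative)

text \<open>The left side is the Lie derivative of \<nu> along \<open>P \<xi>\<close> for constant
  \<xi>. The derivative of \<rho> is a scalar multiple minus a real operator, and the symmetric part
  of that operator for the Mukai pairing is exactly the divergence.\<close>

lemma hamiltonian_divergence:
  fixes \<xi> :: "'e \<Rightarrow>\<^sub>L real"
  assumes x: "x \<in> S"
  shows "\<nu>' x (P x \<xi>) vs + (\<Sum>k\<in>Basis. of_real (P' x k \<xi> \<bullet> k) * \<nu> x vs) =
    of_real (blinfun_apply \<xi> ((-2) *\<^sub>R fst (J x (v x)))) * \<nu> x vs"
proof -
  define w where "w y = J y (0, \<xi>)" for y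
  define w' where "w' = frechet_derivative w (at x)"
  let ?e = "\<lambda>k. (0, blinfun_inner_right k) :: 'e gtan"
  define B where "B = contract (fst (w x)) (complexify (H x))"
  \<comment> \<open>The operator is built from real vectors, covectors and forms, so it commutes
    with conjugation and serves both spinors.\<close>
  define Q where "Q \<phi> = (\<lambda>vs. (\<Sum>k\<in>Basis. clifford (?e k) (clifford (w' k) \<phi>) vs) + wedge B \<phi> vs)" for \<phi>
  define lam where "lam = complex_of_real (pairing (w x) (v x)) + \<i> * complex_of_real (pairing (0, \<xi>) (v x))"
  let ?\<rho> = "\<rho> x" and ?\<sigma> = "cnj_form (\<rho> x)"
  note alt = \<rho>_alt[OF x]
  note alt\<sigma> = alternating_cnj_form[OF alt]
  have 1: "\<rho>' x (fst (w x)) = (\<lambda>vs. lam * ?\<rho> vs + (-1) * Q ?\<rho> vs)"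
  proof (rule ext)
    fix vs
    have "\<rho>' x (fst (w x)) vs + Q ?\<rho> vs = lam * ?\<rho> vs"
      using hamiltonian_derivative[OF x, where \<xi> = \<xi> and vs = vs]
      by (simp add: Q_def B_def lam_def w_def[abs_def] w'_def clifford_covector[OF alternating_clifford[OF alt]] add.assoc)
    then show "\<rho>' x (fst (w x)) vs = lam * ?\<rho> vs + (-1) * Q ?\<rho> vs"
      by (simp add: eq_diff_eq)
  qed
  have 2: "cnj_form (\<rho>' x (fst (w x))) = (\<lambda>vs. cnj lam * ?\<sigma> vs + (-1) * Q ?\<sigma> vs)"
  proof -
    have cl: "cnj (clifford u \<phi> vs) = clifford u (cnj_form \<phi>) vs" for u \<phi> vs
      using fun_cong[OF cnj_clifford, of u \<phi> vs] by (simp add: cnj_form_def)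
    have "cnj_form B = B" by (simp add: B_def cnj_form_def contract_def complexify_def)
    then have "cnj (Q ?\<rho> vs) = Q ?\<sigma> vs" for vs
      by (simp add: Q_def cl cnj_clifford cnj_wedge)
    then show ?thesis unfolding 1 by (simp add: cnj_form_def)
  qed
  \<comment> \<open>Self-adjointness reverses each two-letter word, so a word and its adjoint add up
    to a Clifford anticommutator, the k-th term of the divergence. The 2-form \<open>B\<close>
    changes sign under reversal and cancels.\<close>
  have 3: "mukai (Q ?\<rho>) ?\<sigma> vs + mukai ?\<rho> (Q ?\<sigma>) vs = (\<Sum>k\<in>Basis. of_real (P' x k \<xi> \<bullet> k) * \<nu> x vs)"
  proof -
    have "has_degree 2 B"
      using H_degree[OF x] by (auto simp: B_def has_degree_def contract_def complexify_def)
    then have "reversal B = (\<lambda>vs. (-1) * B vs)"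
      using has_degree_reversal[of 2 B] by (simp add: fun_eq_iff)
    then have b: "mukai (wedge B ?\<rho>) ?\<sigma> vs = - mukai ?\<rho> (wedge B ?\<sigma>) vs"
      unfolding mukai_wedge by (simp only: wedge_mult_left[abs_def] mukai_linear) simp
    have "mukai (clifford (?e k) (clifford (w' k) ?\<rho>)) ?\<sigma> vs + mukai ?\<rho> (clifford (?e k) (clifford (w' k) ?\<sigma>)) vs =
        of_real (P' x k \<xi> \<bullet> k) * \<nu> x vs" for k
    proof -
      have "mukai (clifford (?e k) (clifford (w' k) ?\<rho>)) ?\<sigma> vs = mukai ?\<rho> (clifford (w' k) (clifford (?e k) ?\<sigma>)) vs"
        by (simp add: mukai_clifford alternating_clifford alt alt\<sigma>)
      then have "mukai (clifford (?e k) (clifford (w' k) ?\<rho>)) ?\<sigma> vs + mukai ?\<rho> (clifford (?e k) (clifford (w' k) ?\<sigma>)) vs =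
          mukai ?\<rho> (\<lambda>vs. clifford (w' k) (clifford (?e k) ?\<sigma>) vs + clifford (?e k) (clifford (w' k) ?\<sigma>) vs) vs"
        by (simp only: mukai_linear)
      also have "\<dots> = of_real (pairing (w' k) (?e k)) * \<nu> x vs"
        by (simp only: clifford_clifford[OF alt\<sigma>] mukai_linear)
      finally show ?thesis by (simp add: w'_def w_def[abs_def] inner_commute)
    qed
    then show ?thesis
      unfolding Q_def mukai_linear mukai_sum_left mukai_sum_right b by (simp flip: sum.distrib)
  qed
  \<comment> \<open>Conjugation removes the imaginary part and doubles the real one; skewness of
    \<open>J\<close> then supplies the minus sign.\<close>
  have 4: "lam + cnj lam = of_real (blinfun_apply \<xi> ((-2) *\<^sub>R fst (J x (v x))))"
    using J_skew[OF x, of "(0, \<xi>)" "v x"]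
    by (simp add: complex_eq_iff lam_def w_def blinfun.scaleR_right blinfun.minus_right)
  have "\<nu>' x (P x \<xi>) vs = (lam + cnj lam) * \<nu> x vs - (mukai (Q ?\<rho>) ?\<sigma> vs + mukai ?\<rho> (Q ?\<sigma>) vs)"
    unfolding w_def[symmetric] unfolding 2 unfolding 1 mukai_linear by (simp add: algebra_simps)
  then show ?thesis unfolding 3 4 by simp
qed

lemma modular_equation_chart:
  assumes x: "x \<in> S"
  shows "ext_d (\<lambda>y. exp_bivector (P y) (\<nu> y)) x vs =
    contract ((-2) *\<^sub>R fst (J x (v x))) (exp_bivector (P x) (\<nu> x)) vs"
proof -
  interpret poisson_at P "P' x" \<nu> "\<nu>' x" x "(-2) *\<^sub>R fst (J x (v x))"
  proof
    show "alternating_form (\<nu>' x k)" for k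
      by (intro alternating_add alternating_mukai alternating_cnj_form \<rho>_alt \<rho>'_alt x)
    show "has_degree DIM('e) (\<nu>' x k)" for k
      using has_degree_mukai[of "\<rho>' x k" "cnj_form (\<rho> x)"] has_degree_mukai[of "\<rho> x" "cnj_form (\<rho>' x k)"]
      by (simp add: has_degree_def)
    show "\<nu>' x (P x (blinfun_inner_right i)) vs +
      (\<Sum>k\<in>Basis. of_real (bcoeff (P' x k) i k) * \<nu> x vs) = of_real ((-2) *\<^sub>R fst (J x (v x)) \<bullet> i) * \<nu> x vs" for i vs
      using hamiltonian_divergence[OF x, of "blinfun_inner_right i" vs] by (simp add: inner_commute)
  qed (intro P_has_derivative skew_map_P skew_map_P' jacobi_coordinates \<nu>_derivative \<nu>_alt has_degree_mukai x)+
  show ?thesis by (rule modular_equation_at)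
qed

text \<open>The component of degree m - 1 already decides: there the exponential reduces to \<nu>,
  and contraction into a nonzero top form is injective.\<close>

lemma modular_field_unique:
  assumes x: "x \<in> S"
    and eq: "\<And>vs. contract Y (exp_bivector (P x) (\<nu> x)) vs = contract X (exp_bivector (P x) (\<nu> x)) vs"
  shows "Y = X"
proof -
  obtain zs where zs: "\<nu> x zs \<noteq> 0" using \<nu>_nonzero[OF x] by blast
  have "\<nu> x (Y # vs) = \<nu> x (X # vs)" for vs
  proof (cases "length (Y # vs) = DIM('e)")
    case True
    then show ?thesis
      using eq[of vs] exp_bivector_top[OF has_degree_mukai, of "Y # vs"] exp_bivector_top[OF has_degree_mukai, of "X # vs"]
      by (simp add: contract_def)
  next
    case False
    then show ?thesis by (simp add: mukai_def)
  qed
  then have "contract (Y - X) (\<nu> x) vs = 0" for vs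
    using linear_diff[OF alternating_linear_hd[OF \<nu>_alt[OF x], of vs], of Y X] by (simp add: contract_def)
  from top_form_contract_eq_0[OF \<nu>_alt[OF x] has_degree_mukai zs this] show ?thesis by simp
qed

end

section \<open>Compatibility with changes of charts\<close>

theorem proposition3p27:
  fixes A :: "('m::{t2_space, second_countable_topology}, 'e::euclidean_space) chart set"
    and H :: "('m, 'e) chart \<Rightarrow> 'e \<Rightarrow> ('e, real) form"
    and J :: "('m, 'e) chart \<Rightarrow> 'e \<Rightarrow> 'e gtan \<Rightarrow> 'e gtan"
    and \<rho> :: "('m, 'e) chart \<Rightarrow> 'e \<Rightarrow> ('e, complex) form"
    and v :: "('m, 'e) chart \<Rightarrow> 'e \<Rightarrow> 'e gtan"
  assumes "smooth_atlas A"
    and "closed_three_form A H"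
    and "generalized_complex A H J"
    and "canonical_chern_class_zero A J"
    and "canonical_section A J UNIV \<rho>"
    and "nonvanishing_on A UNIV \<rho>"
    and "gen_section A v"
    and "\<forall>c\<in>A. \<forall>x\<in>region c UNIV. twisted_d (H c) (\<rho> c) x = clifford (v c x) (\<rho> c x)"
  shows "is_modular_vector_field A
           (\<lambda>c x \<xi>. fst (J c x (0, \<xi>)))
           (\<lambda>c x. mukai (\<rho> c x) (cnj_form (\<rho> c x)))
           (\<lambda>c x. (-2) *\<^sub>R fst (J c x (v c x)))"
proof -
  let ?P = "\<lambda>c x \<xi>. fst (J c x (0, \<xi>))"
  let ?\<nu> = "\<lambda>c x. mukai (\<rho> c x) (cnj_form (\<rho> c x))"
  let ?X = "\<lambda>c x. (-2) *\<^sub>R fst (J c x (v c x))"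
  note gc = assms(3)[unfolded generalized_complex_def]
  note J_square = gc[THEN conjunct2, THEN conjunct1, rule_format]
  note involutive = gc[THEN conjunct2, THEN conjunct2, rule_format]
  note J = gc[THEN conjunct1, unfolded gen_endomorphism_def]
  note J_chart = J[THEN conjunct1, rule_format]
  note J_related = J[THEN conjunct2, rule_format]
  have chart: "generalized_complex_chart (region c UNIV) (H c) (J c) (\<rho> c) (v c)" if c: "c \<in> A" for c
  proof (rule generalized_complex_chart.intro)
    show "open (region c UNIV)" using assms(1) c by (simp add: smooth_atlas_def)
    show "linear (J c x)" if "x \<in> region c UNIV" for x
      using J_chart[OF c, THEN conjunct1] that by (rule bspec)
    show "smooth_on (region c UNIV) (\<lambda>x. J c x u)" for u
      using J_chart[OF c, THEN conjunct2] by (rule spec)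
    show "J c x (J c x u) = - u" if "x \<in> region c UNIV" for x u
      by (rule J_square[OF c that])
    show "complex_bracket (H c) p q x \<in> eigenbundle (J c x)"
      if "open V" "V \<subseteq> region c UNIV" "smooth_on V p" "smooth_on V q"
        "\<And>x. x \<in> V \<Longrightarrow> p x \<in> eigenbundle (J c x)" "\<And>x. x \<in> V \<Longrightarrow> q x \<in> eigenbundle (J c x)" "x \<in> V" for V p q x
      by (rule involutive[OF c _ that(7)]) (intro conjI ballI that; assumption)
    show "alternating_form (H c x)" "has_degree 3 (H c x)" if "x \<in> region c UNIV" for x
      using assms(2) c that by (simp_all add: closed_three_form_def form_field_def)
    show "smooth_on (region c UNIV) (\<lambda>x. \<rho> c x vs)" for vs
      using assms(5) c by (simp add: canonical_section_def form_field_def)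
    show "\<rho> c x \<in> canonical_fibre (J c x)" if "x \<in> region c UNIV" for x
      using assms(5) c that by (simp add: canonical_section_def)
    show "\<exists>vs. \<rho> c x vs \<noteq> 0" if "x \<in> region c UNIV" for x
      using assms(6) c that by (simp add: nonvanishing_on_def)
    show "twisted_d (H c) (\<rho> c) x = clifford (v c x) (\<rho> c x)" if "x \<in> region c UNIV" for x
      using assms(8) c that by simp
  qed
  have jac_linear: "linear (jacobian c c' x)" if "c \<in> A" "c' \<in> A" "x \<in> region c (fst c')" for c c' x
  proof -
    have "smooth_on (region c (fst c')) (transition c c')"
      using assms(1) that(1,2) by (simp add: smooth_atlas_def)
    then show ?thesis by (rule linear_frechet_derivative[OF smooth_on_differentiable[OF _ that(3)]])
  qed
  have bivector: "bivector_field A ?P"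
    unfolding bivector_field_def
  proof (intro conjI ballI allI impI)
    fix c assume c: "c \<in> A"
    interpret generalized_complex_chart "region c UNIV" "H c" "J c" "\<rho> c" "v c" by (rule chart[OF c])
    show "linear (?P c x)" "blinfun_apply \<eta> (?P c x \<xi>) = - blinfun_apply \<xi> (?P c x \<eta>)" if "x \<in> region c UNIV" for x \<xi> \<eta>
      using skew_map_P[OF that] unfolding skew_map_def by blast+
    show "smooth_on (region c UNIV) (\<lambda>x. ?P c x \<xi>)" for \<xi>
      by (rule smooth_on_bounded_linear[OF open_S bounded_linear_fst J_smooth])
  next
    fix c c' x and \<xi> \<xi>' :: "'e \<Rightarrow>\<^sub>L real"
    assume *: "c \<in> A" "c' \<in> A" "x \<in> region c (fst c')"
      "\<forall>z. blinfun_apply \<xi> z = blinfun_apply \<xi>' (jacobian c c' x z)"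
    \<comment> \<open>Covectors that correspond under the Jacobian are related elements with zero
      vector part, so equivariance of \<open>J\<close> yields that of its block from T* to
      T.\<close>
    then have "related (jacobian c c' x) (0, \<xi>) (0, \<xi>')"
      by (simp add: related_def linear_0[OF jac_linear])
    from J_related[OF *(1-3) this] show "?P c' (transition c c' x) \<xi>' = jacobian c c' x (?P c x \<xi>)"
      by (simp add: related_def)
  qed
  have poisson: "poisson_structure A ?P"
    unfolding poisson_structure_def
  proof (intro conjI bivector ballI allI impI)
    fix c V x and f g h :: "'e \<Rightarrow> real"
    assume c: "c \<in> A" and V: "open V \<and> V \<subseteq> region c UNIV \<and> smooth_on V f \<and> smooth_on V g \<and> smooth_on V h" "x \<in> V"
    interpret generalized_complex_chart "region c UNIV" "H c" "J c" "\<rho> c" "v c" by (rule chart[OF c])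
    show "poisson_bracket (?P c) f (poisson_bracket (?P c) g h) x + poisson_bracket (?P c) g (poisson_bracket (?P c) h f) x +
        poisson_bracket (?P c) h (poisson_bracket (?P c) f g) x = 0"
      using V by (intro jacobi_identity[of V]) auto
  qed
  have volume: "volume_form A ?\<nu>"
    unfolding volume_form_def form_field_def nonvanishing_on_def
  proof (intro conjI ballI allI)
    fix c assume c: "c \<in> A"
    interpret generalized_complex_chart "region c UNIV" "H c" "J c" "\<rho> c" "v c" by (rule chart[OF c])
    show "alternating_form (?\<nu> c x)" "\<exists>vs. ?\<nu> c x vs \<noteq> 0" if "x \<in> region c UNIV" for x
      using \<nu>_alt[OF that] \<nu>_nonzero[OF that] by blast+
    show "smooth_on (region c UNIV) (\<lambda>x. ?\<nu> c x vs)" for vs by (rule \<nu>_smooth)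
  next
    fix c c' x and vs :: "'e list"
    assume *: "c \<in> A" "c' \<in> A" "x \<in> region c (fst c' \<inter> UNIV)"
    have "\<rho> c x vs = \<rho> c' (transition c c' x) (map (jacobian c c' x) vs)" for vs
      using assms(5) * by (simp add: canonical_section_def form_field_def)
    then show "?\<nu> c x vs = ?\<nu> c' (transition c c' x) (map (jacobian c c' x) vs)"
      unfolding mukai_def by (auto intro!: wedge_map simp: reversal_def cnj_form_def)
  qed (rule has_degree_mukai)
  have field: "vector_field A ?X"
    unfolding vector_field_def
  proof (intro conjI ballI)
    fix c assume c: "c \<in> A"
    interpret generalized_complex_chart "region c UNIV" "H c" "J c" "\<rho> c" "v c" by (rule chart[OF c])
    have "smooth_on (region c UNIV) (v c)" using assms(7) c by (simp add: gen_section_def)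
    then show "smooth_on (region c UNIV) (?X c)"
      by (intro smooth_on_scaleR smooth_on_const smooth_on_bounded_linear[OF open_S bounded_linear_fst] smooth_on_J open_S order_refl)
  next
    fix c c' x
    assume *: "c \<in> A" "c' \<in> A" "x \<in> region c (fst c')"
    then have "related (jacobian c c' x) (v c x) (v c' (transition c c' x))"
      using assms(7) by (simp add: gen_section_def)
    from J_related[OF * this] show "?X c' (transition c c' x) = jacobian c c' x (?X c x)"
      using linear_scale[OF jac_linear[OF *], of "-2"] by (simp add: related_def)
  qed
  have modular: "modular_equation A ?P ?\<nu> ?X"
    unfolding modular_equation_def
    using generalized_complex_chart.modular_equation_chart[OF chart] by blast
  \<comment> \<open>Both fields solve the modular equation with the same exterior derivative on the
    left, so their contractions agree.\<close>
  have "Y c x = ?X c x" if "modular_equation A ?P ?\<nu> Y" "c \<in> A" "x \<in> region c UNIV" for Y c x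
    using that modular unfolding modular_equation_def
    by (intro generalized_complex_chart.modular_field_unique[OF chart]) auto
  then show ?thesis
    unfolding is_modular_vector_field_def using poisson volume field modular by blast
qed

end
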